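(* Let $M\ge1$, let $\mathcal Y=\widetilde{\mathcal Y}_1\times\dots\times\widetilde{\mathcal Y}_M$ with the product sigma-algebra $\mathcal B_{\mathcal Y}$, and let $\{(X^t,Y^t)\}_{t\ge0}$, $Y^t=(Y^t_1,\dots,Y^t_M)$, be a time-homogeneous Markov chain on $(\mathcal X\times\mathcal Y,\ \mathcal B_{\mathcal X}\times\mathcal B_{\mathcal Y})$ satisfying: (A0) For all $x\in\mathcal X$, $y\in\mathcal Y$: $\mathbf P_{x,y}(X^1\in\cdot)=\mathbf P_x(X^1\in\cdot)$, so that $\{X^t\}$ is itself a Markov chain with autonomous dynamics. (A1) $\{X^t\}$ is aperiodic. (A2) There is $V\in\mathcal B_{\mathcal X}$ such that $\tau=\min\{t\ge1:X^t\in V\}<\infty$ $\mathbf P_x$-a.s. for every $x\in\mathcal X$ and $\sup_{x\in V}\mathbf E_x\tau<\infty$. (A3) There exist $0<p\le1$, a probability measure $\mu$ on $\mathcal X$ and an integer $m\ge1$ with $\mathbf P_x(X^m\in\cdot)\ge p\,\mu(\cdot)$ for all $x\in V$. Let $\pi$ be the (unique) stationary distribution of $\{X^t\}$. For each $i=1,\dots,M$ let $L_{2,i}:\widetilde{\mathcal Y}_i\to[0,\infty)$ be measurable. Assume that ($\widetilde{B1}$), ($\widetilde{B2}$) and ($\widetilde{B3}$) hold (or that ($\widetilde{B1}$) and ($\widehat B$) hold), where: ($\widetilde{B1}$) there is a constant $U<\infty$ such that for every $i$, $\sup_{x\in\mathcal X,\,y\in\mathcal Y}\mathbf E_{x,y}|L_{2,i}(Y^1_i)-L_{2,i}(Y^0_i)|\le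 U$; ($\widetilde{B2}$) for each $i$ there exist a function $h_i(N)$, $N\ge0$, with $h_i(N)\downarrow0$ as $N\to\infty$ and a measurable function $f_i:\mathcal X\to(-\infty,\infty)$ with $\sup_x|f_i(x)|<\infty$, $\int_{\mathcal X}f_i(x)\,\pi(dx)=:-\varepsilon_i<0$, and $$\mathbf E_{x,y}\bigl(L_{2,i}(Y^1_i)-L_{2,i}(y_i)\bigr)\le f_i(x)+h_i(L_{2,i}(y_i))\quad\text{for all }x\in\mathcal X,\ y\in\mathcal Y;$$ ($\widetilde{B3}$) for each $i$, $$\sup_{t\ge N}\ \sup_{y\in\mathcal Y,\,x\in V}\frac{\mathbf E_{x,y}\bigl(L_{2,i}(Y^t_i)-L_{2,i}(y_i)\bigr)}{t}\to0\quad\text{as }N\to\infty;$$ ($\widehat B$) for each $i$ there exist a non-negative and non-increasing function $h_i(N)$, $N\ge0$, with $h_i(N)\downarrow0$ as $N\to\infty$, and a family of mutually independent random variables $\{\varphi^t_{x,i}\}$, $x\in\mathcal X$, $t=0,1,\dots$, such that (i) for each $t$ and $i$ these random variables are uniformly integrable; (ii) for each $i$ and $x$ the random variables $\{\varphi^t_{x,i},\ t=0,1,\dots\}$ are identically distributed with common distribution function $F_{x,i}$, where $F_{x,i}(u)$ is measurable as a function of $x$ for any fixed $u$; (iii) $L_{2,i}(Y^{t+1}_i)-L_{2,i}(Y^t_i)\le\varphi^t_{X^t,i}+h_i(L_{2,i}(Y^t_i))$ a.s., for all initial states $X^0=x\in\mathcal X$, $Y^0=y\in\mathcal Y$ and all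 $t=0,1,\dots$; (iv) the functions $f_i(x)=\mathbf E\varphi^1_{x,i}$ satisfy $\int_{\mathcal X}f_i(x)\,\pi(dx)=:-\varepsilon_i<0$. Then there exists $N_1\ge N_0$ (with $N_0$ the positive constant described in the context) such that the set $$D:=V\times\Bigl\{y\in\mathcal Y:\ \sum_{i=1}^M L_{2,i}(y_i)\le N_1\Bigr\}$$ is positive recurrent for the Markov chain $\{(X^t,Y^t)\}$.
   Context: $(\mathcal X,\mathcal B_{\mathcal X})$ and $(\mathcal Y,\mathcal B_{\mathcal Y})$ are measurable spaces with countably generated sigma-algebras. $\mathbf P_x,\mathbf E_x$: conditional on $X^0=x$; $\mathbf P_{x,y},\mathbf E_{x,y}$: conditional on $X^0=x,\ Y^0=y$. A measurable set $D$ is called positive recurrent for a Markov chain $\{Z^t\}$ if, with $\tau(D)=\min\{t\ge1:Z^t\in D\}$, one has $\tau(D)<\infty$ a.s. for every initial state, and $\sup_{z\in D}\mathbf E_z\tau(D)<\infty$. The constant $N_0$ is the one in the following coordinatewise drift property, established beforehand under (A0)-(A3), ($\widetilde{B1}$) and ($\widetilde{B2}$): with $\Delta=\min_i\varepsilon_i/10$, for some integer $t'$ and for any integer $t\ge t'$ there exists a positive number $N_0$ such that, for any $i$, if $L_{2,i}(y_i)\ge N_0$ then $\mathbf E_{x,y}(L_{2,i}(Y^t_i)-L_{2,i}(y_i))\le-t\Delta$ for all $x\in V$. *)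

theory Defs
  imports "HOL-Probability.Probability"
begin

section \<open>Time-homogeneous Markov chains on a measurable space\<close>

definition countably_generated :: "'a measure \<Rightarrow> bool" where
  "countably_generated S \<longleftrightarrow>
     (\<exists>G. countable G \<and> G \<subseteq> Pow (space S) \<and> sets S = sigma_sets (space S) G)"

abbreviation markov_kernel :: "'a measure \<Rightarrow> ('a \<Rightarrow> 'a measure) \<Rightarrow> bool" where
  "markov_kernel S K \<equiv> K \<in> S \<rightarrow>\<^sub>M prob_algebra S"

definition chain_step :: "'a measure \<Rightarrow> ('a \<Rightarrow> 'a measure) \<Rightarrow> 'a \<Rightarrow> nat \<Rightarrow> (nat \<Rightarrow> 'a) \<Rightarrow> 'a measure" where
  "chain_step S K z n \<omega> = (case n of 0 \<Rightarrow> return S z | Suc k \<Rightarrow> K (\<omega> k))"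

text \<open>The law, on the space of trajectories, of the Markov chain with transition kernel \<open>K\<close>
  started at \<open>z\<close>, obtained from the Ionescu-Tulcea theorem. The lemmas below confirm that it is
  the usual one: the coordinate process starts at \<open>z\<close> and has the Markov property.\<close>

definition chain_law :: "'a measure \<Rightarrow> ('a \<Rightarrow> 'a measure) \<Rightarrow> 'a \<Rightarrow> (nat \<Rightarrow> 'a) measure" where
  "chain_law S K z =
     projective_family.lim UNIV (Ionescu_Tulcea.CI (chain_step S K z) (\<lambda>_. S)) (\<lambda>_. S)"

lemma Ionescu_Tulcea_chain_step:
  assumes K: "markov_kernel S K" and z: "z \<in> space S"
  shows "Ionescu_Tulcea (chain_step S K z) (\<lambda>_. S)"
proof (rule Ionescu_Tulcea.intro)
  have K': "K \<in> S \<rightarrow>\<^sub>M subprob_algebra S"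
    using K by (rule measurable_prob_algebraD)
  show "chain_step S K z n \<in> PiM {0..<n} (\<lambda>_. S) \<rightarrow>\<^sub>M subprob_algebra S" for n
  proof (cases n)
    case 0
    have "return S z \<in> space (subprob_algebra S)"
      using z by (intro measurable_space[OF return_measurable])
    then show ?thesis
      by (simp add: 0 chain_step_def[abs_def])
  next
    case (Suc k)
    have "(\<lambda>\<omega>. \<omega> k) \<in> PiM {0..<Suc k} (\<lambda>_. S) \<rightarrow>\<^sub>M S"
      by (rule measurable_component_singleton) simp
    from measurable_compose[OF this K'] show ?thesis
      by (simp add: Suc chain_step_def[abs_def])
  qed
  show "prob_space (chain_step S K z n \<omega>)" if "\<omega> \<in> space (PiM {0..<n} (\<lambda>_. S))"
    for n and \<omega> :: "nat \<Rightarrow> 'a"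
  proof (cases n)
    case 0
    with z show ?thesis
      by (simp add: chain_step_def prob_space_return)
  next
    case (Suc k)
    with that have "\<omega> k \<in> space S"
      by (auto simp: space_PiM PiE_iff)
    from measurable_space[OF K this] show ?thesis
      by (simp add: Suc chain_step_def space_prob_algebra)
  qed
qed

lemma sets_chain_law:
  assumes "markov_kernel S K" "z \<in> space S"
  shows "sets (chain_law S K z) = sets (PiM UNIV (\<lambda>_. S))"
proof -
  interpret Ionescu_Tulcea "chain_step S K z" "\<lambda>_. S"
    using assms by (rule Ionescu_Tulcea_chain_step)
  show ?thesis
    by (simp add: chain_law_def)
qed

lemma prob_space_chain_law:
  assumes "markov_kernel S K" "z \<in> space S"
  shows "prob_space (chain_law S K z)"
proof -
  interpret Ionescu_Tulcea "chain_step S K z" "\<lambda>_. S"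
    using assms by (rule Ionescu_Tulcea_chain_step)
  have "distr (chain_law S K z) (PiM {} (\<lambda>_. S)) (\<lambda>x. restrict x {}) = CI {}"
    unfolding chain_law_def by (rule distr_lim) simp
  moreover have "(\<lambda>x. restrict x {}) \<in> chain_law S K z \<rightarrow>\<^sub>M PiM {} (\<lambda>_. S)"
    by (auto simp: measurable_cong_sets[OF sets_chain_law[OF assms] refl] intro!: measurable_restrict)
  ultimately show ?thesis
    using PF.prob_space_P[of "{}"] by (auto intro: prob_space_distrD)
qed

lemma distr_chain_law_upto:
  assumes "markov_kernel S K" "z \<in> space S"
  shows "distr (chain_law S K z) (PiM {0..<n} (\<lambda>_. S)) (\<lambda>\<omega>. restrict \<omega> {0..<n}) =
    Ionescu_Tulcea.C (chain_step S K z) (\<lambda>_. S) 0 n (\<lambda>_. undefined)"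
proof -
  interpret Ionescu_Tulcea "chain_step S K z" "\<lambda>_. S"
    using assms by (rule Ionescu_Tulcea_chain_step)
  have "up_to {0..<n} \<le> n"
    by (simp add: up_to_iff)
  from distr_C[OF this, of "\<lambda>_. undefined" 0] show ?thesis
    using up_to[of "{0..<n}"] \<open>up_to {0..<n} \<le> n\<close>
    unfolding chain_law_def by (subst distr_lim) (auto simp: CI_def)
qed

lemma chain_law_start:
  assumes "markov_kernel S K" "z \<in> space S"
  shows "distr (chain_law S K z) S (\<lambda>\<omega>. \<omega> 0) = return S z"
proof -
  interpret Ionescu_Tulcea "chain_step S K z" "\<lambda>_. S"
    using assms by (rule Ionescu_Tulcea_chain_step)
  have u: "(\<lambda>_. undefined) \<in> space (PiM {0..<0::nat} (\<lambda>_. S))"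
    by (auto simp: space_PiM)
  have "distr (chain_law S K z) S (\<lambda>\<omega>. \<omega> 0) =
      distr (distr (chain_law S K z) (PiM {0..<1} (\<lambda>_. S)) (\<lambda>\<omega>. restrict \<omega> {0..<1})) S (\<lambda>\<omega>. \<omega> 0)"
    by (subst distr_distr)
       (auto simp: measurable_cong_sets[OF sets_chain_law[OF assms] refl] comp_def
         intro!: measurable_restrict measurable_component_singleton)
  also have "\<dots> = distr (eP 0 (\<lambda>_. undefined)) S (\<lambda>\<omega>. \<omega> 0)"
    unfolding distr_chain_law_upto[OF assms] One_nat_def C.simps add_0
    by (subst bind_return[OF measurable_eP u]) (rule refl)
  also have "\<dots> = distr (return S z) S (\<lambda>x. x)"
    unfolding eP_def
    by (subst distr_distr)
       (auto simp: comp_def chain_step_def fun_upd_def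
         intro!: measurable_component_singleton measurable_fun_upd[where J="{}"] cong: distr_cong)
  also have "\<dots> = return S z"
    by (simp add: distr_id2)
  finally show ?thesis .
qed

lemma chain_law_Markov:
  assumes "markov_kernel S K" "z \<in> space S"
    and B: "B \<in> sets (PiM {0..<Suc n} (\<lambda>_. S))" and A: "A \<in> sets S"
  shows "emeasure (chain_law S K z)
           {\<omega> \<in> space (chain_law S K z). restrict \<omega> {0..<Suc n} \<in> B \<and> \<omega> (Suc n) \<in> A} =
         (\<integral>\<^sup>+\<omega>. indicator B (restrict \<omega> {0..<Suc n}) * emeasure (K (\<omega> n)) A \<partial>chain_law S K z)"
proof -
  interpret Ionescu_Tulcea "chain_step S K z" "\<lambda>_. S"
    using assms(1,2) by (rule Ionescu_Tulcea_chain_step)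
  let ?P = "\<lambda>n::nat. PiM {0..<n} (\<lambda>_. S)" and ?C = "\<lambda>n. C 0 n (\<lambda>_. undefined)"
  let ?L = "chain_law S K z" and ?r = "\<lambda>n \<omega>. restrict \<omega> {0..<n::nat}"
  have u: "(\<lambda>_. undefined) \<in> space (?P 0)"
    by (auto simp: space_PiM)
  have K': "K \<in> S \<rightarrow>\<^sub>M subprob_algebra S"
    using assms(1) by (rule measurable_prob_algebraD)
  note [measurable] = A B
  note mL = measurable_cong_sets[OF sets_chain_law[OF assms(1,2)] refl]
  have r: "?r m \<in> ?L \<rightarrow>\<^sub>M ?P m" for m
    unfolding mL by (auto intro!: measurable_restrict measurable_component_singleton)
  define f :: "(nat \<Rightarrow> 'a) \<Rightarrow> ennreal"
    where "f \<omega> = indicator B (?r (Suc n) \<omega>) * indicator A (\<omega> (Suc n))" for \<omega>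
  have [measurable]: "?r (Suc n) \<in> ?P (Suc (Suc n)) \<rightarrow>\<^sub>M ?P (Suc n)"
    by (auto intro!: measurable_restrict measurable_component_singleton)
  have [measurable]: "(\<lambda>\<omega>. \<omega> (Suc n)) \<in> ?P (Suc (Suc n)) \<rightarrow>\<^sub>M S"
    by (auto intro!: measurable_component_singleton)
  have f[measurable]: "f \<in> borel_measurable (?P (Suc (Suc n)))"
    unfolding f_def[abs_def] by measurable
  have m1: "(\<lambda>\<omega>. \<omega> n) \<in> ?P (Suc n) \<rightarrow>\<^sub>M S"
    by (auto intro!: measurable_component_singleton)
  have g[measurable]: "(\<lambda>\<omega>. indicator B \<omega> * emeasure (K (\<omega> n)) A) \<in> borel_measurable (?P (Suc n))"
    using measurable_compose[OF measurable_compose[OF m1 K'] measurable_emeasure_subprob_algebra[OF A]]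
    by measurable
  have set: "{\<omega> \<in> space ?L. ?r (Suc n) \<omega> \<in> B \<and> \<omega> (Suc n) \<in> A} \<in> sets ?L"
  proof -
    have "(\<lambda>\<omega>. \<omega> (Suc n)) \<in> ?L \<rightarrow>\<^sub>M S"
      unfolding mL by (auto intro!: measurable_component_singleton)
    with r[of "Suc n"] show ?thesis
      by measurable
  qed
  have "emeasure ?L {\<omega> \<in> space ?L. ?r (Suc n) \<omega> \<in> B \<and> \<omega> (Suc n) \<in> A} =
      (\<integral>\<^sup>+\<omega>. f (?r (Suc (Suc n)) \<omega>) \<partial>?L)"
    unfolding nn_integral_indicator[OF set, symmetric]
    by (rule nn_integral_cong) (auto simp: f_def indicator_def inf.absorb2)
  also have "\<dots> = (\<integral>\<^sup>+\<omega>. f \<omega> \<partial>?C (Suc (Suc n)))"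
    unfolding distr_chain_law_upto[OF assms(1,2), symmetric]
    by (rule nn_integral_distr[OF r, symmetric]) (simp add: f)
  also have "\<dots> = (\<integral>\<^sup>+\<omega>. \<integral>\<^sup>+x. f x \<partial>eP (Suc n) \<omega> \<partial>?C (Suc n))"
    unfolding C.simps(2)[of 0 "Suc n"] add_0
  proof (rule nn_integral_bind[OF f])
    show "eP (Suc n) \<in> ?C (Suc n) \<rightarrow>\<^sub>M subprob_algebra (?P (Suc (Suc n)))"
      using measurable_eP[of "Suc n"]
      unfolding measurable_cong_sets[OF sets_C[OF u, of "Suc n", unfolded add_0] refl] .
  qed
  also have "\<dots> = (\<integral>\<^sup>+\<omega>. indicator B \<omega> * emeasure (K (\<omega> n)) A \<partial>?C (Suc n))"
  proof (rule nn_integral_cong)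
    fix \<omega> assume "\<omega> \<in> space (?C (Suc n))"
    then have \<omega>: "\<omega> \<in> space (?P (Suc n))"
      using space_C[OF u, of "Suc n"] by simp
    then have \<omega>n: "\<omega> n \<in> space S"
      by (auto simp: space_PiM PiE_iff)
    have r\<omega>: "?r (Suc n) (fun_upd \<omega> (Suc n) x) = \<omega>" for x
      using \<omega> by (auto simp: space_PiM PiE_iff extensional_def fun_eq_iff)
    have "A \<in> sets (K (\<omega> n))"
      using A subprob_measurableD(2)[OF K' \<omega>n] by simp
    then have K_A: "(\<integral>\<^sup>+x. indicator B \<omega> * indicator A x \<partial>K (\<omega> n)) = indicator B \<omega> * emeasure (K (\<omega> n)) A"
      by (subst nn_integral_cmult) auto
    have "(\<integral>\<^sup>+x. f x \<partial>eP (Suc n) \<omega>) = (\<integral>\<^sup>+x. f (fun_upd \<omega> (Suc n) x) \<partial>K (\<omega> n))"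
      unfolding nn_integral_eP[OF \<omega> f] by (simp only: chain_step_def nat.case)
    also have "\<dots> = (\<integral>\<^sup>+x. indicator B \<omega> * indicator A x \<partial>K (\<omega> n))"
      unfolding f_def r\<omega> fun_upd_same by (rule refl)
    finally show "(\<integral>\<^sup>+x. f x \<partial>eP (Suc n) \<omega>) = indicator B \<omega> * emeasure (K (\<omega> n)) A"
      unfolding K_A .
  qed
  also have "\<dots> = (\<integral>\<^sup>+\<omega>. indicator B (?r (Suc n) \<omega>) * emeasure (K (?r (Suc n) \<omega> n)) A \<partial>?L)"
    unfolding distr_chain_law_upto[OF assms(1,2), symmetric]
    by (rule nn_integral_distr[OF r]) (simp add: g)
  finally show ?thesis
    by simp
qed


section \<open>Recurrence, irreducibility and aperiodicity\<close>

definition return_time :: "'a set \<Rightarrow> (nat \<Rightarrow> 'a) \<Rightarrow> enat" where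
  "return_time D \<omega> = (INF t\<in>{t. 1 \<le> t \<and> \<omega> t \<in> D}. enat t)"

definition positive_recurrent :: "'a measure \<Rightarrow> ('a \<Rightarrow> 'a measure) \<Rightarrow> 'a set \<Rightarrow> bool" where
  "positive_recurrent S K D \<longleftrightarrow>
     D \<in> sets S \<and>
     (\<forall>z\<in>space S. AE \<omega> in chain_law S K z. return_time D \<omega> < \<infinity>) \<and>
     (SUP z\<in>D. \<integral>\<^sup>+\<omega>. ennreal_of_enat (return_time D \<omega>) \<partial>chain_law S K z) < \<infinity>"

definition nstep :: "'a measure \<Rightarrow> ('a \<Rightarrow> 'a measure) \<Rightarrow> nat \<Rightarrow> 'a \<Rightarrow> 'a measure" where
  "nstep S K n z = distr (chain_law S K z) S (\<lambda>\<omega>. \<omega> n)"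

definition stationary :: "'a measure \<Rightarrow> ('a \<Rightarrow> 'a measure) \<Rightarrow> 'a measure \<Rightarrow> bool" where
  "stationary S K \<pi> \<longleftrightarrow> \<pi> \<in> space (prob_algebra S) \<and> \<pi> \<bind> K = \<pi>"

definition irreducibility_measure :: "'a measure \<Rightarrow> ('a \<Rightarrow> 'a measure) \<Rightarrow> 'a measure \<Rightarrow> bool" where
  "irreducibility_measure S K \<phi> \<longleftrightarrow>
     sets \<phi> = sets S \<and> emeasure \<phi> (space S) \<noteq> 0 \<and>
     (\<forall>A\<in>sets S. emeasure \<phi> A > 0 \<longrightarrow>
        (\<forall>z\<in>space S. \<exists>n\<ge>1. emeasure (nstep S K n z) A > 0))"

definition maximal_irreducibility_measure ::
    "'a measure \<Rightarrow> ('a \<Rightarrow> 'a measure) \<Rightarrow> 'a measure \<Rightarrow> bool" where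
  "maximal_irreducibility_measure S K \<psi> \<longleftrightarrow>
     irreducibility_measure S K \<psi> \<and>
     (\<forall>\<phi>. irreducibility_measure S K \<phi> \<longrightarrow> absolutely_continuous \<psi> \<phi>)"

definition cycle ::
    "'a measure \<Rightarrow> ('a \<Rightarrow> 'a measure) \<Rightarrow> 'a measure \<Rightarrow> nat \<Rightarrow> (nat \<Rightarrow> 'a set) \<Rightarrow> bool" where
  "cycle S K \<psi> d D \<longleftrightarrow>
     (\<forall>j<d. D j \<in> sets S) \<and> disjoint_family_on D {..<d} \<and>
     (\<forall>j<d. \<forall>z\<in>D j. emeasure (K z) (D (Suc j mod d)) = 1) \<and>
     emeasure \<psi> (space S - (\<Union>j<d. D j)) = 0"

text \<open>Aperiodicity on a general state space in the sense of Meyn and Tweedie: the chain is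
  irreducible and its period, the largest length of a cycle carrying a maximal irreducibility
  measure, is one. All maximal irreducibility measures have the same null sets.\<close>

definition aperiodic :: "'a measure \<Rightarrow> ('a \<Rightarrow> 'a measure) \<Rightarrow> bool" where
  "aperiodic S K \<longleftrightarrow>
     (\<exists>\<psi>. maximal_irreducibility_measure S K \<psi> \<and> \<not> (\<exists>d\<ge>2. \<exists>D. cycle S K \<psi> d D))"

definition minorized :: "'a measure \<Rightarrow> ('a \<Rightarrow> 'a measure) \<Rightarrow> 'a set \<Rightarrow> bool" where
  "minorized S K V \<longleftrightarrow>
     (\<exists>p::real. \<exists>\<mu>. \<exists>m::nat. 0 < p \<and> p \<le> 1 \<and> \<mu> \<in> space (prob_algebra S) \<and> 1 \<le> m \<and>
        (\<forall>x\<in>V. \<forall>A\<in>sets S. ennreal p * emeasure \<mu> A \<le> emeasure (nstep S K m x) A))"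


section \<open>Drift conditions for a chain with several components\<close>

text \<open>A state is a pair \<open>(x, y)\<close>, where \<open>y\<close> is an element of the product of the
  measurable spaces \<open>Y i\<close> over \<open>i \<in> {1..M}\<close>. The component spaces share one
  type, but may have different carriers and sigma-algebras.\<close>

abbreviation joint_space ::
    "'x measure \<Rightarrow> (nat \<Rightarrow> 'y measure) \<Rightarrow> nat \<Rightarrow> ('x \<times> (nat \<Rightarrow> 'y)) measure" where
  "joint_space MX Y M \<equiv> MX \<Otimes>\<^sub>M PiM {1..M} Y"

definition level :: "(nat \<Rightarrow> 'y \<Rightarrow> real) \<Rightarrow> nat \<Rightarrow> 'x \<times> (nat \<Rightarrow> 'y) \<Rightarrow> real" where
  "level L i z = L i (snd z i)"

definition mean_increment ::
    "'a measure \<Rightarrow> ('a \<Rightarrow> 'a measure) \<Rightarrow> ('a \<Rightarrow> real) \<Rightarrow> nat \<Rightarrow> 'a \<Rightarrow> real" where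
  "mean_increment S K g t z = (\<integral>\<omega>. g (\<omega> t) - g z \<partial>chain_law S K z)"

definition decreases_to_zero :: "(real \<Rightarrow> real) \<Rightarrow> bool" where
  "decreases_to_zero h \<longleftrightarrow> antimono_on {0..} h \<and> (h \<longlongrightarrow> 0) at_top"

text \<open>The bound is stated with the nonnegative integral, so that it includes integrability of
  the increments; the Bochner integrals in \<open>mean_increment\<close> are then meaningful.\<close>

definition cond_B1 ::
    "'x measure \<Rightarrow> (nat \<Rightarrow> 'y measure) \<Rightarrow> nat \<Rightarrow>
     ('x \<times> (nat \<Rightarrow> 'y) \<Rightarrow> ('x \<times> (nat \<Rightarrow> 'y)) measure) \<Rightarrow>
     (nat \<Rightarrow> 'y \<Rightarrow> real) \<Rightarrow> bool" where
  "cond_B1 MX Y M K L \<longleftrightarrow>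
     (\<exists>U::real. \<forall>i\<in>{1..M}.
        (SUP z\<in>space (joint_space MX Y M).
           \<integral>\<^sup>+\<omega>. ennreal \<bar>level L i (\<omega> 1) - level L i (\<omega> 0)\<bar>
             \<partial>chain_law (joint_space MX Y M) K z)
        \<le> ennreal U)"

definition cond_B2 ::
    "'x measure \<Rightarrow> (nat \<Rightarrow> 'y measure) \<Rightarrow> nat \<Rightarrow>
     ('x \<times> (nat \<Rightarrow> 'y) \<Rightarrow> ('x \<times> (nat \<Rightarrow> 'y)) measure) \<Rightarrow>
     'x measure \<Rightarrow> (nat \<Rightarrow> 'y \<Rightarrow> real) \<Rightarrow> (nat \<Rightarrow> 'x \<Rightarrow> real) \<Rightarrow> bool" where
  "cond_B2 MX Y M K \<pi> L f \<longleftrightarrow>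
     (\<forall>i\<in>{1..M}.
        f i \<in> borel_measurable MX \<and>
        (\<exists>C. \<forall>x\<in>space MX. \<bar>f i x\<bar> \<le> C) \<and>
        (\<integral>x. f i x \<partial>\<pi>) < 0 \<and>
        (\<exists>h. decreases_to_zero h \<and>
           (\<forall>z\<in>space (joint_space MX Y M).
              mean_increment (joint_space MX Y M) K (level L i) 1 z
              \<le> f i (fst z) + h (level L i z))))"

definition cond_B3 ::
    "'x measure \<Rightarrow> (nat \<Rightarrow> 'y measure) \<Rightarrow> nat \<Rightarrow>
     ('x \<times> (nat \<Rightarrow> 'y) \<Rightarrow> ('x \<times> (nat \<Rightarrow> 'y)) measure) \<Rightarrow>
     'x set \<Rightarrow> (nat \<Rightarrow> 'y \<Rightarrow> real) \<Rightarrow> bool" where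
  "cond_B3 MX Y M K V L \<longleftrightarrow>
     (\<forall>i\<in>{1..M}.
        ((\<lambda>N::nat. SUP t\<in>{N..}. SUP z\<in>{z \<in> space (joint_space MX Y M). fst z \<in> V}.
            ereal (mean_increment (joint_space MX Y M) K (level L i) t z / real t)) \<longlonglongrightarrow> 0))"

definition uniformly_integrable :: "'w measure \<Rightarrow> 'j set \<Rightarrow> ('j \<Rightarrow> 'w \<Rightarrow> real) \<Rightarrow> bool" where
  "uniformly_integrable Q J \<phi> \<longleftrightarrow>
     (\<forall>j\<in>J. \<phi> j \<in> borel_measurable Q) \<and>
     ((\<lambda>c::real. SUP j\<in>J. \<integral>\<^sup>+w. ennreal \<bar>\<phi> j w\<bar> * indicator {w. c \<le> \<bar>\<phi> j w\<bar>} w \<partial>Q)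
        \<longlongrightarrow> 0) at_top"

text \<open>The process \<open>Z\<close>, under the probability measure \<open>Q z\<close>, is a version of the chain
  started at \<open>z\<close>. The underlying space may carry more randomness than the chain itself.\<close>

definition chain_version ::
    "'a measure \<Rightarrow> ('a \<Rightarrow> 'a measure) \<Rightarrow> ('a \<Rightarrow> 'w measure) \<Rightarrow> (nat \<Rightarrow> 'w \<Rightarrow> 'a) \<Rightarrow> bool" where
  "chain_version S K Q Z \<longleftrightarrow>
     (\<forall>z\<in>space S. prob_space (Q z) \<and> (\<forall>t. Z t \<in> Q z \<rightarrow>\<^sub>M S) \<and> (AE w in Q z. Z 0 w = z) \<and>
        distr (Q z) (PiM UNIV (\<lambda>_. S)) (\<lambda>w t. Z t w) = chain_law S K z)"

definition cond_Bhat ::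
    "'x measure \<Rightarrow> (nat \<Rightarrow> 'y measure) \<Rightarrow> nat \<Rightarrow>
     ('x \<times> (nat \<Rightarrow> 'y) \<Rightarrow> 'w measure) \<Rightarrow> (nat \<Rightarrow> 'w \<Rightarrow> 'x \<times> (nat \<Rightarrow> 'y)) \<Rightarrow>
     'x measure \<Rightarrow> (nat \<Rightarrow> 'y \<Rightarrow> real) \<Rightarrow> (nat \<Rightarrow> 'x \<Rightarrow> real) \<Rightarrow> bool" where
  "cond_Bhat MX Y M Q Z \<pi> L f \<longleftrightarrow>
     (\<forall>i\<in>{1..M}. \<exists>h. \<exists>\<phi> :: nat \<Rightarrow> 'x \<Rightarrow> 'w \<Rightarrow> real. \<exists>F :: 'x \<Rightarrow> real \<Rightarrow> real.
        (\<forall>N\<ge>0. 0 \<le> h N) \<and> decreases_to_zero h \<and>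
        (\<forall>z\<in>space (joint_space MX Y M).
           prob_space.indep_vars (Q z) (\<lambda>_. borel) (\<lambda>(t, x). \<phi> t x) (UNIV \<times> space MX)) \<and>
        (\<forall>z\<in>space (joint_space MX Y M). \<forall>t.
           uniformly_integrable (Q z) (space MX) (\<phi> t)) \<and>
        (\<forall>z\<in>space (joint_space MX Y M). \<forall>t. \<forall>x\<in>space MX. \<forall>u.
           cdf (distr (Q z) borel (\<phi> t x)) u = F x u) \<and>
        (\<forall>u. (\<lambda>x. F x u) \<in> borel_measurable MX) \<and>
        (\<forall>z\<in>space (joint_space MX Y M). \<forall>t. AE w in Q z.
           level L i (Z (Suc t) w) - level L i (Z t w) \<le>
             \<phi> t (fst (Z t w)) w + h (level L i (Z t w))) \<and>
        (\<forall>z\<in>space (joint_space MX Y M). \<forall>x\<in>space MX.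
           f i x = (\<integral>w. \<phi> 1 x w \<partial>Q z)) \<and>
        (\<integral>x. f i x \<partial>\<pi>) < 0)"

definition drift_rate :: "nat \<Rightarrow> 'x measure \<Rightarrow> (nat \<Rightarrow> 'x \<Rightarrow> real) \<Rightarrow> real" where
  "drift_rate M \<pi> f = (MIN i\<in>{1..M}. - (\<integral>x. f i x \<partial>\<pi>)) / 10"

definition drift_threshold ::
    "'x measure \<Rightarrow> (nat \<Rightarrow> 'y measure) \<Rightarrow> nat \<Rightarrow>
     ('x \<times> (nat \<Rightarrow> 'y) \<Rightarrow> ('x \<times> (nat \<Rightarrow> 'y)) measure) \<Rightarrow>
     'x set \<Rightarrow> (nat \<Rightarrow> 'y \<Rightarrow> real) \<Rightarrow> real \<Rightarrow> nat \<Rightarrow> real \<Rightarrow> bool" where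
  "drift_threshold MX Y M K V L \<Delta> t N\<^sub>0 \<longleftrightarrow>
     (\<forall>i\<in>{1..M}. \<forall>z\<in>space (joint_space MX Y M). fst z \<in> V \<longrightarrow> N\<^sub>0 \<le> level L i z \<longrightarrow>
        mean_increment (joint_space MX Y M) K (level L i) t z \<le> - (real t * \<Delta>))"

end

theory Submission
  imports Defs
begin

text \<open>
  Write \<open>\<tau>\<close> for the return time of \<open>X\<close> to \<open>V\<close> and \<open>\<sigma> \<ge> 0\<close> for the hitting time.
  The minorization and \<open>sup\<^sub>V E \<tau> < \<infinity>\<close> bound the oscillation over \<open>V\<close> of the sums
  \<open>E\<^sub>x (g (X\<^sup>0) + \<dots> + g (X\<^sup>t\<^sup>-\<^sup>1))\<close> uniformly in \<open>t\<close>, for bounded \<open>g\<close>; integrating against \<open>\<pi>\<close> shows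
  that they are at most \<open>t (\<pi> g + o(1))\<close> uniformly on \<open>V\<close>. For the \<open>f\<^sub>i\<close> this is the drift property. For
  \<open>g = 1\<^sub>V E \<tau>\<close>, whose \<open>\<pi>\<close>-mean is at most \<open>1\<close> by Kac's formula, it shows that the expected
  time from \<open>T\<close> to the next visit to \<open>V\<close> is \<open>o(T)\<close>.

  With \<open>W\<close> the sum of the levels and a constant \<open>C\<close> bounding its one-step growth, \<open>W + (C + 1) E \<sigma>\<close>
  decreases in mean by at least \<open>1\<close> in one step outside \<open>V\<close>, and by a multiple of \<open>T\<close> in \<open>T\<close> steps from
  \<open>V\<close> when \<open>W\<close> is large: one large level decreases linearly in \<open>T\<close>, the other levels grow by \<open>o(T)\<close>,
  and \<open>E \<sigma>\<close> is \<open>o(T)\<close> after \<open>T\<close> steps. This is a Foster criterion with a state-dependent time.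

  The \<open>o(T)\<close> growth is \<open>(B3)\<close>. Under the stochastic domination \<open>(Bhat)\<close> it follows from the drift of
  \<open>G (L) + G' (L) u (X)\<close>, where \<open>G\<close> is a convex function that is quadratic near \<open>0\<close> and linear with slope
  \<open>1\<close> at infinity, and \<open>u\<close> is a bounded approximate solution of the Poisson equation for \<open>f\<^sub>i\<close>. The
  factor \<open>G' (L)\<close> suppresses the correction \<open>h (L)\<close> at small levels, and uniform integrability bounds
  the second-order term. Only the distributions of the \<open>\<phi>\<close> enter, so that it does not matter how
  they depend on the chain.
\<close>

section \<open>Markov kernels and return times\<close>

text \<open>The assumptions bound the mean return time only from states of \<open>V\<close>. From
  other states, and even under the stationary law, the mean hitting time may be infinite. Hence
  stationary averages are taken of the truncated times \<open>hit V n\<close>, since an exact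
  balance could read infinity minus infinity. Foster functions take values in
  \<open>ennreal\<close>, with gains added on the left instead of subtracted on the right. Moreover
  a Foster bound says nothing at a state where the function is infinite; there almost sure return
  follows because the chain reaches \<open>V\<close>, and from \<open>V\<close> the set is reached
  with probability one.

  The mean one-step change of a level is bounded only by a signed function of \<open>X\<close> plus
  a correction that is small at high levels, so it may be positive at single steps; a negative mean
  shows only after averaging. The averaging time is fixed first, and the threshold for the levels
  depends on it. When the sum of the levels is large, only one of them need be large; the others may
  be near zero, where the correction is not small. This is why their growth needs a separate
  bound.\<close>

locale markov_chain =
  fixes S :: "'a measure" and K :: "'a \<Rightarrow> 'a measure"
  assumes kernel: "markov_kernel S K"
begin

lemma kernel_subprob [measurable]: "K \<in> S \<rightarrow>\<^sub>M subprob_algebra S"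
  using kernel by (rule measurable_prob_algebraD)

lemma prob_space_kernel: "z \<in> space S \<Longrightarrow> prob_space (K z)"
  using measurable_space[OF kernel] by (simp add: space_prob_algebra)

lemma sets_kernel [measurable_cong]: "z \<in> space S \<Longrightarrow> sets (K z) = sets S"
  using measurable_space[OF kernel] by (simp add: space_prob_algebra)

lemma space_kernel: "z \<in> space S \<Longrightarrow> space (K z) = space S"
  using sets_kernel sets_eq_imp_space_eq by blast

lemma borel_measurable_kernel: "z \<in> space S \<Longrightarrow> g \<in> borel_measurable S \<Longrightarrow> g \<in> borel_measurable (K z)"
  by (simp add: measurable_cong_sets[OF sets_kernel refl])

lemma nn_integral_kernel_measurable [measurable]:
  "g \<in> borel_measurable S \<Longrightarrow> (\<lambda>z. \<integral>\<^sup>+w. g w \<partial>K z) \<in> borel_measurable S"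
  by (rule measurable_compose[OF kernel_subprob nn_integral_measurable_subprob_algebra])

lemma integral_kernel_measurable [measurable]:
  fixes g :: "'a \<Rightarrow> real"
  shows "g \<in> borel_measurable S \<Longrightarrow> (\<lambda>z. \<integral>w. g w \<partial>K z) \<in> borel_measurable S"
  by (rule measurable_compose[OF kernel_subprob integral_measurable_subprob_algebra])

lemma nn_integral_kernel_const: "z \<in> space S \<Longrightarrow> (\<integral>\<^sup>+w. c \<partial>K z) = c"
  by (simp add: prob_space.emeasure_space_1[OF prob_space_kernel])

lemma nn_integral_kernel_mono:
  assumes "z \<in> space S" "\<And>w. w \<in> space S \<Longrightarrow> g w \<le> g' w"
  shows "(\<integral>\<^sup>+w. g w \<partial>K z) \<le> (\<integral>\<^sup>+w. g' w \<partial>K z)"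
  using assms by (intro nn_integral_mono) (auto simp: space_kernel)

section \<open>Coordinates of the trajectory law and the Markov property\<close>

lemma chain_law_coordinate [measurable]:
  "z \<in> space S \<Longrightarrow> (\<lambda>\<omega>. \<omega> n) \<in> chain_law S K z \<rightarrow>\<^sub>M S"
  unfolding measurable_cong_sets[OF sets_chain_law[OF kernel] refl]
  by (auto intro!: measurable_component_singleton)

lemma chain_law_restrict:
  "z \<in> space S \<Longrightarrow> (\<lambda>\<omega>. restrict \<omega> {0..<n}) \<in> chain_law S K z \<rightarrow>\<^sub>M PiM {0..<n} (\<lambda>_. S)"
  unfolding measurable_cong_sets[OF sets_chain_law[OF kernel] refl]
  by (auto intro!: measurable_restrict measurable_component_singleton)

lemma chain_law_space: "z \<in> space S \<Longrightarrow> \<omega> \<in> space (chain_law S K z) \<Longrightarrow> \<omega> n \<in> space S"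
  using measurable_space[OF chain_law_coordinate] by blast

lemma nn_integral_chain_law_0:
  assumes z: "z \<in> space S" and g[measurable]: "g \<in> borel_measurable S"
  shows "(\<integral>\<^sup>+\<omega>. g (\<omega> 0) \<partial>chain_law S K z) = g z"
proof -
  have "(\<integral>\<^sup>+\<omega>. g (\<omega> 0) \<partial>chain_law S K z) = (\<integral>\<^sup>+w. g w \<partial>distr (chain_law S K z) S (\<lambda>\<omega>. \<omega> 0))"
    using z by (subst nn_integral_distr) auto
  also have "\<dots> = g z"
    unfolding chain_law_start[OF kernel z] using z by (simp add: nn_integral_return)
  finally show ?thesis .
qed

text \<open>Induction over measurable functions extends \<open>chain_law_Markov\<close> from events
  to nonnegative \<open>g\<close>. The past is kept as an arbitrary event \<open>B\<close>, which is
  needed when the event is that a set has not been visited so far.\<close>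

lemma nn_integral_chain_law_Suc:
  assumes z: "z \<in> space S" and B: "B \<in> sets (PiM {0..<Suc n} (\<lambda>_. S))"
    and g: "g \<in> borel_measurable S"
  shows "(\<integral>\<^sup>+\<omega>. indicator B (restrict \<omega> {0..<Suc n}) * g (\<omega> (Suc n)) \<partial>chain_law S K z) =
    (\<integral>\<^sup>+\<omega>. indicator B (restrict \<omega> {0..<Suc n}) * (\<integral>\<^sup>+w. g w \<partial>K (\<omega> n)) \<partial>chain_law S K z)"
proof -
  let ?L = "chain_law S K z"
  let ?i = "\<lambda>\<omega>. indicator B (restrict \<omega> {0..<Suc n}) :: ennreal"
  note cL[measurable] = chain_law_coordinate[OF z]
  note [measurable] = chain_law_restrict[OF z] B
  have K[simp]: "\<omega> \<in> space ?L \<Longrightarrow> \<omega> n \<in> space S" for \<omega>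
    using chain_law_space[OF z] .
  have mi: "?i \<in> borel_measurable ?L"
    by measurable
  have km: "(\<lambda>\<omega>. \<integral>\<^sup>+w. u w \<partial>K (\<omega> n)) \<in> borel_measurable ?L" if "u \<in> borel_measurable S" for u
    by (rule measurable_compose[OF cL nn_integral_kernel_measurable[OF that]])
  have sm: "(\<lambda>\<omega>. u (\<omega> (Suc n))) \<in> borel_measurable ?L" if "u \<in> borel_measurable S" for u :: "'a \<Rightarrow> ennreal"
    by (rule measurable_compose[OF cL that])
  show ?thesis
    using g
  proof (induction rule: borel_measurable_induct)
    case (cong f g)
    have "(\<integral>\<^sup>+\<omega>. ?i \<omega> * f (\<omega> (Suc n)) \<partial>?L) = (\<integral>\<^sup>+\<omega>. ?i \<omega> * g (\<omega> (Suc n)) \<partial>?L)"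
      using cong(3) chain_law_space[OF z] by (intro nn_integral_cong) auto
    moreover have "(\<integral>\<^sup>+\<omega>. ?i \<omega> * (\<integral>\<^sup>+w. f w \<partial>K (\<omega> n)) \<partial>?L) =
        (\<integral>\<^sup>+\<omega>. ?i \<omega> * (\<integral>\<^sup>+w. g w \<partial>K (\<omega> n)) \<partial>?L)"
      using cong(3) by (intro nn_integral_cong arg_cong2[where f="(*)"] refl) (auto simp: space_kernel)
    ultimately show ?case
      using cong(4) by (simp only:)
  next
    case (set A)
    have [measurable]: "A \<in> sets S" by fact
    have 1: "(\<integral>\<^sup>+\<omega>. ?i \<omega> * indicator A (\<omega> (Suc n)) \<partial>?L) =
      emeasure ?L {\<omega> \<in> space ?L. restrict \<omega> {0..<Suc n} \<in> B \<and> \<omega> (Suc n) \<in> A}"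
      by (subst nn_integral_indicator[symmetric])
        (auto intro!: nn_integral_cong simp: indicator_def simp del: nn_integral_indicator)
    show ?case
      unfolding 1 chain_law_Markov[OF kernel z B set]
      by (intro nn_integral_cong arg_cong2[where f="(*)"] refl)
        (simp add: sets_kernel set)
  next
    case (mult u c)
    note [measurable] = mult(2)
    have "(\<integral>\<^sup>+\<omega>. ?i \<omega> * (c * u (\<omega> (Suc n))) \<partial>?L) = c * (\<integral>\<^sup>+\<omega>. ?i \<omega> * u (\<omega> (Suc n)) \<partial>?L)"
      unfolding mult.left_commute[of _ c]
      by (intro nn_integral_cmult borel_measurable_times_ennreal mi sm mult(2))
    moreover have "(\<integral>\<^sup>+\<omega>. ?i \<omega> * (\<integral>\<^sup>+w. c * u w \<partial>K (\<omega> n)) \<partial>?L) =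
        (\<integral>\<^sup>+\<omega>. c * (?i \<omega> * (\<integral>\<^sup>+w. u w \<partial>K (\<omega> n))) \<partial>?L)"
    proof (rule nn_integral_cong)
      fix \<omega> assume "\<omega> \<in> space ?L"
      then have "(\<integral>\<^sup>+w. c * u w \<partial>K (\<omega> n)) = c * (\<integral>\<^sup>+w. u w \<partial>K (\<omega> n))"
        by (intro nn_integral_cmult borel_measurable_kernel K mult(2))
      then show "?i \<omega> * (\<integral>\<^sup>+w. c * u w \<partial>K (\<omega> n)) = c * (?i \<omega> * (\<integral>\<^sup>+w. u w \<partial>K (\<omega> n)))"
        by (simp only: ac_simps)
    qed
    moreover have "\<dots> = c * (\<integral>\<^sup>+\<omega>. ?i \<omega> * (\<integral>\<^sup>+w. u w \<partial>K (\<omega> n)) \<partial>?L)"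
      by (intro nn_integral_cmult borel_measurable_times_ennreal mi km mult(2))
    ultimately show ?case
      using mult.IH by (simp only:)
  next
    case (add u v)
    note [measurable] = add(1,4)
    have "(\<integral>\<^sup>+\<omega>. ?i \<omega> * (v (\<omega> (Suc n)) + u (\<omega> (Suc n))) \<partial>?L) =
        (\<integral>\<^sup>+\<omega>. ?i \<omega> * v (\<omega> (Suc n)) \<partial>?L) + (\<integral>\<^sup>+\<omega>. ?i \<omega> * u (\<omega> (Suc n)) \<partial>?L)"
      unfolding distrib_left
      by (intro nn_integral_add borel_measurable_times_ennreal mi sm) (auto simp: add)
    moreover have "(\<integral>\<^sup>+\<omega>. ?i \<omega> * (\<integral>\<^sup>+w. v w + u w \<partial>K (\<omega> n)) \<partial>?L) =
        (\<integral>\<^sup>+\<omega>. ?i \<omega> * (\<integral>\<^sup>+w. v w \<partial>K (\<omega> n)) \<partial>?L) + (\<integral>\<^sup>+\<omega>. ?i \<omega> * (\<integral>\<^sup>+w. u w \<partial>K (\<omega> n)) \<partial>?L)"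
    proof -
      have "(\<integral>\<^sup>+\<omega>. ?i \<omega> * (\<integral>\<^sup>+w. v w + u w \<partial>K (\<omega> n)) \<partial>?L) =
          (\<integral>\<^sup>+\<omega>. ?i \<omega> * (\<integral>\<^sup>+w. v w \<partial>K (\<omega> n)) + ?i \<omega> * (\<integral>\<^sup>+w. u w \<partial>K (\<omega> n)) \<partial>?L)"
      proof (rule nn_integral_cong)
        fix \<omega> assume "\<omega> \<in> space ?L"
        then have "(\<integral>\<^sup>+w. v w + u w \<partial>K (\<omega> n)) = (\<integral>\<^sup>+w. v w \<partial>K (\<omega> n)) + (\<integral>\<^sup>+w. u w \<partial>K (\<omega> n))"
          using add by (intro nn_integral_add borel_measurable_kernel K) auto
        then show "?i \<omega> * (\<integral>\<^sup>+w. v w + u w \<partial>K (\<omega> n)) =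
            ?i \<omega> * (\<integral>\<^sup>+w. v w \<partial>K (\<omega> n)) + ?i \<omega> * (\<integral>\<^sup>+w. u w \<partial>K (\<omega> n))"
          by (simp only: distrib_left)
      qed
      also have "\<dots> = (\<integral>\<^sup>+\<omega>. ?i \<omega> * (\<integral>\<^sup>+w. v w \<partial>K (\<omega> n)) \<partial>?L) + (\<integral>\<^sup>+\<omega>. ?i \<omega> * (\<integral>\<^sup>+w. u w \<partial>K (\<omega> n)) \<partial>?L)"
        by (intro nn_integral_add borel_measurable_times_ennreal mi km) (auto simp: add)
      finally show ?thesis .
    qed
    ultimately show ?case
      using add.IH by (simp only:)
  next
    case (seq U)
    have [measurable]: "U i \<in> borel_measurable S" for i by fact
    have "(\<integral>\<^sup>+\<omega>. ?i \<omega> * (SUP i. U i) (\<omega> (Suc n)) \<partial>?L) = (SUP i. \<integral>\<^sup>+\<omega>. ?i \<omega> * U i (\<omega> (Suc n)) \<partial>?L)"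
      using \<open>incseq U\<close>
      by (subst nn_integral_monotone_convergence_SUP[symmetric])
        (auto simp: SUP_mult_left_ennreal image_comp incseq_def le_fun_def intro!: mult_left_mono)
    moreover have "(\<integral>\<^sup>+\<omega>. ?i \<omega> * (\<integral>\<^sup>+w. (SUP i. U i) w \<partial>K (\<omega> n)) \<partial>?L) =
        (\<integral>\<^sup>+\<omega>. (SUP i. ?i \<omega> * (\<integral>\<^sup>+w. U i w \<partial>K (\<omega> n))) \<partial>?L)"
    proof (rule nn_integral_cong)
      fix \<omega> assume "\<omega> \<in> space ?L"
      then have "(\<integral>\<^sup>+w. (SUP i. U i w) \<partial>K (\<omega> n)) = (SUP i. \<integral>\<^sup>+w. U i w \<partial>K (\<omega> n))"
        using \<open>incseq U\<close> by (intro nn_integral_monotone_convergence_SUP borel_measurable_kernel K) auto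
      then show "?i \<omega> * (\<integral>\<^sup>+w. (SUP i. U i) w \<partial>K (\<omega> n)) = (SUP i. ?i \<omega> * (\<integral>\<^sup>+w. U i w \<partial>K (\<omega> n)))"
        by (simp add: SUP_mult_left_ennreal image_comp)
    qed
    moreover have "\<dots> = (SUP i. \<integral>\<^sup>+\<omega>. ?i \<omega> * (\<integral>\<^sup>+w. U i w \<partial>K (\<omega> n)) \<partial>?L)"
      using \<open>incseq U\<close>
      by (intro nn_integral_monotone_convergence_SUP)
        (auto simp: incseq_def le_fun_def intro!: mult_left_mono nn_integral_mono)
    ultimately show ?case
      using seq.IH by (simp only:)
  qed
qed

section \<open>Laws after n steps and iterated drift inequalities\<close>

lemma sets_nstep [simp, measurable_cong]: "sets (nstep S K n z) = sets S"
  by (simp add: nstep_def)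

lemma space_nstep [simp]: "space (nstep S K n z) = space S"
  by (simp add: nstep_def)

lemma borel_measurable_nstep: "g \<in> borel_measurable S \<Longrightarrow> g \<in> borel_measurable (nstep S K n z)"
  by (simp add: measurable_cong_sets[OF sets_nstep refl])

lemma prob_space_nstep: "z \<in> space S \<Longrightarrow> prob_space (nstep S K n z)"
  unfolding nstep_def
  by (intro prob_space.prob_space_distr prob_space_chain_law kernel chain_law_coordinate)

lemma nn_integral_nstep_const: "z \<in> space S \<Longrightarrow> (\<integral>\<^sup>+w. c \<partial>nstep S K n z) = c"
  using prob_space.emeasure_space_1[OF prob_space_nstep, of z n] by simp

lemma nn_integral_nstep:
  "z \<in> space S \<Longrightarrow> g \<in> borel_measurable S \<Longrightarrow>
    (\<integral>\<^sup>+w. g w \<partial>nstep S K n z) = (\<integral>\<^sup>+\<omega>. g (\<omega> n) \<partial>chain_law S K z)"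
  unfolding nstep_def by (rule nn_integral_distr) auto

lemma nn_integral_nstep_0:
  "z \<in> space S \<Longrightarrow> g \<in> borel_measurable S \<Longrightarrow> (\<integral>\<^sup>+w. g w \<partial>nstep S K 0 z) = g z"
  by (simp add: nn_integral_nstep nn_integral_chain_law_0)

text \<open>The Markov property with \<open>B\<close> the whole space. It peels off the last step,
  so that a one-step inequality at \<open>w\<close> can be integrated against the law after
  \<open>n\<close> steps.\<close>

lemma nn_integral_nstep_Suc:
  assumes z: "z \<in> space S" and g[measurable]: "g \<in> borel_measurable S"
  shows "(\<integral>\<^sup>+w. g w \<partial>nstep S K (Suc n) z) = (\<integral>\<^sup>+w. (\<integral>\<^sup>+v. g v \<partial>K w) \<partial>nstep S K n z)"
proof -
  have 1: "restrict \<omega> {0..<Suc n} \<in> space (PiM {0..<Suc n} (\<lambda>_. S))"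
    if "\<omega> \<in> space (chain_law S K z)" for \<omega>
    using measurable_space[OF chain_law_restrict[OF z] that] .
  have "(\<integral>\<^sup>+w. g w \<partial>nstep S K (Suc n) z) = (\<integral>\<^sup>+\<omega>. indicator (space (PiM {0..<Suc n} (\<lambda>_. S))) (restrict \<omega> {0..<Suc n}) * g (\<omega> (Suc n)) \<partial>chain_law S K z)"
    using z 1 by (auto simp: nn_integral_nstep intro!: nn_integral_cong)
  also have "\<dots> = (\<integral>\<^sup>+\<omega>. (\<integral>\<^sup>+w. g w \<partial>K (\<omega> n)) \<partial>chain_law S K z)"
    using 1 by (subst nn_integral_chain_law_Suc[OF z]) (auto intro!: nn_integral_cong)
  also have "\<dots> = (\<integral>\<^sup>+w. (\<integral>\<^sup>+v. g v \<partial>K w) \<partial>nstep S K n z)"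
    using z by (simp add: nn_integral_nstep)
  finally show ?thesis .
qed

lemma nn_integral_nstep_1:
  assumes z: "z \<in> space S" and g[measurable]: "g \<in> borel_measurable S"
  shows "(\<integral>\<^sup>+w. g w \<partial>nstep S K 1 z) = (\<integral>\<^sup>+v. g v \<partial>K z)"
  using z by (simp add: nn_integral_nstep_Suc nn_integral_nstep_0)

lemma nstep_1: "z \<in> space S \<Longrightarrow> nstep S K 1 z = K z"
proof (rule measure_eqI)
  fix A assume A: "A \<in> sets (nstep S K 1 z)" and z: "z \<in> space S"
  have [measurable]: "A \<in> sets S" using A by simp
  show "emeasure (nstep S K 1 z) A = emeasure (K z) A"
    using nn_integral_nstep_1[OF z, of "indicator A"] by (simp add: sets_kernel[OF z])
qed (simp add: sets_kernel)

lemma nn_integral_nstep_mono: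
  assumes "\<And>w. w \<in> space S \<Longrightarrow> g w \<le> g' w"
  shows "(\<integral>\<^sup>+w. g w \<partial>nstep S K n z) \<le> (\<integral>\<^sup>+w. g' w \<partial>nstep S K n z)"
  using assms by (intro nn_integral_mono) auto

text \<open>The one-step inequality is integrated against each law in turn and the results are
  added. The gain \<open>c\<close> stands on the left so that nothing is subtracted and
  \<open>\<Phi>\<close> may be infinite.\<close>

lemma nn_integral_nstep_drift:
  assumes z: "z \<in> space S"
    and [measurable]: "\<Phi> \<in> borel_measurable S" "\<psi> \<in> borel_measurable S"
    and drift: "\<And>w. w \<in> space S \<Longrightarrow> (\<integral>\<^sup>+v. \<Phi> v \<partial>K w) + c \<le> \<Phi> w + \<psi> w"
  shows "(\<integral>\<^sup>+w. \<Phi> w \<partial>nstep S K n z) + of_nat n * c \<le> \<Phi> z + (\<Sum>u<n. \<integral>\<^sup>+w. \<psi> w \<partial>nstep S K u z)"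
proof (induction n)
  case 0
  show ?case using z by (simp add: nn_integral_nstep_0)
next
  case (Suc n)
  have "(\<integral>\<^sup>+w. \<Phi> w \<partial>nstep S K (Suc n) z) + c = (\<integral>\<^sup>+w. (\<integral>\<^sup>+v. \<Phi> v \<partial>K w) + c \<partial>nstep S K n z)"
    using z by (subst nn_integral_add)
      (auto simp: nn_integral_nstep_Suc prob_space.emeasure_space_1[OF prob_space_nstep, simplified]
        borel_measurable_nstep)
  also have "\<dots> \<le> (\<integral>\<^sup>+w. \<Phi> w + \<psi> w \<partial>nstep S K n z)"
    by (rule nn_integral_nstep_mono) (rule drift)
  also have "\<dots> = (\<integral>\<^sup>+w. \<Phi> w \<partial>nstep S K n z) + (\<integral>\<^sup>+w. \<psi> w \<partial>nstep S K n z)"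
    by (rule nn_integral_add) (simp_all add: borel_measurable_nstep)
  finally have step: "(\<integral>\<^sup>+w. \<Phi> w \<partial>nstep S K (Suc n) z) + c \<le>
    (\<integral>\<^sup>+w. \<Phi> w \<partial>nstep S K n z) + (\<integral>\<^sup>+w. \<psi> w \<partial>nstep S K n z)" .
  have "(\<integral>\<^sup>+w. \<Phi> w \<partial>nstep S K (Suc n) z) + of_nat (Suc n) * c =
      ((\<integral>\<^sup>+w. \<Phi> w \<partial>nstep S K (Suc n) z) + c) + of_nat n * c"
    by (simp only: of_nat_Suc distrib_right mult_1 add.assoc)
  also have "\<dots> \<le> ((\<integral>\<^sup>+w. \<Phi> w \<partial>nstep S K n z) + (\<integral>\<^sup>+w. \<psi> w \<partial>nstep S K n z)) + of_nat n * c"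
    by (rule add_right_mono) (rule step)
  also have "\<dots> = ((\<integral>\<^sup>+w. \<Phi> w \<partial>nstep S K n z) + of_nat n * c) + (\<integral>\<^sup>+w. \<psi> w \<partial>nstep S K n z)"
    by (simp only: ac_simps)
  also have "\<dots> \<le> \<Phi> z + (\<Sum>u<Suc n. \<integral>\<^sup>+w. \<psi> w \<partial>nstep S K u z)"
    using Suc by (simp only: sum.lessThan_Suc add.assoc[symmetric]) (rule add_right_mono)
  finally show ?case .
qed

text \<open>The probability, started from \<open>z\<close>, that \<open>D\<close> is not visited at the times \<open>1, \<dots>, k\<close>.\<close>

primrec avoid :: "'a set \<Rightarrow> nat \<Rightarrow> 'a \<Rightarrow> ennreal" where
  "avoid D 0 z = 1"
| "avoid D (Suc k) z = (\<integral>\<^sup>+w. indicator (space S - D) w * avoid D k w \<partial>K z)"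

lemma avoid_measurable [measurable]:
  assumes [measurable]: "D \<in> sets S"
  shows "avoid D k \<in> borel_measurable S"
  by (induction k) (simp_all add: avoid.simps[abs_def])

lemma avoid_le_1: "z \<in> space S \<Longrightarrow> avoid D k z \<le> 1"
proof (induction k arbitrary: z)
  case (Suc k)
  have "avoid D (Suc k) z \<le> (\<integral>\<^sup>+w. 1 \<partial>K z)"
    unfolding avoid.simps using Suc by (intro nn_integral_kernel_mono) (auto simp: indicator_def)
  then show ?case using Suc.prems by (simp only: nn_integral_kernel_const)
qed simp

lemma avoid_antimono_Suc: "z \<in> space S \<Longrightarrow> avoid D (Suc k) z \<le> avoid D k z"
proof (induction k arbitrary: z)
  case 0
  then show ?case using avoid_le_1[of z D 1] by simp
next
  case (Suc k)
  then show ?case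
    unfolding avoid.simps(2)[of D "Suc k"] avoid.simps(2)[of D k]
    by (intro nn_integral_kernel_mono mult_left_mono) auto
qed

section \<open>Return times expressed by avoidance probabilities\<close>

lemma return_time_greater:
  "enat k < return_time D \<omega> \<longleftrightarrow> (\<forall>t\<in>{1..k}. \<omega> t \<notin> D)"
proof
  assume k: "enat k < return_time D \<omega>"
  show "\<forall>t\<in>{1..k}. \<omega> t \<notin> D"
  proof (intro ballI notI)
    fix t assume "t \<in> {1..k}" "\<omega> t \<in> D"
    then have "return_time D \<omega> \<le> enat t" "t \<le> k"
      unfolding return_time_def by (auto intro: INF_lower)
    with k show False
      by (metis enat_ord_simps(1) leD order.trans)
  qed
next
  assume "\<forall>t\<in>{1..k}. \<omega> t \<notin> D"
  then have "eSuc (enat k) \<le> return_time D \<omega>"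
    unfolding return_time_def eSuc_enat by (intro INF_greatest) (force simp: not_less_eq_eq[symmetric])
  then show "enat k < return_time D \<omega>"
    by (simp add: eSuc_enat Suc_ile_eq)
qed

lemma return_time_greater_sets:
  assumes z: "z \<in> space S" and [measurable]: "D \<in> sets S"
  shows "{\<omega> \<in> space (chain_law S K z). enat k < return_time D \<omega>} \<in> sets (chain_law S K z)"
proof -
  note [measurable] = chain_law_coordinate[OF z]
  show ?thesis
    unfolding return_time_greater by measurable
qed

lemma emeasure_return_time_greater:
  assumes z: "z \<in> space S" and D[measurable]: "D \<in> sets S"
  shows "emeasure (chain_law S K z) {\<omega> \<in> space (chain_law S K z). enat k < return_time D \<omega>} = avoid D k z"
proof -
  let ?L = "chain_law S K z"
  note [measurable] = chain_law_coordinate[OF z]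
  let ?B = "\<lambda>n. {\<omega> \<in> space (PiM {0..<Suc n} (\<lambda>_. S)). \<forall>t\<in>{1..n}. \<omega> t \<notin> D}"
  have B: "?B n \<in> sets (PiM {0..<Suc n} (\<lambda>_. S))" for n
  proof -
    have [measurable]: "(\<lambda>\<omega>. \<omega> t) \<in> PiM {0..<Suc n} (\<lambda>_. S) \<rightarrow>\<^sub>M S" if "t \<in> {1..n}" for t
      using that by (intro measurable_component_singleton) auto
    show ?thesis
      by measurable
  qed
  have mem: "restrict \<omega> {0..<Suc n} \<in> ?B n \<longleftrightarrow> (\<forall>t\<in>{1..n}. \<omega> t \<notin> D)" if "\<omega> \<in> space ?L" for \<omega> n
    using measurable_space[OF chain_law_restrict[OF z] that, of "Suc n"] by auto
  \<comment> \<open>The time horizon is split into \<open>n\<close> steps seen on the trajectory and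
    \<open>j\<close> steps left to the recursion. At \<open>n = 0\<close> this is
    \<open>avoid\<close> at the start, at \<open>j = 0\<close> it is the probability of the event;
    the Markov property moves one step across.\<close>
  have "(\<integral>\<^sup>+\<omega>. indicator (?B n) (restrict \<omega> {0..<Suc n}) * avoid D j (\<omega> n) \<partial>?L) = avoid D (n + j) z" for n j
  proof (induction n arbitrary: j)
    case 0
    have "(\<integral>\<^sup>+\<omega>. indicator (?B 0) (restrict \<omega> {0..<Suc 0}) * avoid D j (\<omega> 0) \<partial>?L) =
        (\<integral>\<^sup>+\<omega>. avoid D j (\<omega> 0) \<partial>?L)"
      using mem[of _ 0] by (intro nn_integral_cong) (simp add: indicator_def)
    then show ?case
      using z by (simp only: nn_integral_chain_law_0[OF z avoid_measurable[OF D]] add_0)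
  next
    case (Suc n)
    have "(\<integral>\<^sup>+\<omega>. indicator (?B (Suc n)) (restrict \<omega> {0..<Suc (Suc n)}) * avoid D j (\<omega> (Suc n)) \<partial>?L) =
        (\<integral>\<^sup>+\<omega>. indicator (?B n) (restrict \<omega> {0..<Suc n}) *
          (indicator (space S - D) (\<omega> (Suc n)) * avoid D j (\<omega> (Suc n))) \<partial>?L)"
    proof (rule nn_integral_cong)
      fix \<omega> assume \<omega>: "\<omega> \<in> space ?L"
      have "(\<forall>t\<in>{1..Suc n}. \<omega> t \<notin> D) \<longleftrightarrow> (\<forall>t\<in>{1..n}. \<omega> t \<notin> D) \<and> \<omega> (Suc n) \<notin> D"
        by (auto simp: atLeastAtMostSuc_conv)
      then show "indicator (?B (Suc n)) (restrict \<omega> {0..<Suc (Suc n)}) * avoid D j (\<omega> (Suc n)) =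
          indicator (?B n) (restrict \<omega> {0..<Suc n}) *
          (indicator (space S - D) (\<omega> (Suc n)) * avoid D j (\<omega> (Suc n)))"
        using mem[OF \<omega>, of n] mem[OF \<omega>, of "Suc n"] chain_law_space[OF z \<omega>, of "Suc n"]
        unfolding indicator_def by (simp only: Diff_iff) auto
    qed
    also have "\<dots> = (\<integral>\<^sup>+\<omega>. indicator (?B n) (restrict \<omega> {0..<Suc n}) * avoid D (Suc j) (\<omega> n) \<partial>?L)"
      unfolding avoid.simps by (rule nn_integral_chain_law_Suc[OF z B]) measurable
    also have "\<dots> = avoid D (Suc n + j) z"
      using Suc.IH[of "Suc j"] by (simp only: add_Suc_shift)
    finally show ?case .
  qed
  from this[of k 0]
  have "(\<integral>\<^sup>+\<omega>. indicator (?B k) (restrict \<omega> {0..<Suc k}) \<partial>?L) = avoid D k z"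
    by (simp only: avoid.simps mult_1_right add_0_right)
  moreover have "emeasure ?L {\<omega> \<in> space ?L. enat k < return_time D \<omega>} =
      (\<integral>\<^sup>+\<omega>. indicator {\<omega> \<in> space ?L. enat k < return_time D \<omega>} \<omega> \<partial>?L)"
    by (rule nn_integral_indicator[symmetric]) (rule return_time_greater_sets[OF z D])
  moreover have "\<dots> = (\<integral>\<^sup>+\<omega>. indicator (?B k) (restrict \<omega> {0..<Suc k}) \<partial>?L)"
  proof (rule nn_integral_cong)
    fix \<omega> assume "\<omega> \<in> space ?L"
    then show "indicator {\<omega> \<in> space ?L. enat k < return_time D \<omega>} \<omega> =
        (indicator (?B k) (restrict \<omega> {0..<Suc k}) :: ennreal)"
      using mem[of \<omega> k] unfolding indicator_def return_time_greater by simp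
  qed
  ultimately show ?thesis
    by (simp only:)
qed

text \<open>The tail-sum formula for the mean of an integer-valued time. The bulk of the proof is
  measurability into \<open>enat\<close>, obtained by writing each value through the events
  \<open>enat k < return_time D \<omega>\<close>.\<close>

lemma nn_integral_return_time:
  assumes z: "z \<in> space S" and D: "D \<in> sets S"
  shows "(\<integral>\<^sup>+\<omega>. ennreal_of_enat (return_time D \<omega>) \<partial>chain_law S K z) = (\<Sum>k. avoid D k z)"
proof -
  have "return_time D \<in> chain_law S K z \<rightarrow>\<^sub>M count_space UNIV"
  proof -
    have "return_time D -` {enat k<..} \<inter> space (chain_law S K z) =
        {\<omega> \<in> space (chain_law S K z). enat k < return_time D \<omega>}" for k
      by auto
    then have 1: "return_time D -` {enat k<..} \<inter> space (chain_law S K z) \<in> sets (chain_law S K z)" for k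
      using return_time_greater_sets[OF z D] by simp
    show ?thesis
      unfolding measurable_count_space_eq_countable[OF countableI_type]
    proof (intro conjI ballI)
      fix a :: enat
      show "return_time D -` {a} \<inter> space (chain_law S K z) \<in> sets (chain_law S K z)"
      proof (cases a)
        case infinity
        then have "return_time D -` {a} \<inter> space (chain_law S K z) =
            space (chain_law S K z) \<inter> (\<Inter>k. return_time D -` {enat k<..} \<inter> space (chain_law S K z))"
          by auto (metis less_irrefl not_infinity_eq)
        also have "\<dots> \<in> sets (chain_law S K z)"
          using 1 by (intro sets.Int sets.top sets.countable_INT) auto
        finally show ?thesis .
      next
        case (enat n)
        show ?thesis
        proof (cases n)
          case 0
          then have "return_time D -` {a} \<inter> space (chain_law S K z) =
            space (chain_law S K z) - (return_time D -` {enat 0<..} \<inter> space (chain_law S K z))"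
            using enat by (auto simp: zero_enat_def[symmetric])
          then show ?thesis using 1[of 0] by auto
        next
          case (Suc m)
          then have "return_time D -` {a} \<inter> space (chain_law S K z) =
            (return_time D -` {enat m<..} \<inter> space (chain_law S K z)) - (return_time D -` {enat n<..} \<inter> space (chain_law S K z))"
            using enat by (auto simp: eSuc_enat[symmetric] not_less ileI1 intro!: antisym)
          then show ?thesis using 1 by auto
        qed
      qed
    qed auto
  qed
  then show ?thesis
    by (subst nn_integral_enat_function) (simp_all add: emeasure_return_time_greater[OF z D])
qed

text \<open>The event of no return is the intersection of the events that the return takes longer
  than \<open>k\<close>, so it is null when \<open>avoid D k z\<close> tends to \<open>0\<close>.
  With this lemma and its converse, recurrence is handled through \<open>avoid\<close>
  alone.\<close>

lemma positive_recurrentI: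
  assumes D: "D \<in> sets S"
    and lim: "\<And>z. z \<in> space S \<Longrightarrow> (\<lambda>k. avoid D k z) \<longlonglongrightarrow> 0"
    and sup: "\<And>z. z \<in> D \<Longrightarrow> (\<Sum>k. avoid D k z) \<le> C" and C: "C < \<infinity>"
  shows "positive_recurrent S K D"
  unfolding positive_recurrent_def
proof (intro conjI ballI)
  have "D \<subseteq> space S"
    using D sets.sets_into_space by blast
  then have "(SUP z\<in>D. \<integral>\<^sup>+\<omega>. ennreal_of_enat (return_time D \<omega>) \<partial>chain_law S K z) \<le> C"
    by (intro SUP_least) (auto simp: nn_integral_return_time D sup subset_iff)
  with C show "(SUP z\<in>D. \<integral>\<^sup>+\<omega>. ennreal_of_enat (return_time D \<omega>) \<partial>chain_law S K z) < \<infinity>"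
    by simp
  fix z assume z: "z \<in> space S"
  show "AE \<omega> in chain_law S K z. return_time D \<omega> < \<infinity>"
  proof (rule AE_I')
    let ?N = "\<Inter>k. {\<omega> \<in> space (chain_law S K z). enat k < return_time D \<omega>}"
    have N: "?N \<in> sets (chain_law S K z)"
      using return_time_greater_sets[OF z D] by (intro sets.countable_INT) auto
    have "emeasure (chain_law S K z) ?N \<le> avoid D k z" for k
      unfolding emeasure_return_time_greater[OF z D, symmetric]
      by (rule emeasure_mono) (use return_time_greater_sets[OF z D] in auto)
    then have "emeasure (chain_law S K z) ?N \<le> 0"
      using lim[OF z] by (intro LIMSEQ_le_const) auto
    with N show "?N \<in> null_sets (chain_law S K z)"
      by (auto simp: null_sets_def)
    show "{\<omega> \<in> space (chain_law S K z). \<not> return_time D \<omega> < \<infinity>} \<subseteq> ?N"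
      by auto
  qed
qed (rule D)

lemma positive_recurrentD:
  assumes "positive_recurrent S K D"
  shows "D \<in> sets S" and "z \<in> space S \<Longrightarrow> (\<lambda>k. avoid D k z) \<longlonglongrightarrow> 0"
    and "\<exists>b::real. \<forall>z\<in>D. (\<Sum>k. avoid D k z) \<le> ennreal b"
proof -
  show D: "D \<in> sets S"
    using assms by (simp add: positive_recurrent_def)
  have DS: "D \<subseteq> space S"
    using D sets.sets_into_space by blast
  show "(\<lambda>k. avoid D k z) \<longlonglongrightarrow> 0" if z: "z \<in> space S"
  proof -
    interpret L: prob_space "chain_law S K z"
      using z by (intro prob_space_chain_law kernel)
    let ?A = "\<lambda>k. {\<omega> \<in> space (chain_law S K z). enat k < return_time D \<omega>}"
    have "(\<lambda>k. emeasure (chain_law S K z) (?A k)) \<longlonglongrightarrow> emeasure (chain_law S K z) (\<Inter>k. ?A k)"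
    proof (rule Lim_emeasure_decseq)
      show "decseq ?A"
        by (auto simp: decseq_def intro: le_less_trans[rotated])
    qed (use return_time_greater_sets[OF z D] in auto)
    moreover have "emeasure (chain_law S K z) (\<Inter>k. ?A k) = 0"
    proof -
      have "AE \<omega> in chain_law S K z. \<omega> \<notin> (\<Inter>k. ?A k)"
      proof -
        have "AE \<omega> in chain_law S K z. return_time D \<omega> < \<infinity>"
          using assms z by (simp add: positive_recurrent_def)
        then show ?thesis
          by eventually_elim (auto intro: less_asym)
      qed
      then show ?thesis
        using return_time_greater_sets[OF z D] by (subst (asm) AE_iff_measurable) auto
    qed
    ultimately show ?thesis
      using z D by (simp add: emeasure_return_time_greater)
  qed
  have "(SUP z\<in>D. \<Sum>k. avoid D k z) < \<infinity>"
    using assms DS unfolding positive_recurrent_def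
    by (simp add: nn_integral_return_time D subset_iff cong: SUP_cong)
  then obtain b :: real where "(SUP z\<in>D. \<Sum>k. avoid D k z) = ennreal b"
    by (cases "SUP z\<in>D. \<Sum>k. avoid D k z" rule: ennreal_cases) auto
  then show "\<exists>b::real. \<forall>z\<in>D. (\<Sum>k. avoid D k z) \<le> ennreal b"
    by (metis SUP_upper)
qed

end

section \<open>Bounded functions under the kernel\<close>

context markov_chain
begin

definition bounded_by :: "real \<Rightarrow> ('a \<Rightarrow> real) \<Rightarrow> bool" where
  "bounded_by F g \<longleftrightarrow> g \<in> borel_measurable S \<and> (\<forall>x\<in>space S. \<bar>g x\<bar> \<le> F)"

definition kernel_op :: "('a \<Rightarrow> real) \<Rightarrow> 'a \<Rightarrow> real" where
  "kernel_op g x = (\<integral>w. g w \<partial>K x)"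

abbreviation kernel_pow :: "nat \<Rightarrow> ('a \<Rightarrow> real) \<Rightarrow> 'a \<Rightarrow> real" where
  "kernel_pow n g \<equiv> (kernel_op ^^ n) g"

text \<open>The expectation under the start \<open>x\<close> of the sum of \<open>g\<close> over the
  times \<open>0, ..., t - 1\<close>, written through powers of the kernel.\<close>

definition psum :: "('a \<Rightarrow> real) \<Rightarrow> nat \<Rightarrow> 'a \<Rightarrow> real" where
  "psum g t x = (\<Sum>s<t. kernel_pow s g x)"

lemma bounded_by_measurable: "bounded_by F g \<Longrightarrow> g \<in> borel_measurable S"
  by (simp add: bounded_by_def)

lemma bounded_byD: "bounded_by F g \<Longrightarrow> x \<in> space S \<Longrightarrow> \<bar>g x\<bar> \<le> F"
  by (simp add: bounded_by_def)

lemma bounded_by_const: "bounded_by \<bar>c\<bar> (\<lambda>_. c)"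
  by (simp add: bounded_by_def)

lemma bounded_by_add: "bounded_by F g \<Longrightarrow> bounded_by F' g' \<Longrightarrow> bounded_by (F + F') (\<lambda>x. g x + g' x)"
  unfolding bounded_by_def by (fastforce intro: abs_triangle_ineq[THEN order.trans] add_mono)

lemma bounded_by_uminus: "bounded_by F g \<Longrightarrow> bounded_by F (\<lambda>x. - g x)"
  unfolding bounded_by_def by auto

lemma bounded_by_diff: "bounded_by F g \<Longrightarrow> bounded_by F' g' \<Longrightarrow> bounded_by (F + F') (\<lambda>x. g x - g' x)"
  using bounded_by_add[OF _ bounded_by_uminus, of F g F' g'] by simp

lemma bounded_by_cmult: "bounded_by F g \<Longrightarrow> bounded_by (\<bar>c\<bar> * F) (\<lambda>x. c * g x)"
  unfolding bounded_by_def by (auto simp: abs_mult intro: mult_left_mono)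

lemma bounded_by_sum:
  "(\<And>i. i \<in> I \<Longrightarrow> bounded_by (F i) (g i)) \<Longrightarrow> bounded_by (\<Sum>i\<in>I. F i) (\<lambda>x. \<Sum>i\<in>I. g i x)"
  unfolding bounded_by_def by (auto intro!: sum_abs[THEN order.trans] sum_mono borel_measurable_sum)

lemma bounded_by_integrable:
  assumes g: "bounded_by F g" and P: "prob_space P" "sets P = sets S"
  shows "integrable P g"
proof -
  interpret prob_space P by fact
  have "g \<in> borel_measurable P"
    using g P(2) by (simp add: bounded_by_def cong: measurable_cong_sets)
  then show ?thesis
    using bounded_byD[OF g] sets_eq_imp_space_eq[OF P(2)]
    by (intro integrable_const_bound[where B=F]) auto
qed

lemma bounded_by_integral:
  assumes g: "bounded_by F g" and P: "prob_space P" "sets P = sets S"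
  shows "\<bar>\<integral>x. g x \<partial>P\<bar> \<le> F"
proof -
  interpret prob_space P by fact
  have i: "integrable P g" by (rule bounded_by_integrable) fact+
  have "(\<integral>x. g x \<partial>P) \<le> (\<integral>x. F \<partial>P)" "(\<integral>x. - F \<partial>P) \<le> (\<integral>x. g x \<partial>P)"
    using bounded_byD[OF g] sets_eq_imp_space_eq[OF P(2)] i
    by (intro integral_mono; force simp: abs_le_iff)+
  then show ?thesis by (simp add: prob_space abs_le_iff)
qed

lemma integrable_kernel: "bounded_by F g \<Longrightarrow> x \<in> space S \<Longrightarrow> integrable (K x) g"
  by (rule bounded_by_integrable) (auto simp: prob_space_kernel sets_kernel)

lemma bounded_by_kernel_op: "bounded_by F g \<Longrightarrow> bounded_by F (kernel_op g)"
  unfolding bounded_by_def[of F "kernel_op g"] unfolding kernel_op_def[abs_def]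
  using bounded_by_integral[of F g] bounded_by_measurable[of F g] integral_kernel_measurable
  by (auto simp: prob_space_kernel sets_kernel)

lemma bounded_by_kernel_pow: "bounded_by F g \<Longrightarrow> bounded_by F (kernel_pow n g)"
  by (induction n) (auto intro: bounded_by_kernel_op)

lemma bounded_by_psum: "bounded_by F g \<Longrightarrow> bounded_by (t * F) (psum g t)"
  unfolding psum_def[abs_def]
  using bounded_by_sum[of "{..<t}" "\<lambda>_. F" "\<lambda>s. kernel_pow s g"] bounded_by_kernel_pow[of F g]
  by simp

lemma kernel_op_cong: "x \<in> space S \<Longrightarrow> (\<And>w. w \<in> space S \<Longrightarrow> g w = g' w) \<Longrightarrow> kernel_op g x = kernel_op g' x"
  unfolding kernel_op_def by (intro Bochner_Integration.integral_cong refl) (simp add: space_kernel)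

lemma kernel_op_mono:
  "x \<in> space S \<Longrightarrow> bounded_by F g \<Longrightarrow> bounded_by F' g' \<Longrightarrow> (\<And>w. w \<in> space S \<Longrightarrow> g w \<le> g' w) \<Longrightarrow>
    kernel_op g x \<le> kernel_op g' x"
  unfolding kernel_op_def by (intro integral_mono integrable_kernel) (auto simp: space_kernel)

lemma kernel_op_const [simp]: "x \<in> space S \<Longrightarrow> kernel_op (\<lambda>_. c) x = c"
  using prob_space.prob_space[OF prob_space_kernel, of x] by (simp add: kernel_op_def)

lemma kernel_op_add:
  "x \<in> space S \<Longrightarrow> bounded_by F g \<Longrightarrow> bounded_by F' g' \<Longrightarrow>
    kernel_op (\<lambda>w. g w + g' w) x = kernel_op g x + kernel_op g' x"
  unfolding kernel_op_def by (intro Bochner_Integration.integral_add integrable_kernel)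

lemma kernel_op_diff:
  "x \<in> space S \<Longrightarrow> bounded_by F g \<Longrightarrow> bounded_by F' g' \<Longrightarrow>
    kernel_op (\<lambda>w. g w - g' w) x = kernel_op g x - kernel_op g' x"
  unfolding kernel_op_def by (intro Bochner_Integration.integral_diff integrable_kernel)

lemma kernel_op_cmult: "kernel_op (\<lambda>w. c * g w) x = c * kernel_op g x"
  unfolding kernel_op_def by simp

lemma kernel_op_uminus: "kernel_op (\<lambda>w. - g w) x = - kernel_op g x"
  unfolding kernel_op_def by simp

lemma kernel_op_sum:
  "x \<in> space S \<Longrightarrow> (\<And>i. i \<in> I \<Longrightarrow> bounded_by (F i) (g i)) \<Longrightarrow>
    kernel_op (\<lambda>w. \<Sum>i\<in>I. g i w) x = (\<Sum>i\<in>I. kernel_op (g i) x)"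
  unfolding kernel_op_def by (intro Bochner_Integration.integral_sum integrable_kernel)

lemma kernel_pow_uminus: "kernel_pow n (\<lambda>w. - g w) x = - kernel_pow n g x"
proof -
  have "kernel_op (\<lambda>w. - h w) = (\<lambda>w. - kernel_op h w)" for h
    by (simp add: fun_eq_iff kernel_op_uminus)
  then have "kernel_pow n (\<lambda>w. - g w) = (\<lambda>w. - kernel_pow n g w)"
    by (induction n) simp_all
  then show ?thesis by simp
qed

lemma psum_uminus: "psum (\<lambda>w. - g w) t x = - psum g t x"
  by (simp add: psum_def kernel_pow_uminus sum_negf)

lemma kernel_op_psum:
  "x \<in> space S \<Longrightarrow> bounded_by F g \<Longrightarrow> kernel_op (psum g t) x = (\<Sum>s<t. kernel_pow (Suc s) g x)"
  unfolding psum_def[abs_def] by (subst kernel_op_sum) (auto intro: bounded_by_kernel_pow)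

lemma psum_Suc:
  "x \<in> space S \<Longrightarrow> bounded_by F g \<Longrightarrow> psum g (Suc t) x = g x + kernel_op (psum g t) x"
  by (subst kernel_op_psum, assumption, assumption) (simp add: psum_def sum.lessThan_Suc_shift del: sum.lessThan_Suc)

text \<open>Shifting the window of summation by one step changes only its two end terms. So
  \<open>psum g t\<close> is invariant under the kernel up to an error that does not grow with
  \<open>t\<close>.\<close>

lemma kernel_op_psum_eq:
  "x \<in> space S \<Longrightarrow> bounded_by F g \<Longrightarrow> kernel_op (psum g t) x = psum g t x - g x + kernel_pow t g x"
  using psum_Suc[of x F g t] by (simp add: psum_def)

lemma kernel_op_psum_diff:
  "x \<in> space S \<Longrightarrow> bounded_by F g \<Longrightarrow> \<bar>kernel_op (psum g t) x - psum g t x\<bar> \<le> 2 * F"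
  using kernel_op_psum_eq[of x F g t] bounded_byD[of F g x]
    bounded_byD[OF bounded_by_kernel_pow[of F g t], of x] by force

lemma kernel_pow_psum_diff:
  assumes g: "bounded_by F g" and x: "x \<in> space S"
  shows "\<bar>kernel_pow m (psum g t) x - psum g t x\<bar> \<le> 2 * m * F"
  using x
proof (induction m arbitrary: x)
  case (Suc m)
  note b = bounded_by_psum[OF g, of t]
  note bm = bounded_by_kernel_pow[OF b, of m]
  have "bounded_by (2 * m * F) (\<lambda>w. kernel_pow m (psum g t) w - psum g t w)"
    using Suc.IH bounded_by_measurable[OF b] bounded_by_measurable[OF bm]
    by (simp add: bounded_by_def)
  from bounded_byD[OF bounded_by_kernel_op[OF this] Suc.prems]
  have "\<bar>kernel_pow (Suc m) (psum g t) x - kernel_op (psum g t) x\<bar> \<le> 2 * m * F"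
    by (simp add: kernel_op_diff[OF Suc.prems bm b])
  with kernel_op_psum_diff[OF Suc.prems g, of t] show ?case
    by (simp add: algebra_simps)
qed simp

lemma nn_integral_kernel_bounded:
  assumes g: "bounded_by F g" and pos: "\<And>w. w \<in> space S \<Longrightarrow> 0 \<le> g w" and x: "x \<in> space S"
  shows "(\<integral>\<^sup>+w. ennreal (g w) \<partial>K x) = ennreal (kernel_op g x)"
  unfolding kernel_op_def using pos x
  by (intro nn_integral_eq_integral integrable_kernel[OF g]) (auto simp: space_kernel)

lemma kernel_pow_nonneg:
  assumes g: "bounded_by F g" and pos: "\<And>w. w \<in> space S \<Longrightarrow> 0 \<le> g w" and x: "x \<in> space S"
  shows "0 \<le> kernel_pow n g x"
  using x
proof (induction n arbitrary: x)
  case (Suc n)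
  then show ?case
    using kernel_op_mono[OF Suc.prems bounded_by_const bounded_by_kernel_pow[OF g], of 0 n] by simp
qed (simp add: pos)

lemma integral_stationary:
  assumes pi: "stationary S K \<pi>" and g: "bounded_by F g"
  shows "(\<integral>x. kernel_op g x \<partial>\<pi>) = (\<integral>x. g x \<partial>\<pi>)"
proof -
  have sets: "sets \<pi> = sets S" and prob: "prob_space \<pi>" and inv: "\<pi> \<bind> K = \<pi>"
    using pi by (auto simp: stationary_def space_prob_algebra)
  interpret prob_space \<pi> by fact
  have sp: "space \<pi> = space S"
    using sets by (rule sets_eq_imp_space_eq)
  have "(\<integral>x. g x \<partial>(\<pi> \<bind> K)) = (\<integral>x. (\<integral>w. g w \<partial>K x) \<partial>\<pi>)"
  proof (rule integral_bind[where K=S and B=F and B'=1])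
    show "\<bar>g x\<bar> \<le> F" if "x \<in> space S" for x
      using bounded_byD[OF g that] .
    show "K \<in> \<pi> \<rightarrow>\<^sub>M subprob_algebra S"
      using kernel_subprob by (simp add: measurable_cong_sets[OF sets refl])
    show "AE x in \<pi>. emeasure (K x) (space (K x)) \<le> ennreal 1"
      using sp by (auto simp: prob_space.emeasure_space_1[OF prob_space_kernel])
  qed (use bounded_by_measurable[OF g] finite_measure_axioms in auto)
  then show ?thesis
    by (simp add: inv kernel_op_def)
qed

lemma integral_stationary_pow:
  "stationary S K \<pi> \<Longrightarrow> bounded_by F g \<Longrightarrow> (\<integral>x. kernel_pow n g x \<partial>\<pi>) = (\<integral>x. g x \<partial>\<pi>)"
  by (induction n) (simp_all add: integral_stationary[OF _ bounded_by_kernel_pow])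

text \<open>The probability that the hitting time counted from time \<open>0\<close> exceeds
  \<open>k\<close>. Since \<open>avoid\<close> ignores time \<open>0\<close>, the indicator removes
  starts in \<open>D\<close>.\<close>

definition survive :: "'a set \<Rightarrow> nat \<Rightarrow> 'a \<Rightarrow> real" where
  "survive D k x = indicator (space S - D) x * enn2real (avoid D k x)"

text \<open>\<open>hit D n x\<close> is \<open>E\<^sub>x (min \<sigma> n)\<close> for the hitting time \<open>\<sigma> \<ge> 0\<close> of \<open>D\<close>.\<close>

definition hit :: "'a set \<Rightarrow> nat \<Rightarrow> 'a \<Rightarrow> real" where
  "hit D n x = (\<Sum>k<n. survive D k x)"

lemma bounded_by_survive: "D \<in> sets S \<Longrightarrow> bounded_by 1 (survive D k)"
proof -
  assume [measurable]: "D \<in> sets S"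
  have "\<bar>survive D k x\<bar> \<le> 1" if "x \<in> space S" for x
    using avoid_le_1[OF that, of D k] by (auto simp: survive_def indicator_def enn2real_leI)
  moreover have "survive D k \<in> borel_measurable S"
    unfolding survive_def[abs_def] by measurable
  ultimately show ?thesis
    by (simp add: bounded_by_def)
qed

lemma survive_nonneg: "0 \<le> survive D k x"
  by (simp add: survive_def)

lemma ennreal_survive: "x \<in> space S \<Longrightarrow> ennreal (survive D k x) = indicator (space S - D) x * avoid D k x"
  using avoid_le_1[of x D k] by (auto simp: survive_def indicator_def order.strict_trans1 intro!: ennreal_enn2real)

lemma avoid_Suc_survive:
  assumes D: "D \<in> sets S" and x: "x \<in> space S"
  shows "avoid D (Suc k) x = ennreal (kernel_op (survive D k) x)"
proof -
  have "avoid D (Suc k) x = (\<integral>\<^sup>+w. ennreal (survive D k w) \<partial>K x)"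
    unfolding avoid.simps using x by (intro nn_integral_cong) (auto simp: ennreal_survive space_kernel)
  then show ?thesis
    using nn_integral_kernel_bounded[OF bounded_by_survive[OF D] survive_nonneg x] by simp
qed

lemma kernel_op_survive:
  "D \<in> sets S \<Longrightarrow> x \<in> space S \<Longrightarrow> kernel_op (survive D k) x = enn2real (avoid D (Suc k) x)"
  unfolding avoid_Suc_survive kernel_op_def by (simp add: survive_nonneg)

lemma bounded_by_hit: "D \<in> sets S \<Longrightarrow> bounded_by n (hit D n)"
  unfolding hit_def[abs_def] using bounded_by_sum[of "{..<n}" "\<lambda>_. 1" "survive D"] bounded_by_survive by simp

lemma hit_nonneg: "0 \<le> hit D n x"
  by (simp add: hit_def sum_nonneg survive_nonneg)

lemma hit_mem: "x \<in> D \<Longrightarrow> hit D n x = 0"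
  by (simp add: hit_def survive_def)

lemma kernel_op_hit:
  assumes D: "D \<in> sets S" and x: "x \<in> space S"
  shows "kernel_op (hit D n) x = (\<Sum>k<n. enn2real (avoid D (Suc k) x))"
  unfolding hit_def[abs_def]
  by (subst kernel_op_sum) (auto intro: bounded_by_survive D simp: x kernel_op_survive D simp del: avoid.simps)

lemma kernel_op_hit_outside:
  assumes D: "D \<in> sets S" and x: "x \<in> space S" "x \<notin> D"
  shows "1 + kernel_op (hit D n) x = hit D (Suc n) x"
  unfolding kernel_op_hit[OF D x(1)] hit_def sum.lessThan_Suc_shift using x by (simp add: survive_def)

text \<open>Stop at the first visit to \<open>D\<close>. Each step before it contributes at most
  \<open>F\<close>. After it fewer than \<open>t\<close> terms may remain, whereas \<open>H\<close>
  bounds a sum of \<open>t\<close> terms; dropping the missing ones costs at most \<open>F\<close>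
  each. Together this is \<open>2 * F\<close> per step spent outside \<open>D\<close>.\<close>

lemma psum_le_hit:
  assumes D: "D \<in> sets S" and g: "bounded_by F g"
    and H: "\<And>x. x \<in> D \<Longrightarrow> psum g t x \<le> H" "- (F * t) \<le> H" and x: "x \<in> space S"
  shows "psum g t x \<le> H + 2 * F * hit D t x"
proof -
  have F: "0 \<le> F"
    using bounded_byD[OF g x] by linarith
  \<comment> \<open>The induction runs over shorter horizons \<open>k\<close>, with
    \<open>F * (real t - real k)\<close> paying for the terms missing from a full sum. At
    \<open>k = 0\<close> this is the second assumption in \<open>H\<close>.\<close>
  have "psum g k x \<le> H + F * (real t - real k) + 2 * F * hit D k x" if "k \<le> t" "x \<in> space S" for k x
    using that
  proof (induction k arbitrary: x)
    case 0
    then show ?case using H(2) by (simp add: psum_def hit_def)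
  next
    case (Suc k)
    show ?case
    proof (cases "x \<in> D")
      case True
      have "psum g t x = psum g (Suc k) x + (\<Sum>s\<in>{Suc k..<t}. kernel_pow s g x)"
        using Suc.prems(1) by (simp add: psum_def lessThan_atLeast0 sum.atLeastLessThan_concat del: sum.op_ivl_Suc)
      moreover have "(\<Sum>s\<in>{Suc k..<t}. kernel_pow s g x) \<ge> (\<Sum>s\<in>{Suc k..<t}. - F)"
        using bounded_byD[OF bounded_by_kernel_pow[OF g] Suc.prems(2)]
        by (intro sum_mono) (simp add: abs_le_iff minus_le_iff)
      moreover have "(\<Sum>s\<in>{Suc k..<t}. - F) = - (F * (real t - real (Suc k)))"
        using Suc.prems(1) by (simp add: of_nat_diff)
      ultimately have "psum g (Suc k) x \<le> H + F * (real t - real (Suc k))"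
        using H(1)[OF True] by linarith
      then show ?thesis
        by (simp add: hit_mem[OF True])
    next
      case False
      let ?h = "\<lambda>w. H + F * (real t - real k) + 2 * F * hit D k w"
      have bh: "bounded_by (\<bar>2 * F\<bar> * real k) (\<lambda>w. 2 * F * hit D k w)"
        by (intro bounded_by_cmult bounded_by_hit D)
      have "kernel_op (psum g k) x \<le> kernel_op ?h x"
        using Suc by (intro kernel_op_mono[OF Suc.prems(2) bounded_by_psum[OF g] bounded_by_add[OF bounded_by_const bh]]) auto
      also have "\<dots> = H + F * (real t - real k) + 2 * F * kernel_op (hit D k) x"
        using Suc.prems by (simp add: kernel_op_add[OF _ bounded_by_const bh] kernel_op_cmult)
      also have "kernel_op (hit D k) x = hit D (Suc k) x - 1"
        using kernel_op_hit_outside[OF D Suc.prems(2) False, of k] by simp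
      finally have "psum g (Suc k) x \<le> g x + (H + F * (real t - real k) + 2 * F * (hit D (Suc k) x - 1))"
        using psum_Suc[OF Suc.prems(2) g, of k] by simp
      moreover have "g x \<le> F"
        using bounded_byD[OF g Suc.prems(2)] by linarith
      ultimately show ?thesis
        by (simp add: algebra_simps)
    qed
  qed
  from this[OF order.refl x] show ?thesis by simp
qed

end

section \<open>Minorized positive recurrent chains\<close>

lemma sum_le_of_tendsto_0:
  fixes a :: "nat \<Rightarrow> real"
  assumes a: "a \<longlonglongrightarrow> 0" and pos: "\<And>k. 0 \<le> a k" and \<delta>: "0 < \<delta>"
  shows "\<exists>t0. \<forall>t\<ge>t0. (\<Sum>k<t. a k) \<le> \<delta> * real t"
proof -
  from order_tendstoD(2)[OF a, of "\<delta> / 2"] \<delta> obtain n where n: "\<And>k. n \<le> k \<Longrightarrow> a k < \<delta> / 2"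
    by (auto simp: eventually_sequentially)
  obtain t1 :: nat where t1: "2 * (\<Sum>k<n. a k) / \<delta> \<le> real t1"
    using real_arch_simple by blast
  have "(\<Sum>k<t. a k) \<le> \<delta> * real t" if t: "max t1 n \<le> t" for t
  proof -
    have "(\<Sum>k<t. a k) = (\<Sum>k<n. a k) + (\<Sum>k\<in>{n..<t}. a k)"
      using t by (simp add: lessThan_atLeast0 sum.atLeastLessThan_concat)
    also have "(\<Sum>k\<in>{n..<t}. a k) \<le> (\<Sum>k\<in>{n..<t}. \<delta> / 2)"
      using n by (intro sum_mono) (auto intro: less_imp_le)
    also have "\<dots> \<le> \<delta> / 2 * t"
      using \<delta> by (simp add: field_simps)
    also have "(\<Sum>k<n. a k) \<le> \<delta> / 2 * t"
    proof -
      have "2 * (\<Sum>k<n. a k) / \<delta> \<le> real t"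
        using t1 t by (simp add: order.trans)
      then show ?thesis using \<delta> by (simp add: field_simps)
    qed
    finally show ?thesis by (simp add: algebra_simps)
  qed
  then show ?thesis by blast
qed

context markov_chain
begin

lemma nn_integral_nstep_bounded:
  assumes g: "bounded_by F g" and pos: "\<And>w. w \<in> space S \<Longrightarrow> 0 \<le> g w" and x: "x \<in> space S"
  shows "(\<integral>\<^sup>+w. ennreal (g w) \<partial>nstep S K n x) = ennreal (kernel_pow n g x)"
  using g pos
proof (induction n arbitrary: g)
  case 0
  then show ?case
    using x bounded_by_measurable[OF 0(1)] by (simp add: nn_integral_nstep_0)
next
  case (Suc n)
  have [measurable]: "g \<in> borel_measurable S"
    using bounded_by_measurable[OF Suc.prems(1)] .
  have "(\<integral>\<^sup>+w. ennreal (g w) \<partial>nstep S K (Suc n) x) = (\<integral>\<^sup>+w. ennreal (kernel_op g w) \<partial>nstep S K n x)"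
    using x Suc.prems by (subst nn_integral_nstep_Suc) (auto intro!: nn_integral_cong nn_integral_kernel_bounded)
  also have "\<dots> = ennreal (kernel_pow (Suc n) g x)"
    unfolding funpow_Suc_right comp_def using kernel_pow_nonneg[OF Suc.prems, of _ 1]
    by (intro Suc.IH bounded_by_kernel_op Suc.prems) auto
  finally show ?case .
qed

lemma sum_nn_integral_nstep_bounded:
  assumes g: "bounded_by F g" and pos: "\<And>w. w \<in> space S \<Longrightarrow> 0 \<le> g w" and x: "x \<in> space S"
  shows "(\<Sum>u<t. \<integral>\<^sup>+w. ennreal (g w) \<partial>nstep S K u x) = ennreal (psum g t x)"
  using kernel_pow_nonneg[OF g pos x] by (simp add: nn_integral_nstep_bounded[OF g pos x] psum_def)

end

locale minorized_chain = markov_chain S K for S :: "'a measure" and K +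
  fixes V :: "'a set" and \<pi> :: "'a measure"
  assumes recurrent: "positive_recurrent S K V"
    and minorized: "minorized S K V"
    and stationary: "stationary S K \<pi>"
begin

lemma V_sets [measurable]: "V \<in> sets S"
  using positive_recurrentD(1)[OF recurrent] .

lemma V_space: "x \<in> V \<Longrightarrow> x \<in> space S"
  using V_sets sets.sets_into_space by blast

lemma prob_space_stationary: "prob_space \<pi>" and sets_stationary: "sets \<pi> = sets S"
  using stationary by (auto simp: stationary_def space_prob_algebra)

lemma space_stationary: "space \<pi> = space S"
  using sets_stationary by (rule sets_eq_imp_space_eq)

lemma integrable_stationary: "bounded_by F g \<Longrightarrow> integrable \<pi> g"
  by (rule bounded_by_integrable) (auto simp: prob_space_stationary sets_stationary)

lemma integral_mono_stationary:
  "bounded_by F g \<Longrightarrow> bounded_by F' g' \<Longrightarrow> (\<And>x. x \<in> space S \<Longrightarrow> g x \<le> g' x) \<Longrightarrow>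
    (\<integral>x. g x \<partial>\<pi>) \<le> (\<integral>x. g' x \<partial>\<pi>)"
  by (intro integral_mono integrable_stationary) (auto simp: space_stationary)

lemma measure_stationary_space [simp]: "measure \<pi> (space \<pi>) = 1"
  by (rule prob_space.prob_space[OF prob_space_stationary])

text \<open>The cut-off to \<open>V\<close> makes the mean return time bounded, and it makes the
  balance \<open>nn_integral_hit_total\<close> hold at every state in one form.\<close>

definition mean_return :: "'a \<Rightarrow> real" where
  "mean_return x = indicator V x * enn2real (\<Sum>k. avoid V k x)"

text \<open>The untruncated mean hitting time of \<open>V\<close>. It is
  \<open>ennreal\<close>-valued because only returns from \<open>V\<close> are assumed to have
  bounded mean.\<close>

definition hit_total :: "'a \<Rightarrow> ennreal" where
  "hit_total x = (\<Sum>k. ennreal (survive V k x))"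

lemma hit_total_measurable [measurable]: "hit_total \<in> borel_measurable S"
  unfolding hit_total_def[abs_def]
  using bounded_by_measurable[OF bounded_by_survive[OF V_sets]] by measurable

lemma hit_total_mem: "x \<in> V \<Longrightarrow> hit_total x = 0"
  by (simp add: hit_total_def survive_def)

lemma ex_return_bound: "\<exists>b\<ge>0. \<forall>x\<in>V. (\<Sum>k. avoid V k x) \<le> ennreal b"
proof -
  from positive_recurrentD(3)[OF recurrent] obtain b where b: "\<forall>x\<in>V. (\<Sum>k. avoid V k x) \<le> ennreal b"
    by blast
  have "ennreal b \<le> ennreal \<bar>b\<bar>"
    by (simp add: ennreal_leI)
  with b have "\<forall>x\<in>V. (\<Sum>k. avoid V k x) \<le> ennreal \<bar>b\<bar>"
    by (metis order.trans)
  then show ?thesis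
    by (metis abs_ge_zero)
qed

definition return_bound :: real where
  "return_bound = (SOME b. 0 \<le> b \<and> (\<forall>x\<in>V. (\<Sum>k. avoid V k x) \<le> ennreal b))"

lemma return_bound: "0 \<le> return_bound" "x \<in> V \<Longrightarrow> (\<Sum>k. avoid V k x) \<le> ennreal return_bound"
proof -
  have "0 \<le> return_bound \<and> (\<forall>x\<in>V. (\<Sum>k. avoid V k x) \<le> ennreal return_bound)"
    unfolding return_bound_def by (rule someI_ex) (use ex_return_bound in blast)
  then show "0 \<le> return_bound" "x \<in> V \<Longrightarrow> (\<Sum>k. avoid V k x) \<le> ennreal return_bound"
    by auto
qed

lemma ennreal_mean_return: "x \<in> V \<Longrightarrow> ennreal (mean_return x) = (\<Sum>k. avoid V k x)"
  using order.strict_trans1[OF return_bound(2), of x top] by (simp add: mean_return_def)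

lemma mean_return_nonneg: "0 \<le> mean_return x"
  by (simp add: mean_return_def)

lemma bounded_by_mean_return: "bounded_by return_bound mean_return"
proof -
  have "mean_return x \<le> return_bound" if "x \<in> space S" for x
  proof (cases "x \<in> V")
    case True
    have "ennreal (mean_return x) \<le> ennreal return_bound"
      using return_bound(2)[OF True] by (simp add: ennreal_mean_return[OF True])
    then show ?thesis
      using return_bound(1) by simp
  qed (simp add: mean_return_def return_bound(1))
  moreover have "mean_return \<in> borel_measurable S"
    unfolding mean_return_def[abs_def] by measurable
  ultimately show ?thesis
    by (simp add: bounded_by_def mean_return_nonneg)
qed

text \<open>The return time is one plus the hitting time from the next state. Off \<open>V\<close>
  it coincides with the hitting time; on \<open>V\<close> the hitting time is \<open>0\<close> and
  the mean return time appears as the extra term.\<close>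

lemma nn_integral_hit_total:
  assumes x: "x \<in> space S"
  shows "(\<integral>\<^sup>+w. hit_total w \<partial>K x) + 1 = hit_total x + ennreal (mean_return x)"
proof -
  have "(\<integral>\<^sup>+w. hit_total w \<partial>K x) = (\<Sum>k. \<integral>\<^sup>+w. ennreal (survive V k w) \<partial>K x)"
    unfolding hit_total_def
    by (rule nn_integral_suminf)
      (intro borel_measurable_kernel[OF x] measurable_compose[OF _ measurable_ennreal]
        bounded_by_measurable[OF bounded_by_survive[OF V_sets]])
  also have "\<dots> = (\<Sum>k. avoid V (Suc k) x)"
    by (simp only: avoid_Suc_survive[OF V_sets x]
        nn_integral_kernel_bounded[OF bounded_by_survive[OF V_sets] survive_nonneg x])
  finally have "(\<integral>\<^sup>+w. hit_total w \<partial>K x) + 1 = (\<Sum>k. avoid V (k + 1) x) + (\<Sum>k<1. avoid V k x)"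
    by simp
  also have "\<dots> = (\<Sum>k. avoid V k x)"
    by (rule suminf_offset[symmetric]) (rule summableI)
  also have "\<dots> = hit_total x + ennreal (mean_return x)"
  proof (cases "x \<in> V")
    case True
    then show ?thesis by (simp add: hit_total_mem ennreal_mean_return)
  next
    case False
    then show ?thesis
      using x by (simp add: hit_total_def ennreal_survive mean_return_def)
  qed
  finally show ?thesis .
qed

lemma nn_integral_hit_total_le:
  assumes "x \<in> V" shows "(\<integral>\<^sup>+w. hit_total w \<partial>K x) \<le> ennreal return_bound"
proof -
  have "(\<integral>\<^sup>+w. hit_total w \<partial>K x) \<le> (\<integral>\<^sup>+w. hit_total w \<partial>K x) + 1"
    by simp
  also have "\<dots> = (\<Sum>k. avoid V k x)"
    using assms V_space by (simp add: nn_integral_hit_total hit_total_mem ennreal_mean_return)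
  finally show ?thesis
    using return_bound(2)[OF assms] by simp
qed

lemma kernel_op_hit_le:
  assumes x: "x \<in> space S"
  shows "kernel_op (hit V n) x \<le> hit V n x + return_bound"
proof (cases "x \<in> V")
  case True
  have "ennreal (kernel_op (hit V n) x) = (\<Sum>k<n. avoid V (Suc k) x)"
    unfolding kernel_op_hit[OF V_sets x]
    using order.strict_trans1[OF avoid_le_1[OF x]]
    by (subst sum_ennreal[symmetric]) (auto intro!: sum.cong ennreal_enn2real simp del: avoid.simps)
  also have "\<dots> \<le> (\<Sum>k<Suc n. avoid V k x)"
    unfolding sum.lessThan_Suc_shift by simp
  also have "\<dots> \<le> (\<Sum>k. avoid V k x)"
    by (rule sum_le_suminf) auto
  also have "\<dots> \<le> ennreal return_bound"
    using True by (rule return_bound(2))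
  finally show ?thesis
    using return_bound(1) True by (simp add: hit_mem)
next
  case False
  have "survive V n x \<le> 1"
    using bounded_byD[OF bounded_by_survive[OF V_sets] x, of n] by simp
  with kernel_op_hit_outside[OF V_sets x False, of n] return_bound(1) show ?thesis
    by (simp add: hit_def)
qed

lemma kernel_pow_hit_le:
  assumes x: "x \<in> space S"
  shows "kernel_pow m (hit V n) x \<le> hit V n x + m * return_bound"
  using x
proof (induction m arbitrary: x)
  case (Suc m)
  note bh = bounded_by_hit[OF V_sets, of n]
  have "kernel_pow (Suc m) (hit V n) x \<le> kernel_op (\<lambda>w. hit V n w + m * return_bound) x"
    using Suc by (auto intro!: kernel_op_mono[OF _ bounded_by_kernel_pow[OF bh] bounded_by_add[OF bh bounded_by_const]])
  also have "\<dots> = kernel_op (hit V n) x + m * return_bound"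
    using Suc.prems by (simp add: kernel_op_add[OF _ bh bounded_by_const])
  also have "\<dots> \<le> hit V n x + Suc m * return_bound"
    using kernel_op_hit_le[OF Suc.prems, of n] by (simp add: algebra_simps)
  finally show ?case .
qed simp

section \<open>Averages of bounded functions, uniformly over starts in V\<close>

lemma integral_psum: "bounded_by F g \<Longrightarrow> (\<integral>x. psum g t x \<partial>\<pi>) = t * (\<integral>x. g x \<partial>\<pi>)"
  unfolding psum_def
  by (subst Bochner_Integration.integral_sum)
    (auto simp: integral_stationary_pow[OF stationary] intro: integrable_stationary bounded_by_kernel_pow)

text \<open>Comparing \<open>psum g t\<close> with \<open>kernel_pow m (psum g t)\<close> and using the common
  part \<open>p \<mu>\<close> of the \<open>m\<close>-step transitions from \<open>V\<close> contracts the oscillation on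
  \<open>V\<close> by the factor \<open>1 - p\<close>, up to a constant that does not depend on \<open>t\<close>.\<close>

lemma psum_oscillation:
  assumes g: "bounded_by F g"
  shows "\<exists>C. \<forall>t. \<forall>x\<in>V. \<forall>x'\<in>V. psum g t x \<le> psum g t x' + C"
proof (cases "V = {}")
  case False
  then obtain v where v: "v \<in> V" by blast
  have F: "0 \<le> F"
    using bounded_byD[OF g V_space[OF v]] by linarith
  from minorized obtain p :: real and \<mu> m where p: "0 < p" "p \<le> 1"
    and \<mu>: "\<mu> \<in> space (prob_algebra S)"
    and minor: "\<And>x A. x \<in> V \<Longrightarrow> A \<in> sets S \<Longrightarrow> ennreal p * emeasure \<mu> A \<le> emeasure (nstep S K m x) A"
    unfolding minorized_def by blast
  have prob: "prob_space \<mu>" and sets: "sets \<mu> = sets S"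
    using \<mu> by (auto simp: space_prob_algebra)
  interpret mu: prob_space \<mu> by fact
  have sp: "space \<mu> = space S"
    using sets by (rule sets_eq_imp_space_eq)
  have int: "integrable \<mu> h" if "bounded_by F' h" for F' h
    using that prob sets by (rule bounded_by_integrable)
  \<comment> \<open>The minorization as an inequality of measures, hence of integrals. It holds for
    nonnegative functions only, so \<open>psum\<close> has to be turned into a nonnegative function
    first.\<close>
  have low: "p * (\<integral>w. h w \<partial>\<mu>) \<le> kernel_pow m h x"
    if h: "bounded_by F' h" and pos: "\<And>w. w \<in> space S \<Longrightarrow> 0 \<le> h w" and x: "x \<in> V" for F' h x
  proof -
    have [measurable]: "h \<in> borel_measurable S"
      using bounded_by_measurable[OF h] .
    have "scale_measure (ennreal p) \<mu> \<le> nstep S K m x"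
      using minor[OF x] sets by (subst le_measure) auto
    then have "(\<integral>\<^sup>+w. ennreal (h w) \<partial>scale_measure (ennreal p) \<mu>) \<le> (\<integral>\<^sup>+w. ennreal (h w) \<partial>nstep S K m x)"
      using sets by (intro nn_integral_mono_measure) auto
    moreover have "(\<integral>\<^sup>+w. ennreal (h w) \<partial>scale_measure (ennreal p) \<mu>) = ennreal (p * (\<integral>w. h w \<partial>\<mu>))"
    proof -
      have "(\<integral>\<^sup>+w. ennreal (h w) \<partial>\<mu>) = ennreal (\<integral>w. h w \<partial>\<mu>)"
        using pos sp by (intro nn_integral_eq_integral int[OF h]) auto
      then show ?thesis
        using p(1) by (simp add: nn_integral_scale_measure measurable_cong_sets[OF sets refl] ennreal_mult')
    qed
    moreover have "(\<integral>\<^sup>+w. ennreal (h w) \<partial>nstep S K m x) = ennreal (kernel_pow m h x)"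
      by (rule nn_integral_nstep_bounded[OF h pos V_space[OF x]])
    ultimately show ?thesis
      using kernel_pow_nonneg[OF h pos V_space[OF x]] by simp
  qed
  \<comment> \<open>The first term is the cost of replacing \<open>psum g t\<close> by its
    \<open>m\<close>-step average; the second bounds the mean penalty \<open>2 * F * hit V t\<close>
    after \<open>m\<close> steps from \<open>V\<close>.\<close>
  define B where "B = 2 * m * F + 2 * F * m * return_bound"
  \<comment> \<open>Since \<open>\<mu>\<close> need not be carried by \<open>V\<close>, a bound on
    \<open>V\<close> is not enough for \<open>low\<close>. By \<open>psum_le_hit\<close> the
    function \<open>H + 2 * F * hit V t - psum g t\<close> is nonnegative on the whole space, and
    \<open>low\<close> is applied to it.\<close>
  have upper: "psum g t x \<le> (1 - p) * H + p * (\<integral>w. psum g t w \<partial>\<mu>) + B"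
    if g: "bounded_by F g" and H: "\<And>x. x \<in> V \<Longrightarrow> psum g t x \<le> H" and x: "x \<in> V" for g t H x
  proof -
    note bs = bounded_by_psum[OF g, of t]
    note bh = bounded_by_cmult[OF bounded_by_hit[OF V_sets, of t], of "2 * F"]
    let ?h = "\<lambda>w. (H + 2 * F * hit V t w) - psum g t w"
    note b1 = bounded_by_add[OF bounded_by_const[of H] bh]
    note b = bounded_by_diff[OF b1 bs]
    have "- (F * t) \<le> H"
      using H[OF v] bounded_byD[OF bs V_space[OF v]] by (simp add: abs_le_iff mult.commute)
    then have pos: "0 \<le> ?h w" if "w \<in> space S" for w
      using psum_le_hit[OF V_sets g H _ that] by simp
    have pow: "kernel_pow n ?h w = H + 2 * F * kernel_pow n (hit V t) w - kernel_pow n (psum g t) w"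
      if "w \<in> space S" for n w
      using that
    proof (induction n arbitrary: w)
      case (Suc n)
      note bh' = bounded_by_cmult[OF bounded_by_kernel_pow[OF bounded_by_hit[OF V_sets, of t], of n], of "2 * F"]
      have "kernel_pow (Suc n) ?h w = kernel_op (\<lambda>w. (H + 2 * F * kernel_pow n (hit V t) w) - kernel_pow n (psum g t) w) w"
        using Suc by (auto intro: kernel_op_cong)
      then show ?case
        using Suc.prems
        by (simp add: kernel_op_diff[OF _ bounded_by_add[OF bounded_by_const bh'] bounded_by_kernel_pow[OF bs]]
          kernel_op_add[OF _ bounded_by_const bh'] kernel_op_cmult)
    qed simp
    have "p * (\<integral>w. ?h w \<partial>\<mu>) \<le> H + 2 * F * kernel_pow m (hit V t) x - kernel_pow m (psum g t) x"
      using low[OF b pos x] pow[OF V_space[OF x], of m] by simp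
    moreover have "(\<integral>w. ?h w \<partial>\<mu>) \<ge> (\<integral>w. H - psum g t w \<partial>\<mu>)"
      using F hit_nonneg[of V t]
      by (intro integral_mono int[OF b] int[OF bounded_by_diff[OF bounded_by_const bs]]) auto
    moreover have "(\<integral>w. H - psum g t w \<partial>\<mu>) = H - (\<integral>w. psum g t w \<partial>\<mu>)"
      using int[OF bs] mu.prob_space by simp
    moreover have "2 * F * kernel_pow m (hit V t) x \<le> 2 * F * (m * return_bound)"
      using kernel_pow_hit_le[OF V_space[OF x], of m t] hit_mem[OF x, of t] F by (intro mult_left_mono) auto
    moreover have "psum g t x \<le> kernel_pow m (psum g t) x + 2 * m * F"
      using kernel_pow_psum_diff[OF g V_space[OF x], of m t] by linarith
    moreover have "p * (H - (\<integral>w. psum g t w \<partial>\<mu>)) \<le> p * (\<integral>w. ?h w \<partial>\<mu>)"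
      using calculation(2,3) p(1) by (intro mult_left_mono) auto
    ultimately show ?thesis
      unfolding B_def by (simp add: algebra_simps)
  qed
  have "psum g t x \<le> psum g t x' + 2 * B / p" if x: "x \<in> V" "x' \<in> V" for t x x'
  proof -
    let ?H = "SUP x\<in>V. psum g t x" and ?h = "SUP x\<in>V. psum (\<lambda>x. - g x) t x"
    have bd: "bdd_above ((\<lambda>x. psum g t x) ` V)" if "bounded_by F g" for g
      using bounded_byD[OF bounded_by_psum[OF that, of t] V_space]
      by (intro bdd_aboveI2[where M="t * F"]) (simp add: abs_le_iff)
    note ng = bounded_by_uminus[OF g]
    have H: "psum g t x \<le> ?H" if "x \<in> V" for x
      using that by (rule cSUP_upper) (rule bd[OF g])
    have h: "psum (\<lambda>x. - g x) t x \<le> ?h" if "x \<in> V" for x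
      using that by (rule cSUP_upper) (rule bd[OF ng])
    have "?H \<le> (1 - p) * ?H + p * (\<integral>w. psum g t w \<partial>\<mu>) + B"
      using False by (intro cSUP_least upper[OF g H]) auto
    moreover have "?h \<le> (1 - p) * ?h + p * (\<integral>w. psum (\<lambda>x. - g x) t w \<partial>\<mu>) + B"
      using False by (intro cSUP_least upper[OF ng h]) auto
    moreover have "(\<integral>w. psum (\<lambda>x. - g x) t w \<partial>\<mu>) = - (\<integral>w. psum g t w \<partial>\<mu>)"
      by (simp add: psum_uminus)
    \<comment> \<open>\<open>?h\<close> is minus the infimum of \<open>psum g t\<close> over
      \<open>V\<close>, so \<open>?H + ?h\<close> is the oscillation. Adding the bounds for
      \<open>g\<close> and \<open>- g\<close> cancels the \<open>\<mu>\<close>-integrals and leaves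
      a contraction by \<open>1 - p\<close> with error \<open>2 * B\<close>.\<close>
    ultimately have "p * (?H + ?h) \<le> 2 * B"
      by (simp add: algebra_simps)
    then have "?H + ?h \<le> 2 * B / p"
      using p(1) by (simp add: field_simps)
    with H[OF x(1)] h[OF x(2)] show ?thesis
      by (simp add: psum_uminus)
  qed
  then show ?thesis by blast
qed simp

lemma integral_hit_le:
  assumes \<delta>: "0 < \<delta>"
  shows "\<exists>t0. \<forall>t\<ge>t0. (\<integral>w. hit V t w \<partial>\<pi>) \<le> \<delta> * real t"
proof -
  define a where "a k = (\<integral>w. survive V k w \<partial>\<pi>)" for k
  have a0: "0 \<le> a k" for k
    unfolding a_def by (simp add: survive_nonneg)
  have "a \<longlonglongrightarrow> (\<integral>w. 0 \<partial>\<pi>)"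
    unfolding a_def
  proof (rule integral_dominated_convergence[where w="\<lambda>_. 1"])
    show "AE x in \<pi>. (\<lambda>k. survive V k x) \<longlonglongrightarrow> 0"
    proof (rule AE_I2)
      fix x assume "x \<in> space \<pi>"
      then have "(\<lambda>k. avoid V k x) \<longlonglongrightarrow> 0"
        using positive_recurrentD(2)[OF recurrent] by (simp add: space_stationary)
      then have "(\<lambda>k. enn2real (avoid V k x)) \<longlonglongrightarrow> 0"
        using tendsto_enn2real[of "\<lambda>k. avoid V k x" 0 sequentially] by simp
      from tendsto_mult_right_zero[OF this, of "indicator (space S - V) x"]
      show "(\<lambda>k. survive V k x) \<longlonglongrightarrow> 0"
        by (simp add: survive_def)
    qed
    show "integrable \<pi> (\<lambda>_. 1 :: real)"
      by (rule integrable_stationary[OF bounded_by_const])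
    show "AE x in \<pi>. norm (survive V k x) \<le> 1" for k
      using bounded_byD[OF bounded_by_survive[OF V_sets]] by (auto simp: space_stationary)
  qed (use integrable_stationary[OF bounded_by_survive[OF V_sets]] in auto)
  then have "a \<longlonglongrightarrow> 0" by simp
  moreover have "(\<integral>w. hit V t w \<partial>\<pi>) = (\<Sum>k<t. a k)" for t
    unfolding hit_def a_def
    by (rule Bochner_Integration.integral_sum) (rule integrable_stationary[OF bounded_by_survive[OF V_sets]])
  ultimately show ?thesis
    using sum_le_of_tendsto_0[OF _ a0 \<delta>] by simp
qed

text \<open>By the oscillation bound, \<open>- psum g t\<close> is at most
  \<open>C - psum g t x\<close> on \<open>V\<close>; \<open>psum_le_hit\<close>, applied to
  \<open>- g\<close>, extends this to all states up to a multiple of \<open>hit V t\<close>.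
  Integrating against \<open>\<pi>\<close> turns the left side into \<open>- t\<close> times the
  mean of \<open>g\<close>.\<close>

theorem psum_le_mean:
  assumes g: "bounded_by F g" and \<delta>: "0 < \<delta>"
  shows "\<exists>t0. \<forall>t\<ge>t0. \<forall>x\<in>V. psum g t x \<le> t * ((\<integral>w. g w \<partial>\<pi>) + \<delta>)"
proof -
  obtain C where C: "\<And>t x x'. x \<in> V \<Longrightarrow> x' \<in> V \<Longrightarrow> psum g t x \<le> psum g t x' + C"
    using psum_oscillation[OF g] by blast
  show ?thesis
  proof (cases "V = {}")
    case False
    then obtain v where v: "v \<in> V" by blast
    have F: "0 \<le> F"
      using bounded_byD[OF g V_space[OF v]] by linarith
    have C0: "0 \<le> C"
      using C[OF v v, of 0] by simp
    \<comment> \<open>Half of \<open>\<delta>\<close> is for the hitting term with factor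
      \<open>2 * F\<close>, half for \<open>C\<close>, which is at most
      \<open>t * \<delta> / 2\<close> once \<open>t\<close> is large. Using \<open>2 * F + 1\<close>
      avoids a division by zero.\<close>
    have "0 < \<delta> / (2 * (2 * F + 1))"
      using \<delta> F by simp
    from integral_hit_le[OF this] obtain t0
      where t0: "\<And>t. t0 \<le> t \<Longrightarrow> (\<integral>w. hit V t w \<partial>\<pi>) \<le> \<delta> / (2 * (2 * F + 1)) * t"
      by blast
    obtain t1 :: nat where t1: "2 * C / \<delta> \<le> t1"
      using real_arch_simple by blast
    have "psum g t x \<le> t * ((\<integral>w. g w \<partial>\<pi>) + \<delta>)" if t: "max t0 t1 \<le> t" and x: "x \<in> V" for t x
    proof -
      note ng = bounded_by_uminus[OF g]
      note bh = bounded_by_cmult[OF bounded_by_hit[OF V_sets, of t], of "2 * F"]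
      have "- psum g t w \<le> (C - psum g t x) + 2 * F * hit V t w" if w: "w \<in> space S" for w
      proof -
        have "psum (\<lambda>x. - g x) t w \<le> (C - psum g t x) + 2 * F * hit V t w"
        proof (rule psum_le_hit[OF V_sets ng _ _ w])
          show "psum (\<lambda>x. - g x) t x' \<le> C - psum g t x" if "x' \<in> V" for x'
            using C[OF x that] by (simp add: psum_uminus algebra_simps)
          show "- (F * real t) \<le> C - psum g t x"
            using bounded_byD[OF bounded_by_psum[OF g, of t] V_space[OF x]] C0
            by (simp add: abs_le_iff mult.commute)
        qed
        then show ?thesis by (simp add: psum_uminus)
      qed
      then have "(\<integral>w. - psum g t w \<partial>\<pi>) \<le> (\<integral>w. (C - psum g t x) + 2 * F * hit V t w \<partial>\<pi>)"
        by (intro integral_mono_stationary[OF bounded_by_uminus[OF bounded_by_psum[OF g]]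
              bounded_by_add[OF bounded_by_const bh]])
      also have "\<dots> = (C - psum g t x) + 2 * F * (\<integral>w. hit V t w \<partial>\<pi>)"
        using integrable_stationary[OF bh]
        by (subst Bochner_Integration.integral_add) (simp_all add: integrable_stationary[OF bounded_by_const])
      finally have "psum g t x \<le> t * (\<integral>w. g w \<partial>\<pi>) + C + 2 * F * (\<integral>w. hit V t w \<partial>\<pi>)"
        by (simp add: integral_psum[OF g])
      moreover have "2 * F * (\<integral>w. hit V t w \<partial>\<pi>) \<le> t * \<delta> / 2"
      proof -
        have "2 * F * (\<integral>w. hit V t w \<partial>\<pi>) \<le> (2 * F + 1) * (\<delta> / (2 * (2 * F + 1)) * t)"
          using t0[of t] t F by (intro mult_mono) (auto simp: hit_nonneg)
        also have "\<dots> = t * \<delta> / 2"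
          using F by (simp add: field_simps)
        finally show ?thesis .
      qed
      moreover have "C \<le> t * \<delta> / 2"
      proof -
        have "2 * C / \<delta> \<le> real t"
          using t1 t by (simp add: order.trans)
        then show ?thesis using \<delta> by (simp add: field_simps)
      qed
      ultimately show ?thesis
        using distrib_left[of "real t" "\<integral>w. g w \<partial>\<pi>" \<delta>] by linarith
    qed
    then show ?thesis by blast
  qed simp
qed

text \<open>The inequality in Kac's formula, which states that the mean is \<open>1\<close>.\<close>

lemma integral_mean_return_le: "(\<integral>x. mean_return x \<partial>\<pi>) \<le> 1"
proof -
  let ?B = "\<lambda>n x. indicator V x * (1 + kernel_op (hit V n) x)"
  have B1: "(\<integral>x. ?B n x \<partial>\<pi>) \<le> 1" for n
  proof -
    note bh = bounded_by_hit[OF V_sets]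
    \<comment> \<open>By the first-step equation the new integrand vanishes off \<open>V\<close>,
      and on \<open>V\<close> it equals \<open>?B n\<close> since \<open>hit\<close> is
      \<open>0\<close> there. Stationarity then removes the kernel, and truncation keeps the
      difference of the two hitting integrals meaningful.\<close>
    have "(\<integral>x. ?B n x \<partial>\<pi>) = (\<integral>x. 1 + kernel_op (hit V n) x - hit V (Suc n) x \<partial>\<pi>)"
      using kernel_op_hit_outside[OF V_sets]
      by (intro Bochner_Integration.integral_cong refl) (auto simp: space_stationary indicator_def hit_mem)
    also have "\<dots> = 1 + (\<integral>x. hit V n x \<partial>\<pi>) - (\<integral>x. hit V (Suc n) x \<partial>\<pi>)"
      using integrable_stationary[OF bh] integrable_stationary[OF bounded_by_kernel_op[OF bh]]
      by (simp add: integral_stationary[OF stationary bh] integrable_stationary[OF bounded_by_const])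
    also have "(\<integral>x. hit V n x \<partial>\<pi>) \<le> (\<integral>x. hit V (Suc n) x \<partial>\<pi>)"
      by (intro integral_mono_stationary[OF bh bh]) (simp add: hit_def survive_nonneg)
    finally show ?thesis by simp
  qed
  have eq: "1 + kernel_op (hit V n) x = (\<Sum>k<Suc n. enn2real (avoid V k x))" if "x \<in> space S" for n x
    unfolding kernel_op_hit[OF V_sets that] sum.lessThan_Suc_shift by simp
  have lim: "(\<lambda>n. \<integral>x. ?B n x \<partial>\<pi>) \<longlonglongrightarrow> (\<integral>x. mean_return x \<partial>\<pi>)"
  proof (rule integral_dominated_convergence[where w="\<lambda>_. 1 + return_bound"])
    show "AE x in \<pi>. (\<lambda>n. ?B n x) \<longlonglongrightarrow> mean_return x"
    proof (rule AE_I2)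
      fix x assume "x \<in> space \<pi>"
      then have x: "x \<in> space S" by (simp add: space_stationary)
      show "(\<lambda>n. ?B n x) \<longlonglongrightarrow> mean_return x"
      proof (cases "x \<in> V")
        case True
        have fin: "avoid V k x \<noteq> top" for k
          using avoid_le_1[OF x, of V k] by (auto simp: top_unique)
        have "(\<lambda>n. \<Sum>k<n. avoid V k x) \<longlonglongrightarrow> (\<Sum>k. avoid V k x)"
          by (rule summable_LIMSEQ) (rule summableI)
        then have "(\<lambda>n. enn2real (\<Sum>k<n. avoid V k x)) \<longlonglongrightarrow> enn2real (\<Sum>k. avoid V k x)"
          using order.strict_trans1[OF return_bound(2)[OF True], of top] by (intro tendsto_enn2real) auto
        moreover have "enn2real (\<Sum>k<n. avoid V k x) = (\<Sum>k<n. enn2real (avoid V k x))" for n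
          using fin by (subst enn2real_sum) (auto simp: less_top[symmetric])
        ultimately have "(\<lambda>n. \<Sum>k<n. enn2real (avoid V k x)) \<longlonglongrightarrow> mean_return x"
          using True by (simp add: mean_return_def)
        from LIMSEQ_Suc[OF this] show ?thesis
          unfolding eq[OF x] using True by simp
      qed (simp add: mean_return_def)
    qed
    show "integrable \<pi> (\<lambda>_. 1 + return_bound)"
      by (rule integrable_stationary[OF bounded_by_const])
    show "mean_return \<in> borel_measurable \<pi>"
      using integrable_stationary[OF bounded_by_mean_return] by auto
    have [measurable]: "V \<in> sets \<pi>" "(\<lambda>x. kernel_op (hit V n) x) \<in> borel_measurable \<pi>" for n
      using integrable_stationary[OF bounded_by_kernel_op[OF bounded_by_hit[OF V_sets]]]
      by (auto simp: sets_stationary)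
    show "(\<lambda>x. ?B n x) \<in> borel_measurable \<pi>" for n
      by measurable
    have "\<bar>?B n x\<bar> \<le> 1 + return_bound" if x: "x \<in> space S" for n x
    proof (cases "x \<in> V")
      case True
      have "0 \<le> kernel_op (hit V n) x"
        unfolding kernel_op_def by (simp add: hit_nonneg)
      then show ?thesis
        using kernel_op_hit_le[OF x, of n] hit_mem[OF True, of n] True by simp
    qed (use return_bound(1) in simp)
    then show "AE x in \<pi>. norm (?B n x) \<le> 1 + return_bound" for n
      by (auto simp: space_stationary)
  qed
  show ?thesis
    by (rule LIMSEQ_le_const2[OF lim]) (use B1 in blast)
qed

text \<open>Summing \<open>nn_integral_hit_total\<close> over \<open>t\<close> steps from
  \<open>V\<close> shows that the residual mean hitting time plus \<open>t\<close> equals the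
  expected sum of \<open>mean_return\<close>. By Kac's inequality and \<open>psum_le_mean\<close>
  this is at most \<open>t * (1 + \<delta>)\<close>, and \<open>t\<close> cancels.\<close>

lemma residual_hit_le:
  fixes \<delta> :: real
  assumes \<delta>: "0 < \<delta>"
  shows "\<exists>t0. \<forall>t\<ge>t0. \<forall>x\<in>V. (\<integral>\<^sup>+w. hit_total w \<partial>nstep S K t x) \<le> ennreal (\<delta> * t)"
proof -
  from psum_le_mean[OF bounded_by_mean_return \<delta>] obtain t0
    where t0: "\<And>t x. t0 \<le> t \<Longrightarrow> x \<in> V \<Longrightarrow> psum mean_return t x \<le> t * ((\<integral>w. mean_return w \<partial>\<pi>) + \<delta>)"
    by blast
  have "(\<integral>\<^sup>+w. hit_total w \<partial>nstep S K t x) \<le> ennreal (\<delta> * t)" if t: "t0 \<le> t" and x: "x \<in> V" for t x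
  proof -
    have [measurable]: "mean_return \<in> borel_measurable S"
      using bounded_by_measurable[OF bounded_by_mean_return] .
    have "(\<integral>\<^sup>+w. hit_total w \<partial>nstep S K t x) + of_nat t * 1 \<le>
        hit_total x + (\<Sum>u<t. \<integral>\<^sup>+w. ennreal (mean_return w) \<partial>nstep S K u x)"
      by (rule nn_integral_nstep_drift[OF V_space[OF x]]) (simp_all add: nn_integral_hit_total)
    also have "\<dots> = ennreal (psum mean_return t x)"
      by (simp add: hit_total_mem[OF x]
        sum_nn_integral_nstep_bounded[OF bounded_by_mean_return mean_return_nonneg V_space[OF x]])
    also have "psum mean_return t x \<le> t * (1 + \<delta>)"
      using t0[OF t x] mult_left_mono[OF integral_mean_return_le, of "real t"] by (simp add: algebra_simps)
    also have "ennreal (t * (1 + \<delta>)) = ennreal (\<delta> * t) + of_nat t * 1"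
      using \<delta> by (simp add: algebra_simps ennreal_plus ennreal_of_nat_eq_real_of_nat)
    finally show ?thesis
      by (simp add: ennreal_of_nat_eq_real_of_nat ennreal_leI)
  qed
  then show ?thesis by blast
qed

text \<open>An approximate solution \<open>u\<close> of the Poisson equation. The exact solution need not be bounded;
  averaging the sums \<open>psum g k\<close> over \<open>k \<le> n\<close> gives a bounded \<open>u\<close> with an error that is small
  on average.\<close>

lemma ex_approx_poisson:
  fixes \<epsilon> :: real
  assumes g: "bounded_by F g" and neg: "(\<integral>w. g w \<partial>\<pi>) < 0" and \<epsilon>: "0 < \<epsilon>"
  obtains u A \<psi> B t0 where "bounded_by A u" "bounded_by B \<psi>" "\<And>x. x \<in> space S \<Longrightarrow> 0 \<le> \<psi> x"
    "\<And>x. x \<in> space S \<Longrightarrow> g x + kernel_op u x - u x \<le> \<psi> x"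
    "\<And>t x. t0 \<le> t \<Longrightarrow> x \<in> V \<Longrightarrow> psum \<psi> t x \<le> t * \<epsilon>"
proof -
  obtain v where v: "v \<in> space S"
    using prob_space.not_empty[OF prob_space_stationary] by (auto simp: space_stationary)
  have F: "0 \<le> F"
    using bounded_byD[OF g v] by linarith
  \<comment> \<open>With the error equal to minus the mean, the bound reads \<open>0\<close>. Thus
    \<open>H = 0\<close> is allowed in \<open>psum_le_hit\<close>.\<close>
  from psum_le_mean[OF g, of "- (\<integral>w. g w \<partial>\<pi>)"] neg obtain t1
    where t1: "\<And>t x. t1 \<le> t \<Longrightarrow> x \<in> V \<Longrightarrow> psum g t x \<le> 0"
    by auto
  have "0 < \<epsilon> / (2 * (2 * F + 1))"
    using \<epsilon> F by simp
  from integral_hit_le[OF this] obtain t2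
    where t2: "\<And>t. t2 \<le> t \<Longrightarrow> (\<integral>w. hit V t w \<partial>\<pi>) \<le> \<epsilon> / (2 * (2 * F + 1)) * t"
    by blast
  define n where "n = max (max t1 t2) 1"
  have n: "t1 \<le> n" "t2 \<le> n" "0 < n"
    by (auto simp: n_def)
  \<comment> \<open>For each \<open>k\<close>, applying the kernel to \<open>psum g (Suc k)\<close>
    subtracts \<open>g\<close> and adds \<open>kernel_pow (Suc k) g\<close>. Averaging over
    \<open>k < n\<close> collects these remainders into \<open>kernel_op (psum g n) x / n\<close>,
    which \<open>psum_le_hit\<close> bounds by \<open>\<psi>\<close>.\<close>
  define u where "u = (\<lambda>x. (1 / n) * (\<Sum>k<n. psum g (Suc k) x))"
  define \<psi> where "\<psi> = (\<lambda>x. (2 * F / n) * kernel_op (hit V n) x)"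
  note bp = bounded_by_psum[OF g]
  note bh = bounded_by_hit[OF V_sets, of n]
  note bu = bounded_by_cmult[OF bounded_by_sum[of "{..<n}" "\<lambda>k. Suc k * F" "\<lambda>k. psum g (Suc k)", OF bp], of "1 / n", folded u_def]
  note b\<psi> = bounded_by_cmult[OF bounded_by_kernel_op[OF bh], of "2 * F / n", folded \<psi>_def]
  have \<psi>0: "0 \<le> \<psi> x" for x
    unfolding \<psi>_def kernel_op_def using F by (simp add: hit_nonneg)
  have poisson: "g x + kernel_op u x - u x \<le> \<psi> x" if x: "x \<in> space S" for x
  proof -
    have "kernel_op u x = (1 / n) * (\<Sum>k<n. kernel_op (psum g (Suc k)) x)"
      unfolding u_def kernel_op_cmult by (subst kernel_op_sum[OF x bp]) simp
    also have "\<dots> = (1 / n) * (\<Sum>k<n. (psum g (Suc k) x - g x) + kernel_pow (Suc k) g x)"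
      by (simp only: kernel_op_psum_eq[OF x g])
    also have "\<dots> = u x - g x + (1 / n) * kernel_op (psum g n) x"
      using n(3) unfolding kernel_op_psum[OF x g] u_def sum.distrib sum_subtractf
      by (simp add: field_simps)
    also have "kernel_op (psum g n) x \<le> kernel_op (\<lambda>w. 2 * F * hit V n w) x"
    proof (rule kernel_op_mono[OF x bp bounded_by_cmult[OF bh]])
      show "psum g n w \<le> 2 * F * hit V n w" if "w \<in> space S" for w
        using psum_le_hit[OF V_sets g, of n 0 w] t1[OF n(1)] F that by simp
    qed
    finally show ?thesis
      using n(3) by (simp add: \<psi>_def kernel_op_cmult divide_right_mono)
  qed
  have "(\<integral>w. \<psi> w \<partial>\<pi>) = (2 * F / n) * (\<integral>w. hit V n w \<partial>\<pi>)"
    unfolding \<psi>_def by (simp add: integral_stationary[OF stationary bh])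
  also have "\<dots> \<le> (2 * F / n) * (\<epsilon> / (2 * (2 * F + 1)) * n)"
    using t2[OF n(2)] F by (intro mult_left_mono) auto
  also have "\<dots> \<le> \<epsilon> / 2"
    using n(3) F \<epsilon> by (simp add: field_simps)
  finally have mean: "(\<integral>w. \<psi> w \<partial>\<pi>) \<le> \<epsilon> / 2" .
  from psum_le_mean[OF b\<psi>, of "\<epsilon> / 2"] \<epsilon> obtain t3
    where t3: "\<And>t x. t3 \<le> t \<Longrightarrow> x \<in> V \<Longrightarrow> psum \<psi> t x \<le> t * ((\<integral>w. \<psi> w \<partial>\<pi>) + \<epsilon> / 2)"
    by auto
  have "psum \<psi> t x \<le> t * \<epsilon>" if "t3 \<le> t" "x \<in> V" for t x
    using t3[OF that] mult_left_mono[OF mean, of "real t"] by (simp add: algebra_simps)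
  from that[OF bu b\<psi> \<psi>0 poisson this] show thesis .
qed

end

section \<open>A Foster criterion over an autonomous component\<close>

locale factor_chain = markov_chain S K + base: minorized_chain MX KX V \<pi>
  for S :: "'a measure" and K :: "'a \<Rightarrow> 'a measure"
    and MX :: "'x measure" and KX :: "'x \<Rightarrow> 'x measure" and V \<pi> +
  fixes proj :: "'a \<Rightarrow> 'x"
  assumes proj [measurable]: "proj \<in> S \<rightarrow>\<^sub>M MX"
    and distr_proj: "z \<in> space S \<Longrightarrow> distr (K z) MX proj = KX (proj z)"
begin

lemma proj_space: "z \<in> space S \<Longrightarrow> proj z \<in> space MX"
  using measurable_space[OF proj] .

lemma nn_integral_kernel_proj:
  assumes z: "z \<in> space S" and g: "g \<in> borel_measurable MX"
  shows "(\<integral>\<^sup>+w. g (proj w) \<partial>K z) = (\<integral>\<^sup>+x. g x \<partial>KX (proj z))"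
proof -
  have "proj \<in> K z \<rightarrow>\<^sub>M MX"
    using proj by (simp add: measurable_cong_sets[OF sets_kernel[OF z] refl])
  then show ?thesis
    unfolding distr_proj[OF z, symmetric] using g by (intro nn_integral_distr[symmetric]) auto
qed

lemma integral_kernel_proj:
  fixes g :: "'x \<Rightarrow> real"
  assumes z: "z \<in> space S" and g: "g \<in> borel_measurable MX"
  shows "(\<integral>w. g (proj w) \<partial>K z) = base.kernel_op g (proj z)"
proof -
  have "proj \<in> K z \<rightarrow>\<^sub>M MX"
    using proj by (simp add: measurable_cong_sets[OF sets_kernel[OF z] refl])
  then show ?thesis
    unfolding base.kernel_op_def distr_proj[OF z, symmetric] using g by (intro integral_distr[symmetric]) auto
qed

lemma nn_integral_nstep_proj:
  assumes z: "z \<in> space S" and g: "g \<in> borel_measurable MX"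
  shows "(\<integral>\<^sup>+w. g (proj w) \<partial>nstep S K n z) = (\<integral>\<^sup>+x. g x \<partial>nstep MX KX n (proj z))"
  using g
proof (induction n arbitrary: g)
  case 0
  note [measurable] = 0
  show ?case
    using z proj_space by (simp add: nn_integral_nstep_0 base.nn_integral_nstep_0)
next
  case (Suc n)
  note [measurable] = Suc.prems
  have "(\<integral>\<^sup>+w. g (proj w) \<partial>nstep S K (Suc n) z) = (\<integral>\<^sup>+w. (\<integral>\<^sup>+x. g x \<partial>KX (proj w)) \<partial>nstep S K n z)"
    using z by (subst nn_integral_nstep_Suc) (auto intro!: nn_integral_cong simp: nn_integral_kernel_proj)
  also have "\<dots> = (\<integral>\<^sup>+x. g x \<partial>nstep MX KX (Suc n) (proj z))"
    using z proj_space Suc.prems by (subst Suc.IH) (auto simp: base.nn_integral_nstep_Suc)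
  finally show ?case .
qed

lemma sum_nn_integral_nstep_proj:
  assumes g: "base.bounded_by F g" and pos: "\<And>x. x \<in> space MX \<Longrightarrow> 0 \<le> g x" and z: "z \<in> space S"
  shows "(\<Sum>u<t. \<integral>\<^sup>+w. ennreal (g (proj w)) \<partial>nstep S K u z) = ennreal (base.psum g t (proj z))"
proof -
  have [measurable]: "g \<in> borel_measurable MX"
    using base.bounded_by_measurable[OF g] .
  show ?thesis
    using base.sum_nn_integral_nstep_bounded[OF g pos proj_space[OF z]]
    by (simp add: nn_integral_nstep_proj[OF z, where g="\<lambda>x. ennreal (g x)"])
qed

text \<open>A Foster criterion with a state-dependent time: from \<open>V\<close> the function
  \<open>W + (U + 1) hit_total\<close> is looked at after \<open>T\<close> steps, elsewhere after one step. Outside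
  \<open>V\<close> the multiple of the mean hitting time compensates the growth of \<open>W\<close>.\<close>

theorem foster_positive_recurrent:
  fixes W :: "'a \<Rightarrow> real" and c :: real
  assumes W[measurable]: "W \<in> borel_measurable S" and W0: "\<And>z. z \<in> space S \<Longrightarrow> 0 \<le> W z"
    and U0: "0 \<le> U"
    and U: "\<And>z. z \<in> space S \<Longrightarrow> (\<integral>\<^sup>+w. ennreal (W w) \<partial>K z) \<le> ennreal (W z + U)"
    and c: "0 < c" "c \<le> 1" and T: "0 < T"
    and drift: "\<And>z. z \<in> space S \<Longrightarrow> proj z \<in> V \<Longrightarrow> N1 < W z \<Longrightarrow>
      (\<integral>\<^sup>+w. ennreal (W w) \<partial>nstep S K T z) + ennreal (U + 1) * (\<integral>\<^sup>+x. base.hit_total x \<partial>nstep MX KX T (proj z))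
        + ennreal (c * T) \<le> ennreal (W z)"
  shows "positive_recurrent S K {z \<in> space S. proj z \<in> V \<and> W z \<le> N1}"
proof -
  let ?D = "{z \<in> space S. proj z \<in> V \<and> W z \<le> N1}"
  have D[measurable]: "?D \<in> sets S"
    using base.V_sets by measurable
  define \<Psi> where "\<Psi> z = ennreal (W z) + ennreal (U + 1) * base.hit_total (proj z)" for z
  have [measurable]: "\<Psi> \<in> borel_measurable S"
    unfolding \<Psi>_def[abs_def] by measurable
  \<comment> \<open>The mean hitting time of \<open>?D\<close> truncated at \<open>n\<close>.
    Truncation makes it finite and permits an induction on \<open>n\<close> over jumps of length
    \<open>1\<close> or \<open>T\<close>.\<close>
  define E where "E n z = (\<Sum>k<n. indicator (space S - ?D) z * avoid ?D k z)" for n z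
  have [measurable]: "E n \<in> borel_measurable S" for n
    unfolding E_def[abs_def] by measurable
  have \<Psi>_int: "(\<integral>\<^sup>+w. \<Psi> w \<partial>K z) \<le> ennreal (W z + U) + ennreal (U + 1) * (\<integral>\<^sup>+x. base.hit_total x \<partial>KX (proj z))"
    if z: "z \<in> space S" for z
  proof -
    have "(\<integral>\<^sup>+w. \<Psi> w \<partial>K z) = (\<integral>\<^sup>+w. ennreal (W w) \<partial>K z) + ennreal (U + 1) * (\<integral>\<^sup>+x. base.hit_total x \<partial>KX (proj z))"
      unfolding \<Psi>_def using z
      by (subst nn_integral_add)
        (auto simp: borel_measurable_kernel nn_integral_cmult nn_integral_kernel_proj)
    then show ?thesis
      using U[OF z] by (simp add: add_right_mono)
  qed
  have out: "(\<integral>\<^sup>+w. \<Psi> w \<partial>K z) + 1 \<le> \<Psi> z" if z: "z \<in> space S" "proj z \<notin> V" for z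
  proof -
    have "(\<integral>\<^sup>+x. base.hit_total x \<partial>KX (proj z)) + 1 = base.hit_total (proj z)"
      using base.nn_integral_hit_total[OF proj_space[OF z(1)]] z(2) by (simp add: base.mean_return_def)
    then have "ennreal (U + 1) * base.hit_total (proj z) = ennreal (U + 1) * (\<integral>\<^sup>+x. base.hit_total x \<partial>KX (proj z)) + ennreal (U + 1)"
      by (metis distrib_left mult.right_neutral)
    \<comment> \<open>The mean of \<open>W\<close> rises by at most \<open>U\<close>, while the
      hitting term falls by \<open>U + 1\<close>. Since \<open>\<Psi> z\<close> may be infinite,
      \<open>U\<close> is added on both sides and cancelled as a finite number.\<close>
    then have "ennreal U + \<Psi> z = (ennreal (W z) + ennreal U) + ennreal (U + 1) * (\<integral>\<^sup>+x. base.hit_total x \<partial>KX (proj z)) + ennreal (U + 1)"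
      by (simp add: \<Psi>_def ac_simps)
    also have "\<dots> \<ge> (\<integral>\<^sup>+w. \<Psi> w \<partial>K z) + ennreal (U + 1)"
      using \<Psi>_int[OF z(1)] W0[OF z(1)] U0 by (intro add_right_mono) (simp add: ennreal_plus)
    finally have "ennreal U + ((\<integral>\<^sup>+w. \<Psi> w \<partial>K z) + 1) \<le> ennreal U + \<Psi> z"
      using U0 by (simp add: ennreal_plus ac_simps)
    then show ?thesis
      by (simp add: ennreal_add_left_cancel_le)
  qed
  have inV: "(\<integral>\<^sup>+w. \<Psi> w \<partial>nstep S K T z) + ennreal (c * T) \<le> \<Psi> z"
    if z: "z \<in> space S" "proj z \<in> V" "N1 < W z" for z
  proof -
    have "(\<integral>\<^sup>+w. \<Psi> w \<partial>nstep S K T z) =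
        (\<integral>\<^sup>+w. ennreal (W w) \<partial>nstep S K T z) + ennreal (U + 1) * (\<integral>\<^sup>+x. base.hit_total x \<partial>nstep MX KX T (proj z))"
      unfolding \<Psi>_def using z(1)
      by (subst nn_integral_add)
        (auto simp: borel_measurable_nstep nn_integral_cmult nn_integral_nstep_proj)
    then show ?thesis
      using drift[OF z] by (simp add: \<Psi>_def base.hit_total_mem[OF z(2)])
  qed
  have E_Suc: "1 + (\<integral>\<^sup>+w. E n w \<partial>K z) = (\<Sum>k<Suc n. avoid ?D k z)" if "z \<in> space S" for n z
    unfolding E_def sum.lessThan_Suc_shift using that
    by (subst nn_integral_sum) (auto simp: borel_measurable_kernel)
  have E_step: "E (Suc n) z \<le> 1 + (\<integral>\<^sup>+w. E n w \<partial>K z)" if "z \<in> space S" for n z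
    unfolding E_Suc[OF that] unfolding E_def by (intro sum_mono) (auto simp: indicator_def)
  \<comment> \<open>Only an inequality: the chain may pass through \<open>?D\<close> within the
    \<open>j\<close> steps, and the right side then keeps counting.\<close>
  have E_nstep: "E n z \<le> of_nat j + (\<integral>\<^sup>+w. E (n - j) w \<partial>nstep S K j z)" if "j \<le> n" "z \<in> space S" for n j z
    using that(1)
  proof (induction j)
    case 0
    then show ?case using that(2) by (simp add: nn_integral_nstep_0)
  next
    case (Suc j)
    then have "E n z \<le> of_nat j + (\<integral>\<^sup>+w. E (Suc (n - Suc j)) w \<partial>nstep S K j z)"
      by (simp add: Suc_diff_Suc)
    also have "\<dots> \<le> of_nat j + (\<integral>\<^sup>+w. 1 + (\<integral>\<^sup>+v. E (n - Suc j) v \<partial>K w) \<partial>nstep S K j z)"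
      by (intro add_left_mono nn_integral_nstep_mono E_step)
    also have "\<dots> = of_nat (Suc j) + (\<integral>\<^sup>+w. E (n - Suc j) w \<partial>nstep S K (Suc j) z)"
      using that(2) prob_space.emeasure_space_1[OF prob_space_nstep, of z j]
      by (subst nn_integral_add) (auto simp: borel_measurable_nstep nn_integral_nstep_Suc ac_simps)
    finally show ?case .
  qed
  have E_le: "E n z \<le> of_nat n" if "z \<in> space S" for n z
  proof -
    have "E n z \<le> (\<Sum>k<n. 1)"
      unfolding E_def using avoid_le_1[OF that] by (intro sum_mono) (auto simp: indicator_def)
    then show ?thesis by simp
  qed
  have E_bound: "ennreal c * E n z \<le> \<Psi> z" if "z \<in> space S" for n z
    using that
  proof (induction n arbitrary: z rule: less_induct)
    case (less n)
    consider "z \<in> ?D" | "n = 0" | "n \<noteq> 0" "proj z \<notin> V" | "proj z \<in> V" "N1 < W z" "n < T" | "proj z \<in> V" "N1 < W z" "T \<le> n"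
      using less.prems by force
    then show ?case
    proof cases
      case 3
      then obtain m where m: "n = Suc m" by (cases n) auto
      have "ennreal c * E n z \<le> ennreal c * (1 + (\<integral>\<^sup>+w. E m w \<partial>K z))"
        unfolding m by (intro mult_left_mono E_step less.prems) simp
      also have "\<dots> = ennreal c + (\<integral>\<^sup>+w. ennreal c * E m w \<partial>K z)"
        using less.prems by (simp add: distrib_left nn_integral_cmult borel_measurable_kernel)
      also have "\<dots> \<le> 1 + (\<integral>\<^sup>+w. \<Psi> w \<partial>K z)"
        using c m less.prems by (intro add_mono nn_integral_kernel_mono less.IH) auto
      also have "\<dots> \<le> \<Psi> z"
        using out[OF less.prems 3(2)] by (simp add: add.commute)
      finally show ?thesis .
    next
      \<comment> \<open>A jump of \<open>T\<close> steps would exceed the truncation. Here the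
        trivial bound \<open>n\<close> on \<open>E n z\<close> suffices, since \<open>inV\<close>
        already contains \<open>c * T\<close> as a lower bound for \<open>\<Psi> z\<close>.\<close>
      case 4
      have "ennreal c * E n z \<le> ennreal c * of_nat T"
        using E_le[OF less.prems, of n] 4(3) by (intro mult_left_mono) (auto intro: order.trans)
      also have "\<dots> = ennreal (c * T)"
        using c by (simp add: ennreal_mult' ennreal_of_nat_eq_real_of_nat)
      also have "\<dots> \<le> (\<integral>\<^sup>+w. \<Psi> w \<partial>nstep S K T z) + ennreal (c * T)"
        by simp
      finally show ?thesis
        using inV[OF less.prems 4(1,2)] by simp
    next
      case 5
      have "ennreal c * E n z \<le> ennreal c * (of_nat T + (\<integral>\<^sup>+w. E (n - T) w \<partial>nstep S K T z))"
        by (intro mult_left_mono E_nstep less.prems 5) simp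
      also have "\<dots> = (\<integral>\<^sup>+w. ennreal c * E (n - T) w \<partial>nstep S K T z) + ennreal (c * T)"
        using c by (simp add: distrib_left nn_integral_cmult borel_measurable_nstep ennreal_mult' ennreal_of_nat_eq_real_of_nat add.commute)
      also have "\<dots> \<le> (\<integral>\<^sup>+w. \<Psi> w \<partial>nstep S K T z) + ennreal (c * T)"
        using 5 T by (intro add_right_mono nn_integral_nstep_mono less.IH) auto
      finally show ?thesis
        using inV[OF less.prems 5(1,2)] by simp
    qed (simp_all add: E_def)
  qed
  \<comment> \<open>From \<open>?D\<close> one step is taken before \<open>E_bound\<close> is used.
    It costs \<open>1\<close>, moves \<open>W\<close> to mean at most \<open>N1 + U\<close>, and
    leaves a mean hitting time of at most \<open>return_bound\<close>, weighted by
    \<open>U + 1\<close>.\<close>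
  define C where "C = N1 + U + (U + 1) * base.return_bound + 1"
  have sum_D: "(\<Sum>k. avoid ?D k z) \<le> ennreal (1 / c) * ennreal C" if z: "z \<in> ?D" for z
  proof -
    have zS: "z \<in> space S" and zV: "proj z \<in> V" and zN: "W z \<le> N1" using z by auto
    have "(\<Sum>k<n. avoid ?D k z) \<le> ennreal (1 / c) * ennreal C" for n
    proof -
      have "(\<Sum>k<n. avoid ?D k z) \<le> (\<Sum>k<Suc n. avoid ?D k z)"
        by (intro sum_mono2) auto
      also have "\<dots> = ennreal (1 / c) * (ennreal c * (1 + (\<integral>\<^sup>+w. E n w \<partial>K z)))"
        unfolding E_Suc[OF zS] using c by (simp add: mult.assoc[symmetric] ennreal_mult'[symmetric] del: sum.lessThan_Suc)
      also have "ennreal c * (1 + (\<integral>\<^sup>+w. E n w \<partial>K z)) = ennreal c + (\<integral>\<^sup>+w. ennreal c * E n w \<partial>K z)"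
        using zS by (simp add: distrib_left nn_integral_cmult borel_measurable_kernel)
      also have "\<dots> \<le> 1 + (\<integral>\<^sup>+w. \<Psi> w \<partial>K z)"
        using c zS by (intro add_mono nn_integral_kernel_mono E_bound) auto
      also have "(\<integral>\<^sup>+w. \<Psi> w \<partial>K z) \<le> ennreal (N1 + U) + ennreal (U + 1) * ennreal base.return_bound"
        using zN base.nn_integral_hit_total_le[OF zV]
        by (intro order.trans[OF \<Psi>_int[OF zS]] add_mono mult_left_mono) (auto intro: ennreal_leI)
      also have "1 + (ennreal (N1 + U) + ennreal (U + 1) * ennreal base.return_bound) = ennreal C"
        unfolding C_def using U0 base.return_bound(1) zN W0[OF zS]
        by (simp add: ennreal_mult'[symmetric] flip: ennreal_plus ennreal_1)
      finally show ?thesis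
        by (simp add: mult_left_mono)
    qed
    then show ?thesis
      by (subst suminf_eq_SUP) (rule SUP_least)
  qed
  show ?thesis
  proof (rule positive_recurrentI[OF D _ sum_D])
    fix z assume z: "z \<in> space S"
    \<comment> \<open>The probability of never returning to \<open>?D\<close>. Where
      \<open>hit_total\<close> is infinite, \<open>E_bound\<close> is void, so \<open>a\<close> is
      treated separately: it vanishes over \<open>V\<close>, where \<open>\<Psi>\<close> is finite,
      and satisfies a one-step equation.\<close>
    define a where "a z = (INF k. avoid ?D k z)" for z
    have lim: "(\<lambda>k. avoid ?D k z) \<longlonglongrightarrow> a z" if "z \<in> space S" for z
      unfolding a_def using avoid_antimono_Suc[OF that] by (intro LIMSEQ_INF decseq_SucI)
    have a_V: "a z = 0" if zS: "z \<in> space S" and zV: "proj z \<in> V" for z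
    proof -
      have "(\<Sum>k. avoid ?D k z) < \<infinity>"
      proof (cases "z \<in> ?D")
        case True
        show ?thesis
          by (rule order.strict_trans1[OF sum_D[OF True]]) (simp add: ennreal_mult_less_top)
      next
        case False
        have "(\<Sum>k<n. avoid ?D k z) \<le> ennreal (1 / c) * \<Psi> z" for n
        proof -
          have "(\<Sum>k<n. avoid ?D k z) = ennreal (1 / c) * (ennreal c * E n z)"
            using c False zS by (simp add: E_def mult.assoc[symmetric] ennreal_mult'[symmetric])
          also have "\<dots> \<le> ennreal (1 / c) * \<Psi> z"
            by (intro mult_left_mono E_bound zS) simp
          finally show ?thesis .
        qed
        then have "(\<Sum>k. avoid ?D k z) \<le> ennreal (1 / c) * \<Psi> z"
          by (subst suminf_eq_SUP) (rule SUP_least)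
        also have "\<dots> < \<infinity>"
          by (simp add: \<Psi>_def base.hit_total_mem[OF zV] ennreal_mult_less_top)
        finally show ?thesis .
      qed
      moreover have r: "ennreal (enn2real (avoid ?D k z)) = avoid ?D k z" for k
        by (intro ennreal_enn2real order.strict_trans1[OF avoid_le_1[OF zS]]) simp
      ultimately have "summable (\<lambda>k. enn2real (avoid ?D k z))"
        by (intro summable_suminf_not_top) auto
      then have "(\<lambda>k. ennreal (enn2real (avoid ?D k z))) \<longlonglongrightarrow> ennreal 0"
        by (intro tendsto_ennrealI summable_LIMSEQ_zero)
      then have "(\<lambda>k. avoid ?D k z) \<longlonglongrightarrow> 0"
        by (simp only: r ennreal_0)
      then show ?thesis
        using lim[OF zS] LIMSEQ_unique by blast
    qed
    have a_step: "a z = (\<integral>\<^sup>+w. indicator (space S - ?D) w * a w \<partial>K z)" if z: "z \<in> space S" for z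
    proof -
      have "(\<lambda>k. \<integral>\<^sup>+w. indicator (space S - ?D) w * avoid ?D k w \<partial>K z) \<longlonglongrightarrow>
          (\<integral>\<^sup>+w. indicator (space S - ?D) w * a w \<partial>K z)"
      proof (rule nn_integral_dominated_convergence[where w="\<lambda>_. 1"])
        show "AE w in K z. indicator (space S - ?D) w * avoid ?D k w \<le> 1" for k
          using avoid_le_1[of _ ?D k] by (intro AE_I2) (auto simp: indicator_def space_kernel[OF z])
        show "AE w in K z. (\<lambda>k. indicator (space S - ?D) w * avoid ?D k w) \<longlonglongrightarrow> indicator (space S - ?D) w * a w"
          using lim by (intro AE_I2 ennreal_tendsto_cmult) (auto simp: indicator_def space_kernel[OF z])
        show "(\<lambda>w. indicator (space S - ?D) w * a w) \<in> borel_measurable (K z)"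
          unfolding a_def using z by (intro borel_measurable_kernel) auto
      qed (use z in \<open>auto intro!: borel_measurable_kernel simp: prob_space.emeasure_space_1[OF prob_space_kernel]\<close>)
      moreover have "(\<lambda>k. avoid ?D (Suc k) z) \<longlonglongrightarrow> a z"
        using lim[OF z] by (rule LIMSEQ_Suc)
      ultimately show ?thesis
        unfolding avoid.simps using LIMSEQ_unique by blast
    qed
    \<comment> \<open>Never returning to \<open>?D\<close> forces the base chain to avoid
      \<open>V\<close>, since \<open>a\<close> vanishes over \<open>V\<close>. The probability of
      this up to time \<open>j\<close> tends to \<open>0\<close> by recurrence of
      \<open>V\<close>.\<close>
    have "a z \<le> indicator (space MX - V) (proj z) * base.avoid V j (proj z)" if "z \<in> space S" for j z
      using that
    proof (induction j arbitrary: z)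
      case 0
      have "a z \<le> avoid ?D 0 z"
        unfolding a_def by (rule INF_lower) simp
      then show ?case
        using a_V[OF 0] proj_space[OF 0] by (auto simp: indicator_def)
    next
      case (Suc j)
      show ?case
      proof (cases "proj z \<in> V")
        case False
        have "a z \<le> (\<integral>\<^sup>+w. a w \<partial>K z)"
          unfolding a_step[OF Suc.prems] by (intro nn_integral_mono) (auto simp: indicator_def)
        also have "\<dots> \<le> (\<integral>\<^sup>+w. indicator (space MX - V) (proj w) * base.avoid V j (proj w) \<partial>K z)"
          by (intro nn_integral_kernel_mono Suc)
        also have "\<dots> = base.avoid V (Suc j) (proj z)"
          using base.V_sets unfolding base.avoid.simps by (intro nn_integral_kernel_proj Suc.prems) auto
        finally show ?thesis
          using False proj_space[OF Suc.prems] by simp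
      qed (simp add: a_V[OF Suc.prems])
    qed
    from this[OF z] have "a z \<le> 1 * base.avoid V j (proj z)" for j
      by (rule order.trans[OF _ mult_right_mono]) (auto simp: indicator_def)
    then have "a z \<le> base.avoid V j (proj z)" for j
      by simp
    then have "a z \<le> 0"
      using base.positive_recurrentD(2)[OF base.recurrent proj_space[OF z]] by (intro LIMSEQ_le_const) auto
    then show "(\<lambda>k. avoid ?D k z) \<longlonglongrightarrow> 0"
      using lim[OF z] by simp
  next
    show "ennreal (1 / c) * ennreal C < \<infinity>"
      using ennreal_mult_less_top[of "ennreal (1 / c)" "ennreal C"] by simp
  qed
qed

end

section \<open>Drift of one level\<close>

context markov_chain
begin

lemma kernel_pow_add_const:
  assumes g: "bounded_by F g" and x: "x \<in> space S"
  shows "kernel_pow n (\<lambda>x. g x + c) x = kernel_pow n g x + c"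
  using x
proof (induction n arbitrary: x)
  case (Suc n)
  have "kernel_pow (Suc n) (\<lambda>x. g x + c) x = kernel_op (\<lambda>x. kernel_pow n g x + c) x"
    using Suc by (auto intro: kernel_op_cong)
  then show ?case
    using Suc.prems by (simp add: kernel_op_add[OF _ bounded_by_kernel_pow[OF g] bounded_by_const])
qed simp

lemma psum_add_const:
  "bounded_by F g \<Longrightarrow> x \<in> space S \<Longrightarrow> psum (\<lambda>x. g x + c) t x = psum g t x + t * c"
  by (simp add: psum_def kernel_pow_add_const sum.distrib)

end

lemma decreases_to_zero_nonneg: "decreases_to_zero h \<Longrightarrow> 0 \<le> x \<Longrightarrow> 0 \<le> h x"
proof -
  assume h: "decreases_to_zero h" and x: "0 \<le> x"
  have "\<forall>\<^sub>F y in at_top. h y \<le> h x"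
    using eventually_ge_at_top[of x]
    by eventually_elim (use h x in \<open>auto simp: decreases_to_zero_def monotone_on_def\<close>)
  then show "0 \<le> h x"
    using h by (intro tendsto_upperbound[of h 0 at_top]) (auto simp: decreases_to_zero_def)
qed

lemma decreases_to_zeroD: "decreases_to_zero h \<Longrightarrow> 0 \<le> x \<Longrightarrow> x \<le> y \<Longrightarrow> h y \<le> h x"
  by (auto simp: decreases_to_zero_def monotone_on_def)

lemma decreases_to_zero_small:
  assumes h: "decreases_to_zero h" and \<delta>: "0 < \<delta>"
  shows "\<exists>N>0. h N < \<delta>"
proof -
  have "\<forall>\<^sub>F N in at_top. h N < \<delta>"
    using h \<delta> by (auto simp: decreases_to_zero_def dest: order_tendstoD(2))
  then have "\<forall>\<^sub>F N in at_top. 0 < N \<and> h N < \<delta>"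
    using eventually_gt_at_top[of "0::real"] by eventually_elim simp
  then show ?thesis
    using eventually_happens[of _ "at_top :: real filter"] by auto
qed

context factor_chain
begin

text \<open>The error is split into a function of the base state, whose expected sum is
  \<open>psum\<close>, and a rest bounded at each time. The constant \<open>c\<close> lets a signed
  drift be shifted to a nonnegative \<open>g\<close>, as \<open>ennreal\<close> requires.\<close>

lemma nn_integral_nstep_drift_bound:
  assumes z: "z \<in> space S"
    and [measurable]: "\<Phi> \<in> borel_measurable S" "\<eta> \<in> borel_measurable S"
    and \<Phi>0: "\<And>w. w \<in> space S \<Longrightarrow> 0 \<le> \<Phi> w" and \<eta>0: "\<And>w. w \<in> space S \<Longrightarrow> 0 \<le> \<eta> w"
    and g: "base.bounded_by G g" and g0: "\<And>x. x \<in> space MX \<Longrightarrow> 0 \<le> g x"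
    and c: "0 \<le> c" and \<kappa>: "0 \<le> \<kappa>"
    and drift: "\<And>w. w \<in> space S \<Longrightarrow>
      (\<integral>\<^sup>+v. ennreal (\<Phi> v) \<partial>K w) + ennreal c \<le> ennreal (\<Phi> w + (g (proj w) + \<eta> w))"
    and err: "\<And>u. u < t \<Longrightarrow> (\<integral>\<^sup>+w. ennreal (\<eta> w) \<partial>nstep S K u z) \<le> ennreal \<kappa>"
  shows "(\<integral>\<^sup>+w. ennreal (\<Phi> w) \<partial>nstep S K t z) + ennreal (t * c)
    \<le> ennreal (\<Phi> z + base.psum g t (proj z) + t * \<kappa>)"
proof -
  have [measurable]: "g \<in> borel_measurable MX"
    using base.bounded_by_measurable[OF g] .
  let ?\<psi> = "\<lambda>w. ennreal (g (proj w)) + ennreal (\<eta> w)"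
  have "(\<integral>\<^sup>+w. ennreal (\<Phi> w) \<partial>nstep S K t z) + of_nat t * ennreal c
      \<le> ennreal (\<Phi> z) + (\<Sum>u<t. \<integral>\<^sup>+w. ?\<psi> w \<partial>nstep S K u z)"
  proof (rule nn_integral_nstep_drift[OF z])
    fix w assume w: "w \<in> space S"
    show "(\<integral>\<^sup>+v. ennreal (\<Phi> v) \<partial>K w) + ennreal c \<le> ennreal (\<Phi> w) + ?\<psi> w"
      using drift[OF w] \<Phi>0[OF w] \<eta>0[OF w] g0[OF proj_space[OF w]] by (simp add: ennreal_plus)
  qed measurable
  also have "(\<Sum>u<t. \<integral>\<^sup>+w. ?\<psi> w \<partial>nstep S K u z) =
      (\<Sum>u<t. \<integral>\<^sup>+w. ennreal (g (proj w)) \<partial>nstep S K u z) + (\<Sum>u<t. \<integral>\<^sup>+w. ennreal (\<eta> w) \<partial>nstep S K u z)"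
    unfolding sum.distrib[symmetric]
    by (intro sum.cong refl nn_integral_add borel_measurable_nstep) measurable
  also have "\<dots> \<le> ennreal (base.psum g t (proj z)) + (\<Sum>u<t. ennreal \<kappa>)"
    using err sum_nn_integral_nstep_proj[OF g g0 z, of t] by (intro add_mono sum_mono) auto
  also have "\<dots> = ennreal (base.psum g t (proj z) + t * \<kappa>)"
    using \<kappa> base.kernel_pow_nonneg[OF g g0 proj_space[OF z]]
    by (simp add: base.psum_def sum_nonneg ennreal_plus ennreal_mult' ennreal_of_nat_eq_real_of_nat)
  finally show ?thesis
    using \<kappa> c \<Phi>0[OF z] base.kernel_pow_nonneg[OF g g0 proj_space[OF z]]
    by (simp add: base.psum_def sum_nonneg ennreal_plus[symmetric] ennreal_mult' ennreal_of_nat_eq_real_of_nat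
        add_left_mono add.assoc del: ennreal_plus)
qed

end

section \<open>One level with increments bounded in mean\<close>

locale level_chain = factor_chain S K MX KX V \<pi> proj
  for S :: "'a measure" and K :: "'a \<Rightarrow> 'a measure"
    and MX :: "'x measure" and KX :: "'x \<Rightarrow> 'x measure" and V \<pi> proj +
  fixes l :: "'a \<Rightarrow> real" and U :: real
  assumes level_measurable [measurable]: "l \<in> borel_measurable S"
    and level_nonneg: "z \<in> space S \<Longrightarrow> 0 \<le> l z"
    and step_bound_nonneg: "0 \<le> U"
    and step_bound: "z \<in> space S \<Longrightarrow> (\<integral>\<^sup>+w. ennreal \<bar>l w - l z\<bar> \<partial>K z) \<le> ennreal U"
begin

lemma nn_integral_nstep_abs_diff:
  assumes z: "z \<in> space S"
  shows "(\<integral>\<^sup>+w. ennreal \<bar>l w - l z\<bar> \<partial>nstep S K t z) \<le> ennreal (t * U)"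
proof -
  have "(\<integral>\<^sup>+w. ennreal \<bar>l w - l z\<bar> \<partial>nstep S K t z) + of_nat t * 0
    \<le> ennreal \<bar>l z - l z\<bar> + (\<Sum>u<t. \<integral>\<^sup>+w. ennreal U \<partial>nstep S K u z)"
  proof (rule nn_integral_nstep_drift[OF z])
    fix w assume w: "w \<in> space S"
    have "(\<integral>\<^sup>+v. ennreal \<bar>l v - l z\<bar> \<partial>K w) \<le> (\<integral>\<^sup>+v. ennreal \<bar>l v - l w\<bar> + ennreal \<bar>l w - l z\<bar> \<partial>K w)"
      by (intro nn_integral_mono) (simp flip: ennreal_plus)
    also have "\<dots> = (\<integral>\<^sup>+v. ennreal \<bar>l v - l w\<bar> \<partial>K w) + ennreal \<bar>l w - l z\<bar>"
      using w by (subst nn_integral_add) (auto simp: borel_measurable_kernel nn_integral_kernel_const[OF w, simplified])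
    also have "\<dots> \<le> ennreal \<bar>l w - l z\<bar> + ennreal U"
      using step_bound[OF w] by (simp add: add.commute add_left_mono)
    finally show "(\<integral>\<^sup>+v. ennreal \<bar>l v - l z\<bar> \<partial>K w) + 0 \<le> ennreal \<bar>l w - l z\<bar> + ennreal U"
      by simp
  qed measurable
  also have "(\<Sum>u<t. \<integral>\<^sup>+w. ennreal U \<partial>nstep S K u z) = ennreal (t * U)"
    using step_bound_nonneg
    by (simp only: nn_integral_nstep_const[OF z]) (simp add: ennreal_mult' ennreal_of_nat_eq_real_of_nat)
  finally show ?thesis by simp
qed

lemma integrable_level:
  assumes z: "z \<in> space S"
  shows "integrable (nstep S K t z) l"
proof -
  interpret N: prob_space "nstep S K t z"
    using z by (rule prob_space_nstep)
  have "integrable (nstep S K t z) (\<lambda>w. l w - l z)"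
    using nn_integral_nstep_abs_diff[OF z, of t]
    by (intro integrableI_bounded) (auto simp: borel_measurable_nstep intro: order.strict_trans1)
  then have "integrable (nstep S K t z) (\<lambda>w. (l w - l z) + l z)"
    by (intro Bochner_Integration.integrable_add) auto
  then show ?thesis by simp
qed

lemma mean_increment_eq:
  assumes z: "z \<in> space S"
  shows "mean_increment S K l t z = (\<integral>w. l w \<partial>nstep S K t z) - l z"
proof -
  interpret N: prob_space "nstep S K t z"
    using z by (rule prob_space_nstep)
  have "mean_increment S K l t z = (\<integral>w. l w - l z \<partial>nstep S K t z)"
    unfolding mean_increment_def nstep_def using z by (intro integral_distr[symmetric]) auto
  then show ?thesis
    using integrable_level[OF z, of t] N.prob_space by simp
qed

lemma nn_integral_level:
  assumes z: "z \<in> space S"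
  shows "(\<integral>\<^sup>+w. ennreal (l w) \<partial>nstep S K t z) = ennreal (l z + mean_increment S K l t z)"
  using level_nonneg unfolding mean_increment_eq[OF z]
  by (subst nn_integral_eq_integral[OF integrable_level[OF z]]) auto

lemma level_mean_increment_nonneg:
  assumes z: "z \<in> space S"
  shows "0 \<le> l z + mean_increment S K l t z"
  using level_nonneg unfolding mean_increment_eq[OF z] by (auto intro!: integral_nonneg_AE)

lemma nn_integral_kernel_level:
  "z \<in> space S \<Longrightarrow> (\<integral>\<^sup>+w. ennreal (l w) \<partial>K z) = ennreal (l z + mean_increment S K l 1 z)"
  using nn_integral_level[of z 1] nstep_1[of z] by simp

text \<open>Summing the one-step bound gives \<open>psum f\<close>, controlled by
  \<open>psum_le_mean\<close>, plus terms \<open>h (l)\<close>. These are small while the level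
  stays high. From a start above \<open>N\<close> the level can only become low by moving
  \<open>N / 2\<close>, while its mean displacement within \<open>t\<close> steps is at most
  \<open>t * U\<close>.\<close>

theorem mean_increment_drift:
  assumes f: "base.bounded_by F f" and h: "decreases_to_zero h"
    and one_step: "\<And>z. z \<in> space S \<Longrightarrow> mean_increment S K l 1 z \<le> f (proj z) + h (l z)"
    and c: "c < - (\<integral>x. f x \<partial>\<pi>)"
  shows "\<exists>t0. \<forall>t\<ge>t0. \<exists>N>0. \<forall>z\<in>space S. proj z \<in> V \<longrightarrow> N \<le> l z \<longrightarrow>
    mean_increment S K l t z \<le> - (real t * c)"
proof -
  obtain x0 where "x0 \<in> space MX"
    using prob_space.not_empty[OF base.prob_space_stationary] by (auto simp: base.space_stationary)
  with base.bounded_byD[OF f] have F: "0 \<le> F"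
    by force
  \<comment> \<open>The gap between \<open>c\<close> and the mean drift pays three errors: the
    averaging of \<open>f\<close>, the correction at high levels, and the correction at low
    levels.\<close>
  define \<delta> where "\<delta> = (- (\<integral>x. f x \<partial>\<pi>) - c) / 3"
  have \<delta>: "0 < \<delta>"
    using c by (simp add: \<delta>_def)
  from base.psum_le_mean[OF f \<delta>] obtain t0
    where t0: "\<And>t x. t0 \<le> t \<Longrightarrow> x \<in> V \<Longrightarrow> base.psum f t x \<le> t * ((\<integral>x. f x \<partial>\<pi>) + \<delta>)"
    by blast
  obtain N0 where N0: "0 < N0" "h N0 < \<delta>"
    using decreases_to_zero_small[OF h \<delta>] by blast
  have h0: "0 \<le> h 0"
    using decreases_to_zero_nonneg[OF h] by simp
  have "\<exists>N>0. \<forall>z\<in>space S. proj z \<in> V \<longrightarrow> N \<le> l z \<longrightarrow> mean_increment S K l t z \<le> - (real t * c)"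
    if t: "t0 \<le> t" for t
  proof -
    \<comment> \<open>The first entry puts every level above \<open>N / 2\<close> into the range
      where \<open>h\<close> is below \<open>\<delta>\<close>; the second makes the low-level
      correction at most \<open>\<delta>\<close> in mean. The latter depends on
      \<open>t\<close>.\<close>
    define N where "N = max (2 * N0) (2 * h 0 * (t * U) / \<delta>)"
    have N: "0 < N" "N0 \<le> N / 2" "2 * h 0 / N * (t * U) \<le> \<delta>"
    proof -
      show "0 < N" "N0 \<le> N / 2"
        using N0 by (auto simp: N_def)
      have "2 * h 0 * (t * U) / \<delta> \<le> N"
        by (simp add: N_def)
      then show "2 * h 0 / N * (t * U) \<le> \<delta>"
        using \<delta> \<open>0 < N\<close> by (simp add: field_simps)
    qed
    have "mean_increment S K l t z \<le> - (real t * c)" if z: "z \<in> space S" "proj z \<in> V" "N \<le> l z" for z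
    proof -
      \<comment> \<open>A linear majorant of \<open>h (l)\<close> in place of Markov's inequality:
        if the level is below \<open>N / 2\<close>, the displacement exceeds \<open>N / 2\<close>
        and the second term exceeds \<open>h 0\<close>.\<close>
      let ?\<eta> = "\<lambda>w. \<delta> + 2 * h 0 / N * \<bar>l w - l z\<bar>"
      let ?g = "\<lambda>x. f x + F"
      have g: "base.bounded_by (F + \<bar>F\<bar>) ?g"
        by (intro base.bounded_by_add f base.bounded_by_const)
      have g0: "0 \<le> ?g x" if "x \<in> space MX" for x
        using base.bounded_byD[OF f that] by linarith
      have \<eta>: "h (l w) \<le> ?\<eta> w" if w: "w \<in> space S" for w
      proof (cases "N / 2 \<le> l w")
        case True
        have "h (l w) \<le> h N0"
          using N N0 True by (intro decreases_to_zeroD[OF h]) auto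
        then show ?thesis
          using N0 N(1) h0 by (smt (verit) divide_nonneg_pos mult_nonneg_nonneg)
      next
        case False
        have "h (l w) \<le> h 0"
          using level_nonneg[OF w] by (intro decreases_to_zeroD[OF h]) auto
        also have "\<dots> = 2 * h 0 / N * (N / 2)"
          using N(1) by simp
        also have "\<dots> \<le> 2 * h 0 / N * \<bar>l w - l z\<bar>"
          using False z(3) h0 N(1) by (intro mult_left_mono) auto
        finally show ?thesis using \<delta> by simp
      qed
      have "(\<integral>\<^sup>+w. ennreal (l w) \<partial>nstep S K t z) + ennreal (t * F)
        \<le> ennreal (l z + base.psum ?g t (proj z) + t * (2 * \<delta>))"
      proof (rule nn_integral_nstep_drift_bound[OF z(1) _ _ level_nonneg _ g g0 F, where \<eta>="?\<eta>"])
        show "0 \<le> ?\<eta> w" for w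
          using \<delta> h0 N(1) by simp
        show "(\<integral>\<^sup>+v. ennreal (l v) \<partial>K w) + ennreal F \<le> ennreal (l w + (?g (proj w) + ?\<eta> w))" if w: "w \<in> space S" for w
          unfolding nn_integral_kernel_level[OF w]
          using one_step[OF w] \<eta>[OF w] level_mean_increment_nonneg[OF w, of 1] F
          by (simp flip: ennreal_plus)
        show "(\<integral>\<^sup>+w. ennreal (?\<eta> w) \<partial>nstep S K u z) \<le> ennreal (2 * \<delta>)" if u: "u < t" for u
        proof -
          have "(\<integral>\<^sup>+w. ennreal (?\<eta> w) \<partial>nstep S K u z) =
              (\<integral>\<^sup>+w. ennreal \<delta> + ennreal (2 * h 0 / N) * ennreal \<bar>l w - l z\<bar> \<partial>nstep S K u z)"
            using \<delta> h0 N(1) by (intro nn_integral_cong) (simp add: ennreal_plus ennreal_mult'[symmetric])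
          also have "\<dots> = ennreal \<delta> + ennreal (2 * h 0 / N) * (\<integral>\<^sup>+w. ennreal \<bar>l w - l z\<bar> \<partial>nstep S K u z)"
            by (subst nn_integral_add)
              (auto simp: borel_measurable_nstep nn_integral_cmult nn_integral_nstep_const[OF z(1), simplified])
          also have "\<dots> \<le> ennreal \<delta> + ennreal (2 * h 0 / N) * ennreal (t * U)"
            using u step_bound_nonneg
            by (intro add_left_mono mult_left_mono order.trans[OF nn_integral_nstep_abs_diff[OF z(1)]] ennreal_leI mult_right_mono) auto
          also have "\<dots> = ennreal (\<delta> + 2 * h 0 / N * (t * U))"
            using \<delta> h0 N(1) step_bound_nonneg by (simp add: ennreal_plus ennreal_mult'[symmetric])
          also have "\<dots> \<le> ennreal (2 * \<delta>)"
            using N(3) by (intro ennreal_leI) simp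
          finally show ?thesis .
        qed
      qed (use \<delta> in auto)
      also have "base.psum ?g t (proj z) = base.psum f t (proj z) + t * F"
        by (rule base.psum_add_const[OF f base.V_space[OF z(2)]])
      finally have "ennreal (l z + mean_increment S K l t z + t * F) \<le>
          ennreal (l z + (base.psum f t (proj z) + t * F) + t * (2 * \<delta>))"
        unfolding nn_integral_level[OF z(1)]
        using level_mean_increment_nonneg[OF z(1), of t] F by (simp add: ennreal_plus)
      moreover have "0 \<le> base.psum f t (proj z) + t * F"
        using base.bounded_byD[OF base.bounded_by_psum[OF f, of t] base.V_space[OF z(2)]] by (simp add: abs_le_iff)
      ultimately have "mean_increment S K l t z \<le> base.psum f t (proj z) + t * (2 * \<delta>)"
        using level_nonneg[OF z(1)] \<delta> by (subst (asm) ennreal_le_iff) auto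
      also have "\<dots> \<le> t * ((\<integral>x. f x \<partial>\<pi>) + 3 * \<delta>)"
        using t0[OF t z(2)] by (simp add: algebra_simps)
      also have "(\<integral>x. f x \<partial>\<pi>) + 3 * \<delta> = - c"
        by (simp add: \<delta>_def field_simps)
      finally show ?thesis by simp
    qed
    then show ?thesis
      using N(1) by blast
  qed
  then show ?thesis by blast
qed

end

context factor_chain
begin

text \<open>The time \<open>T\<close> is chosen first, large for the drift, the sublinear growth and
  the residual hitting time. Only then are the thresholds \<open>N i\<close> fixed; a sum of levels
  above the sum of the \<open>N i\<close> forces one level above its own threshold.\<close>

theorem sum_positive_recurrent:
  fixes l :: "'i \<Rightarrow> 'a \<Rightarrow> real"
  assumes I: "finite I" "I \<noteq> {}"
    and level: "\<And>i. i \<in> I \<Longrightarrow> level_chain S K MX KX V \<pi> proj (l i) U"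
    and c: "0 < c"
    and drift: "\<And>i. i \<in> I \<Longrightarrow> \<exists>t0. \<forall>t\<ge>t0. \<exists>N>0. \<forall>z\<in>space S. proj z \<in> V \<longrightarrow> N \<le> l i z \<longrightarrow>
      mean_increment S K (l i) t z \<le> - (real t * c)"
    and sublinear: "\<And>i \<delta>. i \<in> I \<Longrightarrow> 0 < \<delta> \<Longrightarrow> \<exists>t0. \<forall>t\<ge>t0. \<forall>z\<in>space S. proj z \<in> V \<longrightarrow>
      mean_increment S K (l i) t z \<le> real t * \<delta>"
  shows "\<exists>N. \<forall>N1\<ge>N. positive_recurrent S K {z \<in> space S. proj z \<in> V \<and> (\<Sum>i\<in>I. l i z) \<le> N1}"
proof -
  define n where "n = real (card I)"
  have n: "0 < n"
    using I by (simp add: n_def card_gt_0_iff)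
  have U: "0 \<le> U"
    using I level unfolding level_chain_def level_chain_axioms_def by blast
  \<comment> \<open>Of the decrease \<open>T * c\<close>, half covers the growth of at most
    \<open>n\<close> other levels, a quarter covers the residual hitting time with its weight
    \<open>n * U + 1\<close>, and a quarter remains as net drift.\<close>
  define \<delta> where "\<delta> = c / (2 * n)"
  define \<delta>' where "\<delta>' = c / (4 * (n * U + 1))"
  have \<delta>: "0 < \<delta>" "0 < \<delta>'"
    using c n U by (auto simp: \<delta>_def \<delta>'_def add_nonneg_pos)
  from drift obtain t1 where t1: "\<And>i t. i \<in> I \<Longrightarrow> t1 i \<le> t \<Longrightarrow> \<exists>N>0. \<forall>z\<in>space S. proj z \<in> V \<longrightarrow> N \<le> l i z \<longrightarrow>
      mean_increment S K (l i) t z \<le> - (real t * c)"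
    by metis
  from sublinear[OF _ \<delta>(1)] obtain t2 where t2: "\<And>i t z. i \<in> I \<Longrightarrow> t2 i \<le> t \<Longrightarrow> z \<in> space S \<Longrightarrow> proj z \<in> V \<Longrightarrow>
      mean_increment S K (l i) t z \<le> real t * \<delta>"
    by metis
  from base.residual_hit_le[OF \<delta>(2)] obtain t3
    where t3: "\<And>t x. t3 \<le> t \<Longrightarrow> x \<in> V \<Longrightarrow> (\<integral>\<^sup>+w. base.hit_total w \<partial>nstep MX KX t x) \<le> ennreal (\<delta>' * t)"
    by blast
  define T where "T = Suc (t3 + (\<Sum>i\<in>I. t1 i) + (\<Sum>i\<in>I. t2 i))"
  have T: "t1 i \<le> T" "t2 i \<le> T" if "i \<in> I" for i
    using member_le_sum[OF that, of t1] member_le_sum[OF that, of t2] I by (auto simp: T_def)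
  have T3: "t3 \<le> T" "0 < T"
    by (auto simp: T_def)
  from t1[OF _ T(1)] obtain N where N: "\<And>i. i \<in> I \<Longrightarrow> 0 < N i"
    "\<And>i z. i \<in> I \<Longrightarrow> z \<in> space S \<Longrightarrow> proj z \<in> V \<Longrightarrow> N i \<le> l i z \<Longrightarrow> mean_increment S K (l i) T z \<le> - (real T * c)"
    by metis
  let ?W = "\<lambda>z. \<Sum>i\<in>I. l i z"
  let ?c = "min 1 (c / 4)"
  have meas: "l i \<in> borel_measurable S" and nonneg: "\<And>z. z \<in> space S \<Longrightarrow> 0 \<le> l i z"
    if "i \<in> I" for i
    using level[OF that] by (auto simp: level_chain_def level_chain_axioms_def)
  have mean_W: "(\<integral>\<^sup>+w. ennreal (?W w) \<partial>nstep S K t z) = ennreal (?W z + (\<Sum>i\<in>I. mean_increment S K (l i) t z))"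
    if z: "z \<in> space S" for t z
  proof -
    have "(\<integral>\<^sup>+w. ennreal (?W w) \<partial>nstep S K t z) = (\<integral>\<^sup>+w. (\<Sum>i\<in>I. ennreal (l i w)) \<partial>nstep S K t z)"
      using nonneg by (intro nn_integral_cong) simp
    also have "\<dots> = (\<Sum>i\<in>I. \<integral>\<^sup>+w. ennreal (l i w) \<partial>nstep S K t z)"
      using meas by (intro nn_integral_sum) (auto intro!: borel_measurable_nstep)
    also have "\<dots> = (\<Sum>i\<in>I. ennreal (l i z + mean_increment S K (l i) t z))"
      using level z by (intro sum.cong refl level_chain.nn_integral_level) auto
    also have "\<dots> = ennreal (\<Sum>i\<in>I. l i z + mean_increment S K (l i) t z)"
      using level_chain.level_mean_increment_nonneg[OF level z] by (intro sum_ennreal) auto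
    finally show ?thesis
      by (simp add: sum.distrib)
  qed
  have "positive_recurrent S K {z \<in> space S. proj z \<in> V \<and> ?W z \<le> N1}" if N1: "(\<Sum>i\<in>I. N i) \<le> N1" for N1
  proof (rule foster_positive_recurrent)
    show "?W \<in> borel_measurable S"
      using meas by (intro borel_measurable_sum)
    show "0 \<le> ?W z" if "z \<in> space S" for z
      using nonneg that by (intro sum_nonneg) auto
    show "0 \<le> n * U"
      using n U by simp
    show "0 < ?c" "?c \<le> 1" "0 < T"
      using c T3 by auto
    show "(\<integral>\<^sup>+w. ennreal (?W w) \<partial>K z) \<le> ennreal (?W z + n * U)" if z: "z \<in> space S" for z
    proof -
      have "mean_increment S K (l i) 1 z \<le> U" if i: "i \<in> I" for i
      proof -
        interpret level_chain S K MX KX V \<pi> proj "l i" U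
          by (rule level[OF i])
        have "ennreal (l i z + mean_increment S K (l i) 1 z) \<le> (\<integral>\<^sup>+w. ennreal (l i z) + ennreal \<bar>l i w - l i z\<bar> \<partial>K z)"
          unfolding nn_integral_kernel_level[OF z, symmetric]
          using level_nonneg[OF z] by (intro nn_integral_mono) (simp flip: ennreal_plus)
        also have "\<dots> \<le> ennreal (l i z) + ennreal U"
          using step_bound[OF z] z
          by (subst nn_integral_add)
            (auto simp: borel_measurable_kernel nn_integral_kernel_const[OF z, simplified] intro: add_left_mono)
        finally show ?thesis
          using U level_nonneg[OF z] by (simp flip: ennreal_plus)
      qed
      then have "(\<Sum>i\<in>I. mean_increment S K (l i) 1 z) \<le> n * U"
        unfolding n_def by (rule sum_bounded_above)
      then show ?thesis
        using mean_W[OF z, of 1] by (simp add: nstep_1[OF z] ennreal_leI del: One_nat_def)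
    qed
    fix z assume z: "z \<in> space S" "proj z \<in> V" "N1 < ?W z"
    obtain i where i: "i \<in> I" "N i \<le> l i z"
    proof (rule ccontr)
      assume "\<not> thesis"
      then have "l i z \<le> N i" if "i \<in> I" for i
        using that \<open>\<And>i. \<lbrakk>i \<in> I; N i \<le> l i z\<rbrakk> \<Longrightarrow> thesis\<close> by force
      then have "?W z \<le> (\<Sum>i\<in>I. N i)"
        by (rule sum_mono)
      with N1 z(3) show False by simp
    qed
    have "(\<Sum>j\<in>I. mean_increment S K (l j) T z) = mean_increment S K (l i) T z + (\<Sum>j\<in>I - {i}. mean_increment S K (l j) T z)"
      using i I by (simp add: sum.remove)
    also have "\<dots> \<le> - (real T * c) + (\<Sum>j\<in>I - {i}. real T * \<delta>)"
      using i z by (intro add_mono sum_mono N t2 T) auto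
    also have "(\<Sum>j\<in>I - {i}. real T * \<delta>) \<le> (\<Sum>j\<in>I. real T * \<delta>)"
      using I \<delta> by (intro sum_mono2) auto
    also have "\<dots> = real T * c / 2"
      using n by (simp add: \<delta>_def n_def[symmetric])
    finally have mi: "(\<Sum>j\<in>I. mean_increment S K (l j) T z) \<le> - (real T * c / 2)"
      by (simp add: mult.commute)
    have "ennreal (n * U + 1) * (\<integral>\<^sup>+x. base.hit_total x \<partial>nstep MX KX T (proj z)) \<le> ennreal (n * U + 1) * ennreal (\<delta>' * T)"
      by (intro mult_left_mono t3 T3 z) simp
    also have "\<dots> = ennreal (real T * c / 4)"
    proof -
      have "0 < n * U + 1"
        using n U by (simp add: add_nonneg_pos)
      then have "(n * U + 1) * (\<delta>' * T) = real T * c / 4"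
        by (simp add: \<delta>'_def field_simps)
      then show ?thesis
        using \<open>0 < n * U + 1\<close> by (subst ennreal_mult'[symmetric]) (auto intro: arg_cong[where f=ennreal])
    qed
    finally have hit: "ennreal (n * U + 1) * (\<integral>\<^sup>+x. base.hit_total x \<partial>nstep MX KX T (proj z)) \<le> ennreal (real T * c / 4)" .
    have pos: "0 \<le> ?W z + (\<Sum>i\<in>I. mean_increment S K (l i) T z)"
      using level_chain.level_mean_increment_nonneg[OF level z(1)]
      by (auto simp: sum.distrib[symmetric] intro!: sum_nonneg)
    have "?c * T \<le> real T * c / 4"
      using mult_right_mono[of ?c "c / 4" "real T"] by (simp add: mult.commute)
    then have "(\<integral>\<^sup>+w. ennreal (?W w) \<partial>nstep S K T z) +
        ennreal (n * U + 1) * (\<integral>\<^sup>+x. base.hit_total x \<partial>nstep MX KX T (proj z)) + ennreal (?c * T)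
      \<le> ennreal (?W z + (\<Sum>i\<in>I. mean_increment S K (l i) T z)) + ennreal (real T * c / 4) + ennreal (real T * c / 4)"
      unfolding mean_W[OF z(1)] by (intro add_mono hit ennreal_leI order.refl)
    also have "\<dots> = ennreal (?W z + (\<Sum>i\<in>I. mean_increment S K (l i) T z) + real T * c / 4 + real T * c / 4)"
      using pos c by (subst ennreal_plus[symmetric], simp_all)+
    also have "\<dots> \<le> ennreal (?W z)"
      using mi by (intro ennreal_leI) linarith
    finally show "(\<integral>\<^sup>+w. ennreal (?W w) \<partial>nstep S K T z) +
        ennreal (n * U + 1) * (\<integral>\<^sup>+x. base.hit_total x \<partial>nstep MX KX T (proj z)) + ennreal (?c * T)
      \<le> ennreal (?W z)" .
  qed
  then show ?thesis by blast
qed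

end

section \<open>Sublinear growth of one level\<close>

definition slope :: "real \<Rightarrow> real \<Rightarrow> real" where
  "slope R x = min (x / R) 1"

text \<open>On \<open>[0, \<infinity>)\<close> this is the convex function with derivative \<open>slope R\<close>.\<close>

definition huber :: "real \<Rightarrow> real \<Rightarrow> real" where
  "huber R x = x * slope R x - R / 2 * (slope R x)\<^sup>2"

lemma slope_measurable [measurable]: "slope R \<in> borel_measurable borel"
  unfolding slope_def[abs_def] by measurable

lemma huber_measurable [measurable]: "huber R \<in> borel_measurable borel"
  unfolding huber_def[abs_def] by measurable

lemma slope_bounds: "0 < R \<Longrightarrow> 0 \<le> x \<Longrightarrow> 0 \<le> slope R x" "slope R x \<le> 1"
  by (auto simp: slope_def)

lemma slope_diff: "0 < R \<Longrightarrow> \<bar>slope R x - slope R y\<bar> \<le> \<bar>x - y\<bar> / R"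
proof -
  assume R: "0 < R"
  have "\<bar>min a 1 - min b 1\<bar> \<le> \<bar>a - b\<bar>" for a b :: real by linarith
  from this[of "x / R" "y / R"] show ?thesis
    using R by (simp add: slope_def diff_divide_distrib[symmetric])
qed

text \<open>For \<open>x \<ge> 0\<close> the value \<open>huber R x\<close> is the maximum of the
  left side over \<open>m\<close> in \<open>[0, 1]\<close>, attained at \<open>slope R x\<close>.
  The choices \<open>m = slope R y\<close>, \<open>0\<close> and \<open>1\<close> give convexity,
  nonnegativity and the linear lower bound.\<close>

lemma huber_ge:
  assumes R: "0 < R" and m: "0 \<le> m" "m \<le> 1"
  shows "x * m - R / 2 * m\<^sup>2 \<le> huber R x"
proof (cases "x \<le> R")
  case True
  define s where "s = slope R x"
  have x: "x = R * s"
    using True R by (simp add: s_def slope_def min_def field_simps)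
  have "0 \<le> R / 2 * (s - m)\<^sup>2"
    using R by simp
  then show ?thesis
    unfolding huber_def s_def[symmetric] by (simp add: x power2_eq_square algebra_simps)
next
  case False
  then have s: "slope R x = 1"
    using R by (simp add: slope_def min_def)
  have "0 \<le> (x - R) * (1 - m) + R / 2 * (1 - m)\<^sup>2"
    using False R m by (intro add_nonneg_nonneg mult_nonneg_nonneg) auto
  then show ?thesis
    unfolding huber_def s by (simp add: power2_eq_square field_simps)
qed

lemma huber_convex: "0 < R \<Longrightarrow> 0 \<le> y \<Longrightarrow> huber R y - huber R x \<le> slope R y * (y - x)"
  using huber_ge[of R "slope R y" x] slope_bounds[of R y] by (simp add: huber_def algebra_simps)

lemma huber_mono: "0 < R \<Longrightarrow> 0 \<le> x \<Longrightarrow> x \<le> y \<Longrightarrow> huber R x \<le> huber R y"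
  using huber_convex[of R x y] slope_bounds[of R x] mult_nonneg_nonpos[of "slope R x" "x - y"] by linarith

lemma huber_nonneg: "0 < R \<Longrightarrow> 0 \<le> huber R x"
  using huber_ge[of R 0 x] by simp

lemma huber_le:
  assumes R: "0 < R" and x: "0 \<le> x"
  shows "huber R x \<le> x"
proof -
  have "x * slope R x \<le> x * 1"
    using slope_bounds(2) x by (intro mult_left_mono) auto
  moreover have "0 \<le> R / 2 * (slope R x)\<^sup>2"
    using R by simp
  ultimately show ?thesis
    unfolding huber_def by linarith
qed

lemma le_huber: "0 < R \<Longrightarrow> x \<le> huber R x + R / 2"
  using huber_ge[of R 1 x] by simp

text \<open>Below \<open>N\<close> the slope is at most \<open>N / R\<close>, above \<open>N\<close>
  the function \<open>h\<close> is at most \<open>h N\<close>. Choosing \<open>N\<close> and then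
  \<open>R\<close> makes both terms small.\<close>

lemma slope_mult_le:
  assumes h: "decreases_to_zero h" and R: "0 < R" and N: "0 \<le> N" and x: "0 \<le> x"
  shows "slope R x * h x \<le> h N + h 0 * N / R"
proof (cases "N \<le> x")
  case True
  have "slope R x * h x \<le> 1 * h N"
    using slope_bounds(1)[OF R x] slope_bounds(2)[of R x] decreases_to_zeroD[OF h N True] decreases_to_zero_nonneg[OF h x]
    by (intro mult_mono) auto
  moreover have "0 \<le> h 0 * N / R"
    using R N decreases_to_zero_nonneg[OF h, of 0] by simp
  ultimately show ?thesis by simp
next
  case False
  have "slope R x * h x \<le> (N / R) * h 0"
    using False R N x decreases_to_zeroD[OF h order.refl x] decreases_to_zero_nonneg[OF h x]
    by (intro mult_mono) (auto simp: slope_def min_def divide_right_mono intro: order.trans[of _ "x / R"])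
  then show ?thesis
    using decreases_to_zero_nonneg[OF h N] by (simp add: mult.commute)
qed

context level_chain
begin

lemma integrable_kernel_level: "z \<in> space S \<Longrightarrow> integrable (K z) l"
  using integrable_level[of z 1] nstep_1[of z] by simp

lemma integrable_kernel_huber:
  assumes R: "0 < R" and z: "z \<in> space S"
  shows "integrable (K z) (\<lambda>w. huber R (l w))"
proof (rule Bochner_Integration.integrable_bound[OF integrable_kernel_level[OF z]])
  show "(\<lambda>w. huber R (l w)) \<in> borel_measurable (K z)"
    using z by (intro borel_measurable_kernel) measurable
  show "AE w in K z. norm (huber R (l w)) \<le> norm (l w)"
    using huber_nonneg[OF R] huber_le[OF R] level_nonneg by (intro AE_I2) (auto simp: space_kernel[OF z])
qed

text \<open>At low levels \<open>h (l)\<close> is not small, so summing the bound for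
  \<open>l\<close> itself could give linear growth. Passing to \<open>huber R\<close> damps
  \<open>h\<close> by the slope but also multiplies \<open>f\<close>, and the product depends on the
  level, so \<open>psum_le_mean\<close> does not apply to it. The term with \<open>u\<close> repairs
  this.\<close>

theorem mean_increment_sublinear:
  assumes f: "base.bounded_by F f" and neg: "(\<integral>x. f x \<partial>\<pi>) < 0" and h: "decreases_to_zero h"
    and one_step: "\<And>\<eta>. 0 < \<eta> \<Longrightarrow> \<exists>R0. \<forall>R\<ge>R0. 0 < R \<longrightarrow> (\<forall>z\<in>space S.
      (\<integral>w. huber R (l w) \<partial>K z) \<le> huber R (l z) + slope R (l z) * (f (proj z) + h (l z)) + \<eta>)"
    and \<delta>: "0 < \<delta>"
  shows "\<exists>t0. \<forall>t\<ge>t0. \<forall>z\<in>space S. proj z \<in> V \<longrightarrow> mean_increment S K l t z \<le> real t * \<delta>"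
proof -
  from \<delta> have "0 < \<delta> / 4" by simp
  from base.ex_approx_poisson[OF f neg this] obtain u A \<psi> B t0
    where u: "base.bounded_by A u" and \<psi>: "base.bounded_by B \<psi>"
      and \<psi>0: "\<And>x. x \<in> space MX \<Longrightarrow> 0 \<le> \<psi> x"
      and poisson: "\<And>x. x \<in> space MX \<Longrightarrow> f x + base.kernel_op u x - u x \<le> \<psi> x"
      and t0: "\<And>t x. t0 \<le> t \<Longrightarrow> x \<in> V \<Longrightarrow> base.psum \<psi> t x \<le> t * (\<delta> / 4)"
    by metis
  have [measurable]: "u \<in> borel_measurable MX" "\<psi> \<in> borel_measurable MX"
    using base.bounded_by_measurable u \<psi> by auto
  obtain x0 where "x0 \<in> space MX"
    using prob_space.not_empty[OF base.prob_space_stationary] by (auto simp: base.space_stationary)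
  with base.bounded_byD[OF u] have A: "0 \<le> A"
    by force
  have uA: "\<bar>u (proj z)\<bar> \<le> A" if "z \<in> space S" for z
    using base.bounded_byD[OF u proj_space[OF that]] .
  have \<delta>16: "0 < \<delta> / 16" using \<delta> by simp
  obtain N where N: "0 < N" "h N < \<delta> / 16"
    using decreases_to_zero_small[OF h \<delta>16] by blast
  obtain R0 where R0: "\<And>R z. R0 \<le> R \<Longrightarrow> 0 < R \<Longrightarrow> z \<in> space S \<Longrightarrow>
      (\<integral>w. huber R (l w) \<partial>K z) \<le> huber R (l z) + slope R (l z) * (f (proj z) + h (l z)) + \<delta> / 16"
    using one_step[OF \<delta>16] by blast
  \<comment> \<open>Four errors of \<open>\<delta> / 16\<close> are allowed per step: the
    second-order term (through \<open>R0\<close>), \<open>h N\<close>, \<open>h 0 * N / R\<close>,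
    and the variation \<open>A * U / R\<close> of the slope in front of \<open>u\<close>. With
    \<open>\<delta> / 4\<close> for \<open>\<psi>\<close>, half of \<open>\<delta>\<close> is left
    for constants.\<close>
  define R where "R = max (max R0 1) (max (16 * (h 0 * N) / \<delta>) (16 * (A * U) / \<delta>))"
  have R: "0 < R" "R0 \<le> R" "h 0 * N / R \<le> \<delta> / 16" "A * U / R \<le> \<delta> / 16"
  proof -
    show "0 < R" "R0 \<le> R" by (auto simp: R_def)
    have "16 * (h 0 * N) / \<delta> \<le> R" "16 * (A * U) / \<delta> \<le> R"
      by (auto simp: R_def)
    then show "h 0 * N / R \<le> \<delta> / 16" "A * U / R \<le> \<delta> / 16"
      using \<delta> \<open>0 < R\<close> by (simp_all add: field_simps)
  qed
  let ?m = "\<lambda>w. slope R (l w)"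
  have m: "0 \<le> ?m w" "?m w \<le> 1" if "w \<in> space S" for w
    using slope_bounds R(1) level_nonneg[OF that] by auto
  have mu: "\<bar>?m w * u (proj w)\<bar> \<le> A" if w: "w \<in> space S" for w
    using mult_mono[of "?m w" 1 "\<bar>u (proj w)\<bar>" A] m[OF w] uA[OF w] A by (simp add: abs_mult)
  define \<Phi> where "\<Phi> w = huber R (l w) + ?m w * u (proj w) + A" for w
  have [measurable]: "\<Phi> \<in> borel_measurable S"
    unfolding \<Phi>_def[abs_def] by measurable
  have \<Phi>_ge: "huber R (l w) \<le> \<Phi> w" if "w \<in> space S" for w
    using mu[OF that] by (simp add: \<Phi>_def abs_le_iff)
  have \<Phi>_le: "\<Phi> w \<le> l w + 2 * A" if "w \<in> space S" for w
    using mu[OF that] huber_le[OF R(1) level_nonneg[OF that]] by (simp add: \<Phi>_def abs_le_iff)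
  have \<Phi>0: "0 \<le> \<Phi> w" if "w \<in> space S" for w
    using \<Phi>_ge[OF that] huber_nonneg[OF R(1), of "l w"] by linarith
  have step: "(\<integral>\<^sup>+v. ennreal (\<Phi> v) \<partial>K w) + ennreal 0 \<le> ennreal (\<Phi> w + (\<psi> (proj w) + \<delta> / 4))"
    if w: "w \<in> space S" for w
  proof -
    interpret Kw: prob_space "K w"
      using w by (rule prob_space_kernel)
    note ih = integrable_kernel_huber[OF R(1) w]
    have mK: "g \<in> borel_measurable (K w)" if "g \<in> borel_measurable S" for g :: "'a \<Rightarrow> real"
      using that by (simp add: measurable_cong_sets[OF sets_kernel[OF w] refl])
    have iu: "integrable (K w) (\<lambda>v. u (proj v))"
      using uA by (intro Kw.integrable_const_bound[where B=A] AE_I2 mK) (auto simp: space_kernel[OF w])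
    have imu: "integrable (K w) (\<lambda>v. ?m v * u (proj v))"
      using mu by (intro Kw.integrable_const_bound[where B=A] AE_I2 mK) (auto simp: space_kernel[OF w])
    have id: "integrable (K w) (\<lambda>v. \<bar>l v - l w\<bar>)"
      using integrable_kernel_level[OF w] by simp
    have dU: "(\<integral>v. \<bar>l v - l w\<bar> \<partial>K w) \<le> U"
      using step_bound[OF w] nn_integral_eq_integral[OF id] step_bound_nonneg by simp
    \<comment> \<open>The slope is frozen at \<open>w\<close>, at the cost of its Lipschitz constant
      \<open>1 / R\<close> times \<open>A\<close> times the mean displacement. What remains is the
      mean of \<open>u\<close>, a function of the base state.\<close>
    have "(\<integral>v. ?m v * u (proj v) \<partial>K w) \<le> (\<integral>v. ?m w * u (proj v) + A / R * \<bar>l v - l w\<bar> \<partial>K w)"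
    proof (rule integral_mono[OF imu])
      show "integrable (K w) (\<lambda>v. ?m w * u (proj v) + A / R * \<bar>l v - l w\<bar>)"
        using iu id by (intro Bochner_Integration.integrable_add integrable_mult_right)
      fix v assume "v \<in> space (K w)"
      then have v: "v \<in> space S" by (simp add: space_kernel[OF w])
      have "(?m v - ?m w) * u (proj v) \<le> \<bar>?m v - ?m w\<bar> * \<bar>u (proj v)\<bar>"
        by (metis abs_ge_self abs_mult)
      also have "\<dots> \<le> (\<bar>l v - l w\<bar> / R) * A"
        using slope_diff[OF R(1), of "l v" "l w"] uA[OF v] R(1) by (intro mult_mono) auto
      finally show "?m v * u (proj v) \<le> ?m w * u (proj v) + A / R * \<bar>l v - l w\<bar>"
        by (simp add: algebra_simps)
    qed
    also have "\<dots> = ?m w * (\<integral>v. u (proj v) \<partial>K w) + A / R * (\<integral>v. \<bar>l v - l w\<bar> \<partial>K w)"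
      using iu id by (subst Bochner_Integration.integral_add) auto
    also have "A / R * (\<integral>v. \<bar>l v - l w\<bar> \<partial>K w) \<le> A / R * U"
      using dU A R(1) by (intro mult_left_mono) auto
    also have "A / R * U \<le> \<delta> / 16"
      using R(4) by simp
    also have "(\<integral>v. u (proj v) \<partial>K w) = base.kernel_op u (proj w)"
      by (rule integral_kernel_proj[OF w]) measurable
    finally have mu_step: "(\<integral>v. ?m v * u (proj v) \<partial>K w) \<le> ?m w * base.kernel_op u (proj w) + \<delta> / 16"
      by simp
    have "(\<integral>v. \<Phi> v \<partial>K w) = (\<integral>v. huber R (l v) \<partial>K w) + (\<integral>v. ?m v * u (proj v) \<partial>K w) + A"
      unfolding \<Phi>_def using ih imu Kw.prob_space by simp
    also have "\<dots> \<le> (huber R (l w) + ?m w * (f (proj w) + h (l w)) + \<delta> / 16)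
        + (?m w * base.kernel_op u (proj w) + \<delta> / 16) + A"
      using R0[OF R(2,1) w] mu_step by (intro add_mono) auto
    also have "\<dots> = \<Phi> w + ?m w * (f (proj w) + base.kernel_op u (proj w) - u (proj w)) + ?m w * h (l w) + \<delta> / 8"
      by (simp add: \<Phi>_def algebra_simps)
    \<comment> \<open>The factor \<open>?m w\<close> can be replaced by \<open>1\<close> because
      \<open>\<psi>\<close> is nonnegative; this would fail for the signed \<open>f\<close>.\<close>
    also have "\<dots> \<le> \<Phi> w + \<psi> (proj w) + \<delta> / 8 + \<delta> / 8"
    proof -
      have "?m w * (f (proj w) + base.kernel_op u (proj w) - u (proj w)) \<le> ?m w * \<psi> (proj w)"
        using m[OF w] poisson[OF proj_space[OF w]] by (intro mult_left_mono) auto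
      also have "\<dots> \<le> 1 * \<psi> (proj w)"
        using m[OF w] \<psi>0[OF proj_space[OF w]] by (intro mult_right_mono) auto
      finally have "?m w * (f (proj w) + base.kernel_op u (proj w) - u (proj w)) \<le> \<psi> (proj w)"
        by simp
      moreover have "?m w * h (l w) \<le> h N + h 0 * N / R"
        using N(1) by (intro slope_mult_le h R(1) level_nonneg w) simp
      ultimately show ?thesis
        using N(2) R(3) by linarith
    qed
    finally have "(\<integral>v. \<Phi> v \<partial>K w) \<le> \<Phi> w + (\<psi> (proj w) + \<delta> / 4)"
      by simp
    moreover have "(\<integral>\<^sup>+v. ennreal (\<Phi> v) \<partial>K w) = ennreal (\<integral>v. \<Phi> v \<partial>K w)"
      using ih imu \<Phi>0 unfolding \<Phi>_def
      by (intro nn_integral_eq_integral) (auto simp: space_kernel[OF w])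
    ultimately show ?thesis
      by (simp add: ennreal_leI)
  qed
  \<comment> \<open>The constants are \<open>2 * A\<close> from comparing \<open>\<Phi>\<close> with
    the level at the start and \<open>R / 2\<close> from comparing \<open>huber R\<close> with it at
    the end.\<close>
  obtain t1 :: nat where t1: "2 * (2 * A + R / 2) / \<delta> \<le> t1"
    using real_arch_simple by blast
  have "mean_increment S K l t z \<le> real t * \<delta>" if t: "max t0 t1 \<le> t" and z: "z \<in> space S" "proj z \<in> V" for t z
  proof -
    have bound: "(\<integral>\<^sup>+w. ennreal (\<Phi> w) \<partial>nstep S K t z) + ennreal (real t * 0)
        \<le> ennreal (\<Phi> z + base.psum \<psi> t (proj z) + t * (\<delta> / 4))"
    proof (rule nn_integral_nstep_drift_bound[where \<eta>="\<lambda>_. \<delta> / 4" and g=\<psi>, OF z(1) _ _ \<Phi>0 _ \<psi> \<psi>0 _ _ step])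
      show "(\<integral>\<^sup>+w. ennreal (\<delta> / 4) \<partial>nstep S K u z) \<le> ennreal (\<delta> / 4)" for u
        by (simp only: nn_integral_nstep_const[OF z(1)])
    qed (use \<delta> in auto)
    have "ennreal (l z + mean_increment S K l t z) \<le> (\<integral>\<^sup>+w. ennreal (\<Phi> w) + ennreal (R / 2) \<partial>nstep S K t z)"
      unfolding nn_integral_level[OF z(1), symmetric]
    proof (rule nn_integral_nstep_mono)
      fix w assume w: "w \<in> space S"
      show "ennreal (l w) \<le> ennreal (\<Phi> w) + ennreal (R / 2)"
        using le_huber[OF R(1), of "l w"] \<Phi>_ge[OF w] \<Phi>0[OF w] R(1)
        by (simp flip: ennreal_plus)
    qed
    also have "\<dots> = (\<integral>\<^sup>+w. ennreal (\<Phi> w) \<partial>nstep S K t z) + ennreal (R / 2)"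
      using nn_integral_nstep_const[OF z(1), where c="ennreal (R / 2)" and n=t]
      by (subst nn_integral_add) (auto intro!: borel_measurable_nstep)
    also have "\<dots> \<le> ennreal (\<Phi> z + base.psum \<psi> t (proj z) + t * (\<delta> / 4)) + ennreal (R / 2)"
      using bound by (intro add_right_mono) simp
    also have "\<dots> = ennreal (\<Phi> z + base.psum \<psi> t (proj z) + t * (\<delta> / 4) + R / 2)"
      using \<Phi>0[OF z(1)] base.kernel_pow_nonneg[OF \<psi> \<psi>0 proj_space[OF z(1)]] \<delta> R(1)
      by (subst ennreal_plus) (auto simp: base.psum_def sum_nonneg)
    finally have "l z + mean_increment S K l t z \<le> \<Phi> z + base.psum \<psi> t (proj z) + t * (\<delta> / 4) + R / 2"
      using \<Phi>0[OF z(1)] base.kernel_pow_nonneg[OF \<psi> \<psi>0 proj_space[OF z(1)]] \<delta> R(1)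
      by (subst (asm) ennreal_le_iff) (auto simp: base.psum_def sum_nonneg)
    moreover have "base.psum \<psi> t (proj z) \<le> t * (\<delta> / 4)"
      using t t0 z(2) by simp
    moreover have "2 * A + R / 2 \<le> t * \<delta> / 2"
    proof -
      have "2 * (2 * A + R / 2) / \<delta> \<le> real t"
        using t1 t by (simp add: order.trans)
      then show ?thesis using \<delta> by (simp add: field_simps)
    qed
    ultimately show ?thesis
      using \<Phi>_le[OF z(1)] by simp
  qed
  then show ?thesis by blast
qed

end

section \<open>Uniformly integrable dominated increments\<close>

text \<open>Uniform integrability stated for laws on the real line, so that it no longer refers to
  the space on which the variables live.\<close>

definition uniform_tails :: "'x set \<Rightarrow> ('x \<Rightarrow> real measure) \<Rightarrow> bool" where
  "uniform_tails X \<nu> \<longleftrightarrow> (\<forall>x\<in>X. prob_space (\<nu> x) \<and> sets (\<nu> x) = sets borel) \<and>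
    (\<forall>\<eta>>0. \<exists>C. \<forall>x\<in>X. (\<integral>\<^sup>+s. ennreal \<bar>s\<bar> * indicator {s. C \<le> \<bar>s\<bar>} s \<partial>\<nu> x) \<le> ennreal \<eta>)"

lemma uniform_tailsD:
  assumes "uniform_tails X \<nu>" "0 < \<eta>"
  shows "\<exists>C. \<forall>x\<in>X. (\<integral>\<^sup>+s. ennreal \<bar>s\<bar> * indicator {s. C \<le> \<bar>s\<bar>} s \<partial>\<nu> x) \<le> ennreal \<eta>"
  using assms by (auto simp: uniform_tails_def)

lemma uniform_tails_mean:
  assumes \<nu>: "uniform_tails X \<nu>"
  shows "x \<in> X \<Longrightarrow> integrable (\<nu> x) (\<lambda>s. s)" and "\<exists>F. \<forall>x\<in>X. \<bar>\<integral>s. s \<partial>\<nu> x\<bar> \<le> F"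
proof -
  obtain C where C: "\<And>x. x \<in> X \<Longrightarrow> (\<integral>\<^sup>+s. ennreal \<bar>s\<bar> * indicator {s. C \<le> \<bar>s\<bar>} s \<partial>\<nu> x) \<le> ennreal 1"
    using uniform_tailsD[OF \<nu>, of 1] by auto
  have bound: "(\<integral>\<^sup>+s. ennreal \<bar>s\<bar> \<partial>\<nu> x) \<le> ennreal (\<bar>C\<bar> + 1)" if x: "x \<in> X" for x
  proof -
    interpret prob_space "\<nu> x" using \<nu> x by (simp add: uniform_tails_def)
    have [measurable_cong]: "sets (\<nu> x) = sets borel" using \<nu> x by (simp add: uniform_tails_def)
    have "(\<integral>\<^sup>+s. ennreal \<bar>s\<bar> \<partial>\<nu> x) \<le> (\<integral>\<^sup>+s. ennreal \<bar>C\<bar> + ennreal \<bar>s\<bar> * indicator {s. C \<le> \<bar>s\<bar>} s \<partial>\<nu> x)"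
      by (intro nn_integral_mono) (auto simp: indicator_def intro: ennreal_leI)
    also have "\<dots> = ennreal \<bar>C\<bar> + (\<integral>\<^sup>+s. ennreal \<bar>s\<bar> * indicator {s. C \<le> \<bar>s\<bar>} s \<partial>\<nu> x)"
      by (subst nn_integral_add) (auto simp: emeasure_space_1)
    also have "\<dots> \<le> ennreal \<bar>C\<bar> + ennreal 1"
      by (intro add_left_mono C x)
    finally show ?thesis by (simp add: ennreal_plus)
  qed
  show int: "integrable (\<nu> x) (\<lambda>s. s)" if x: "x \<in> X" for x
  proof (rule integrableI_bounded)
    show "(\<lambda>s. s) \<in> borel_measurable (\<nu> x)"
      using \<nu> x by (simp add: uniform_tails_def measurable_cong_sets[of "\<nu> x" borel])
    show "(\<integral>\<^sup>+s. ennreal (norm s) \<partial>\<nu> x) < \<infinity>"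
      using bound[OF x] by (auto intro: order.strict_trans1)
  qed
  have "\<bar>\<integral>s. s \<partial>\<nu> x\<bar> \<le> \<bar>C\<bar> + 1" if x: "x \<in> X" for x
  proof -
    have "ennreal \<bar>\<integral>s. s \<partial>\<nu> x\<bar> \<le> (\<integral>\<^sup>+s. ennreal \<bar>s\<bar> \<partial>\<nu> x)"
      using integral_norm_bound_ennreal[OF int[OF x]] by simp
    then have "ennreal \<bar>\<integral>s. s \<partial>\<nu> x\<bar> \<le> ennreal (\<bar>C\<bar> + 1)"
      using bound[OF x] by (rule order.trans)
    then show ?thesis by (subst (asm) ennreal_le_iff) auto
  qed
  then show "\<exists>F. \<forall>x\<in>X. \<bar>\<integral>s. s \<partial>\<nu> x\<bar> \<le> F" by blast
qed

text \<open>For \<open>x \<ge> 0\<close>, \<open>x * slope R x\<close> is the minimum of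
  \<open>x\<^sup>2 / R\<close> and \<open>x\<close>. Large arguments are controlled by the tails and
  bounded ones by \<open>1 / R\<close>. The shift \<open>b\<close> stands for the correction
  \<open>h (l)\<close>, at most \<open>h 0\<close>.\<close>

lemma uniform_tails_truncated:
  assumes \<nu>: "uniform_tails X \<nu>" and b0: "0 \<le> b0" and \<eta>: "0 < \<eta>"
  shows "\<exists>R0. \<forall>R\<ge>R0. 0 < R \<longrightarrow> (\<forall>x\<in>X. \<forall>b. 0 \<le> b \<longrightarrow> b \<le> b0 \<longrightarrow>
    (\<integral>\<^sup>+s. ennreal (\<bar>s + b\<bar> * slope R \<bar>s + b\<bar>) \<partial>\<nu> x) \<le> ennreal \<eta>)"
proof -
  obtain C0 where C0: "\<And>x. x \<in> X \<Longrightarrow> (\<integral>\<^sup>+s. ennreal \<bar>s\<bar> * indicator {s. C0 \<le> \<bar>s\<bar>} s \<partial>\<nu> x) \<le> ennreal (\<eta> / 4)"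
    using uniform_tailsD[OF \<nu>, of "\<eta> / 4"] \<eta> by auto
  \<comment> \<open>The maximum with \<open>b0\<close> ensures that the shift at most doubles
    \<open>\<bar>s\<bar>\<close> beyond \<open>C\<close>.\<close>
  define C where "C = max C0 b0"
  let ?R = "2 * (C + b0)\<^sup>2 / \<eta>"
  have "(\<integral>\<^sup>+s. ennreal (\<bar>s + b\<bar> * slope R \<bar>s + b\<bar>) \<partial>\<nu> x) \<le> ennreal \<eta>"
    if R: "?R \<le> R" "0 < R" and x: "x \<in> X" and b: "0 \<le> b" "b \<le> b0" for R x b
  proof -
    interpret prob_space "\<nu> x" using \<nu> x by (simp add: uniform_tails_def)
    have [measurable_cong]: "sets (\<nu> x) = sets borel" using \<nu> x by (simp add: uniform_tails_def)
    have small: "(C + b0)\<^sup>2 / R \<le> \<eta> / 2"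
      using R \<eta> by (simp add: field_simps)
    have "(\<integral>\<^sup>+s. ennreal (\<bar>s + b\<bar> * slope R \<bar>s + b\<bar>) \<partial>\<nu> x) \<le>
        (\<integral>\<^sup>+s. ennreal (\<eta> / 2) + 2 * (ennreal \<bar>s\<bar> * indicator {s. C0 \<le> \<bar>s\<bar>} s) \<partial>\<nu> x)"
    proof (rule nn_integral_mono)
      fix s
      show "ennreal (\<bar>s + b\<bar> * slope R \<bar>s + b\<bar>) \<le> ennreal (\<eta> / 2) + 2 * (ennreal \<bar>s\<bar> * indicator {s. C0 \<le> \<bar>s\<bar>} s)"
      proof (cases "C \<le> \<bar>s\<bar>")
        case True
        have "\<bar>s + b\<bar> * slope R \<bar>s + b\<bar> \<le> \<bar>s + b\<bar> * 1"
          using slope_bounds(2) by (intro mult_left_mono) auto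
        also have "\<dots> \<le> 2 * \<bar>s\<bar>"
          using True b unfolding C_def mult_1_right by linarith
        finally have "ennreal (\<bar>s + b\<bar> * slope R \<bar>s + b\<bar>) \<le> 2 * ennreal \<bar>s\<bar>"
          by (metis ennreal_leI ennreal_mult' ennreal_numeral zero_le_numeral)
        then show ?thesis
          using True by (simp add: C_def add_increasing)
      next
        case False
        have "\<bar>s + b\<bar> * slope R \<bar>s + b\<bar> \<le> \<bar>s + b\<bar> * (\<bar>s + b\<bar> / R)"
          by (intro mult_left_mono) (auto simp: slope_def)
        also have "\<dots> \<le> (C + b0) * ((C + b0) / R)"
          using False b b0 R by (intro mult_mono divide_right_mono) auto
        also have "\<dots> \<le> \<eta> / 2"
          using small by (simp add: power2_eq_square)
        finally show ?thesis
          by (intro add_increasing2 ennreal_leI) auto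
      qed
    qed
    also have "\<dots> = ennreal (\<eta> / 2) + 2 * (\<integral>\<^sup>+s. ennreal \<bar>s\<bar> * indicator {s. C0 \<le> \<bar>s\<bar>} s \<partial>\<nu> x)"
      by (subst nn_integral_add) (auto simp: emeasure_space_1 nn_integral_cmult)
    also have "\<dots> \<le> ennreal (\<eta> / 2) + 2 * ennreal (\<eta> / 4)"
      by (intro add_left_mono mult_left_mono C0 x) simp
    also have "\<dots> = ennreal \<eta>"
      using \<eta> by (simp add: ennreal_mult'[symmetric] flip: ennreal_plus ennreal_numeral)
    finally show ?thesis .
  qed
  then show ?thesis by blast
qed

text \<open>As \<open>huber R\<close> is increasing on nonnegative arguments, a one-sided bound on
  the increment suffices. Convexity gives the slope at the far end \<open>a + s\<close>; moving it
  back to \<open>a\<close> changes it by at most \<open>\<bar>s\<bar> / R\<close> and at most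
  \<open>1\<close>, that is, by \<open>slope R \<bar>s\<bar>\<close>.\<close>

lemma huber_increment:
  assumes R: "0 < R" and a: "0 \<le> a" and y: "0 \<le> y" "y \<le> a + s"
  shows "huber R y \<le> huber R a + slope R a * s + \<bar>s\<bar> * slope R \<bar>s\<bar>"
proof -
  have as: "0 \<le> a + s" using y by simp
  have "huber R y \<le> huber R (a + s)"
    using y by (intro huber_mono R)
  also have "\<dots> \<le> huber R a + slope R (a + s) * s"
    using huber_convex[OF R as, of a] by simp
  also have "slope R (a + s) * s \<le> slope R a * s + \<bar>s\<bar> * slope R \<bar>s\<bar>"
  proof -
    have "\<bar>slope R (a + s) - slope R a\<bar> \<le> \<bar>s\<bar> / R"
      using slope_diff[OF R, of "a + s" a] by simp
    moreover have "\<bar>slope R (a + s) - slope R a\<bar> \<le> 1"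
      using slope_bounds(1)[OF R as] slope_bounds(1)[OF R a] slope_bounds(2)[of R "a + s"] slope_bounds(2)[of R a]
      by linarith
    ultimately have "\<bar>slope R (a + s) - slope R a\<bar> \<le> slope R \<bar>s\<bar>"
      by (simp add: slope_def)
    then have "\<bar>slope R (a + s) - slope R a\<bar> * \<bar>s\<bar> \<le> slope R \<bar>s\<bar> * \<bar>s\<bar>"
      by (rule mult_right_mono) simp
    moreover have "(slope R (a + s) - slope R a) * s \<le> \<bar>slope R (a + s) - slope R a\<bar> * \<bar>s\<bar>"
      by (metis abs_ge_self abs_mult)
    ultimately show ?thesis
      by (simp add: algebra_simps)
  qed
  finally show ?thesis by simp
qed

section \<open>From a version of the chain to bounds on its kernel\<close>

context markov_chain
begin

lemma distr_version:
  assumes ver: "chain_version S K Q Z" and z: "z \<in> space S"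
  shows "distr (Q z) S (Z 1) = K z"
proof -
  have Z: "\<And>t. Z t \<in> Q z \<rightarrow>\<^sub>M S" and law: "distr (Q z) (PiM UNIV (\<lambda>_. S)) (\<lambda>w t. Z t w) = chain_law S K z"
    using ver z by (auto simp: chain_version_def)
  have m: "(\<lambda>w t. Z t w) \<in> Q z \<rightarrow>\<^sub>M PiM UNIV (\<lambda>_. S)"
    using Z by (intro measurable_PiM_single') (auto simp: space_PiM dest: measurable_space)
  have "K z = distr (chain_law S K z) S (\<lambda>\<omega>. \<omega> 1)"
    using nstep_1[OF z] by (simp add: nstep_def)
  also have "\<dots> = distr (Q z) S ((\<lambda>\<omega>. \<omega> 1) \<circ> (\<lambda>w t. Z t w))"
    unfolding law[symmetric] by (intro distr_distr m measurable_component_singleton) simp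
  also have "\<dots> = distr (Q z) S (Z 1)"
    by (simp add: comp_def)
  finally show ?thesis by simp
qed

lemma AE_chain_law_0:
  fixes l :: "'a \<Rightarrow> real"
  assumes z: "z \<in> space S" and [measurable]: "l \<in> borel_measurable S"
  shows "AE \<omega> in chain_law S K z. l (\<omega> 0) = l z"
proof (rule AE_distrD[OF chain_law_coordinate[OF z]])
  show "AE w in distr (chain_law S K z) S (\<lambda>\<omega>. \<omega> 0). l w = l z"
    unfolding chain_law_start[OF kernel z] using z by (subst AE_return) auto
qed

end

context level_chain
begin

text \<open>At time \<open>0\<close> the version sits at \<open>z\<close> almost surely, so the
  random index in the domination is the fixed \<open>proj z\<close> and only the law of
  \<open>\<phi> (proj z)\<close> enters. The bounds hold for every start, and the kernel carries
  them to later times.\<close>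

lemma version_one_step:
  assumes ver: "chain_version S K Q Z" and \<nu>: "uniform_tails (space MX) \<nu>"
    and h: "decreases_to_zero h"
    and law: "\<And>z x. z \<in> space S \<Longrightarrow> x \<in> space MX \<Longrightarrow> \<phi> x \<in> borel_measurable (Q z)"
      "\<And>z x. z \<in> space S \<Longrightarrow> x \<in> space MX \<Longrightarrow> distr (Q z) borel (\<phi> x) = \<nu> x"
    and dom: "\<And>z. z \<in> space S \<Longrightarrow>
      AE w in Q z. l (Z 1 w) - l (Z 0 w) \<le> \<phi> (proj (Z 0 w)) w + h (l (Z 0 w))"
    and f: "\<And>x. x \<in> space MX \<Longrightarrow> f x = (\<integral>s. s \<partial>\<nu> x)"
  shows "z \<in> space S \<Longrightarrow> mean_increment S K l 1 z \<le> f (proj z) + h (l z)"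
    and "0 < \<eta> \<Longrightarrow> \<exists>R0. \<forall>R\<ge>R0. 0 < R \<longrightarrow> (\<forall>z\<in>space S.
      (\<integral>w. huber R (l w) \<partial>K z) \<le> huber R (l z) + slope R (l z) * (f (proj z) + h (l z)) + \<eta>)"
proof -
  have Z: "\<And>t. Z t \<in> Q z \<rightarrow>\<^sub>M S" and prob: "prob_space (Q z)" and start: "AE w in Q z. Z 0 w = z"
    if "z \<in> space S" for z
    using ver that by (auto simp: chain_version_def)
  have dom': "AE w in Q z. l (Z 1 w) \<le> l z + (\<phi> (proj z) w + h (l z))" if z: "z \<in> space S" for z
    using dom[OF z] start[OF z] by eventually_elim simp
  have Kint: "integrable (Q z) (\<lambda>w. g (Z 1 w))" "(\<integral>w. g w \<partial>K z) = (\<integral>w. g (Z 1 w) \<partial>Q z)"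
    if z: "z \<in> space S" and g: "g \<in> borel_measurable S" "integrable (K z) g" for z and g :: "'a \<Rightarrow> real"
    using g(2) unfolding distr_version[OF ver z, symmetric]
    by (simp_all add: integrable_distr_eq[OF Z[OF z] g(1)] integral_distr[OF Z[OF z] g(1)])
  have \<phi>int: "integrable (Q z) (\<phi> (proj z))" "(\<integral>w. \<phi> (proj z) w \<partial>Q z) = f (proj z)" if z: "z \<in> space S" for z
    using uniform_tails_mean(1)[OF \<nu> proj_space[OF z]] f[OF proj_space[OF z]]
    unfolding law(2)[OF z proj_space[OF z], symmetric]
    by (simp_all add: integrable_distr_eq[OF law(1)[OF z proj_space[OF z]]] integral_distr[OF law(1)[OF z proj_space[OF z]]])
  show "mean_increment S K l 1 z \<le> f (proj z) + h (l z)" if z: "z \<in> space S"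
  proof -
    interpret Q: prob_space "Q z" by (rule prob[OF z])
    have "(\<integral>w. l w \<partial>K z) \<le> (\<integral>w. l z + (\<phi> (proj z) w + h (l z)) \<partial>Q z)"
      unfolding Kint(2)[OF z level_measurable integrable_kernel_level[OF z]]
      using \<phi>int[OF z] dom'[OF z] Kint(1)[OF z level_measurable integrable_kernel_level[OF z]]
      by (intro integral_mono_AE) auto
    then show ?thesis
      using \<phi>int[OF z] Q.prob_space mean_increment_eq[OF z, of 1] nstep_1[OF z] by simp
  qed
  have h0: "0 \<le> h 0"
    using decreases_to_zero_nonneg[OF h] by simp
  show "\<exists>R0. \<forall>R\<ge>R0. 0 < R \<longrightarrow> (\<forall>z\<in>space S.
      (\<integral>w. huber R (l w) \<partial>K z) \<le> huber R (l z) + slope R (l z) * (f (proj z) + h (l z)) + \<eta>)" if \<eta>: "0 < \<eta>"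
  proof -
    from uniform_tails_truncated[OF \<nu> h0 \<eta>] obtain R0 where R0: "\<And>R x b. R0 \<le> R \<Longrightarrow> 0 < R \<Longrightarrow> x \<in> space MX \<Longrightarrow>
        0 \<le> b \<Longrightarrow> b \<le> h 0 \<Longrightarrow> (\<integral>\<^sup>+s. ennreal (\<bar>s + b\<bar> * slope R \<bar>s + b\<bar>) \<partial>\<nu> x) \<le> ennreal \<eta>"
      by blast
    have "(\<integral>w. huber R (l w) \<partial>K z) \<le> huber R (l z) + slope R (l z) * (f (proj z) + h (l z)) + \<eta>"
      if R: "R0 \<le> R" "0 < R" and z: "z \<in> space S" for R z
    proof -
      interpret Q: prob_space "Q z" by (rule prob[OF z])
      note [measurable] = law(1)[OF z proj_space[OF z]]
      let ?s = "\<lambda>w. \<phi> (proj z) w + h (l z)"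
      let ?e = "\<lambda>s. \<bar>s\<bar> * slope R \<bar>s\<bar>"
      have e0: "0 \<le> ?e s" for s
        using slope_bounds(1)[OF R(2)] by simp
      have hz: "0 \<le> h (l z)" "h (l z) \<le> h 0"
        using decreases_to_zero_nonneg[OF h] decreases_to_zeroD[OF h order.refl] level_nonneg[OF z] by auto
      have "(\<integral>\<^sup>+w. ennreal (?e (?s w)) \<partial>Q z) = (\<integral>\<^sup>+s. ennreal (?e (s + h (l z))) \<partial>distr (Q z) borel (\<phi> (proj z)))"
        by (subst nn_integral_distr) auto
      also have "\<dots> \<le> ennreal \<eta>"
        unfolding law(2)[OF z proj_space[OF z]] using hz by (intro R0 R proj_space z)
      finally have e: "(\<integral>\<^sup>+w. ennreal (?e (?s w)) \<partial>Q z) \<le> ennreal \<eta>" .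
      have ie: "integrable (Q z) (\<lambda>w. ?e (?s w))"
        using e e0 by (intro integrableI_bounded) (auto intro: order.strict_trans1 simp: abs_mult abs_of_nonneg[OF slope_bounds(1)[OF R(2)]])
      have "(\<integral>w. ?e (?s w) \<partial>Q z) \<le> \<eta>"
        using e \<eta> nn_integral_eq_integral[OF ie] e0 by simp
      have hm: "(\<lambda>w. huber R (l w)) \<in> borel_measurable S"
        by measurable
      note ih = Kint[OF z hm integrable_kernel_huber[OF R(2) z]]
      have "(\<integral>w. huber R (l w) \<partial>K z) \<le> (\<integral>w. huber R (l z) + slope R (l z) * ?s w + ?e (?s w) \<partial>Q z)"
        unfolding ih(2)
      proof (rule integral_mono_AE)
        show "integrable (Q z) (\<lambda>w. huber R (l z) + slope R (l z) * ?s w + ?e (?s w))"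
          using \<phi>int[OF z] ie by (intro Bochner_Integration.integrable_add integrable_mult_right) auto
        show "AE w in Q z. huber R (l (Z 1 w)) \<le> huber R (l z) + slope R (l z) * ?s w + ?e (?s w)"
          using dom'[OF z] AE_space
        proof eventually_elim
          case (elim w)
          then show ?case
            using measurable_space[OF Z[OF z] elim(2), of 1]
            by (intro huber_increment R level_nonneg z) auto
        qed
      qed (rule ih(1))
      also have "\<dots> = huber R (l z) + slope R (l z) * (f (proj z) + h (l z)) + (\<integral>w. ?e (?s w) \<partial>Q z)"
        using \<phi>int[OF z] ie Q.prob_space by simp
      finally show ?thesis
        using \<open>(\<integral>w. ?e (?s w) \<partial>Q z) \<le> \<eta>\<close> by linarith
    qed
    then show ?thesis by blast
  qed
qed

end

lemma uniform_tails_of_uniformly_integrable: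
  assumes Q: "prob_space Q" and ui: "uniformly_integrable Q X \<phi>"
  shows "uniform_tails X (\<lambda>x. distr Q borel (\<phi> x))"
  unfolding uniform_tails_def
proof (intro conjI ballI allI impI)
  have m: "\<phi> x \<in> borel_measurable Q" if "x \<in> X" for x
    using ui that by (auto simp: uniformly_integrable_def)
  show "prob_space (distr Q borel (\<phi> x))" if "x \<in> X" for x
    using Q m[OF that] by (rule prob_space.prob_space_distr)
  fix \<eta> :: real assume \<eta>: "0 < \<eta>"
  let ?t = "\<lambda>c::real. SUP x\<in>X. \<integral>\<^sup>+w. ennreal \<bar>\<phi> x w\<bar> * indicator {w. c \<le> \<bar>\<phi> x w\<bar>} w \<partial>Q"
  have "(?t \<longlongrightarrow> 0) at_top"
    using ui by (simp add: uniformly_integrable_def)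
  then have "\<forall>\<^sub>F c in at_top. ?t c < ennreal \<eta>"
    using \<eta> by (intro order_tendstoD(2)) auto
  then obtain C where C: "?t C < ennreal \<eta>"
    using eventually_happens[of _ "at_top :: real filter"] by auto
  have "(\<integral>\<^sup>+s. ennreal \<bar>s\<bar> * indicator {s. C \<le> \<bar>s\<bar>} s \<partial>distr Q borel (\<phi> x)) \<le> ennreal \<eta>" if x: "x \<in> X" for x
  proof -
    have "(\<integral>\<^sup>+s. ennreal \<bar>s\<bar> * indicator {s. C \<le> \<bar>s\<bar>} s \<partial>distr Q borel (\<phi> x)) =
        (\<integral>\<^sup>+w. ennreal \<bar>\<phi> x w\<bar> * indicator {w. C \<le> \<bar>\<phi> x w\<bar>} w \<partial>Q)"
      using m[OF x] by (subst nn_integral_distr) (auto simp: indicator_def)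
    also have "\<dots> \<le> ?t C"
      using x by (rule SUP_upper)
    finally show ?thesis using C by simp
  qed
  then show "\<exists>C. \<forall>x\<in>X. (\<integral>\<^sup>+s. ennreal \<bar>s\<bar> * indicator {s. C \<le> \<bar>s\<bar>} s \<partial>distr Q borel (\<phi> x)) \<le> ennreal \<eta>"
    by blast
qed simp

text \<open>Half-lines form an intersection-stable generator of the Borel sets. This makes the laws
  a kernel, so that their means are measurable in \<open>x\<close>.\<close>

lemma measurable_of_cdf:
  assumes \<nu>: "\<And>x. x \<in> space M \<Longrightarrow> prob_space (\<nu> x) \<and> sets (\<nu> x) = sets borel"
    and F: "\<And>u. (\<lambda>x. cdf (\<nu> x) u) \<in> borel_measurable M"
  shows "\<nu> \<in> M \<rightarrow>\<^sub>M prob_algebra (borel :: real measure)"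
proof (rule measurable_prob_algebra_generated)
  show "sets (borel :: real measure) = sigma_sets UNIV (range atMost)"
    by (simp add: borel_eq_atMost)
  show "Int_stable (range (atMost :: real \<Rightarrow> real set))"
    by (auto simp: Int_stable_def)
  show "(\<lambda>x. emeasure (\<nu> x) A) \<in> borel_measurable M" if G: "A \<in> range atMost" for A
  proof -
    obtain u where A: "A = {..u}" using G by auto
    have "emeasure (\<nu> x) A = ennreal (cdf (\<nu> x) u)" if "x \<in> space M" for x
    proof -
      interpret prob_space "\<nu> x" using \<nu>[OF that] by simp
      show ?thesis by (simp add: A cdf_def emeasure_eq_measure)
    qed
    then show ?thesis
      using F[of u] by (simp cong: measurable_cong)
  qed
qed (use \<nu> in auto)

context level_chain
begin

lemma version_sublinear_drift:
  assumes ver: "chain_version S K Q Z" and h: "decreases_to_zero h"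
    and ui: "\<And>z t. z \<in> space S \<Longrightarrow> uniformly_integrable (Q z) (space MX) (\<phi> t)"
    and cdf: "\<And>z t x u. z \<in> space S \<Longrightarrow> x \<in> space MX \<Longrightarrow> cdf (distr (Q z) borel (\<phi> t x)) u = F x u"
    and F: "\<And>u. (\<lambda>x. F x u) \<in> borel_measurable MX"
    and dom: "\<And>z. z \<in> space S \<Longrightarrow>
      AE w in Q z. l (Z 1 w) - l (Z 0 w) \<le> \<phi> 0 (proj (Z 0 w)) w + h (l (Z 0 w))"
    and f: "\<And>z x. z \<in> space S \<Longrightarrow> x \<in> space MX \<Longrightarrow> f x = (\<integral>w. \<phi> 1 x w \<partial>Q z)"
    and neg: "(\<integral>x. f x \<partial>\<pi>) < 0"
  shows "c < - (\<integral>x. f x \<partial>\<pi>) \<Longrightarrow> \<exists>t0. \<forall>t\<ge>t0. \<exists>N>0. \<forall>z\<in>space S. proj z \<in> V \<longrightarrow> N \<le> l z \<longrightarrow>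
      mean_increment S K l t z \<le> - (real t * c)"
    and "0 < \<delta> \<Longrightarrow> \<exists>t0. \<forall>t\<ge>t0. \<forall>z\<in>space S. proj z \<in> V \<longrightarrow> mean_increment S K l t z \<le> real t * \<delta>"
proof -
  have "(c < - (\<integral>x. f x \<partial>\<pi>) \<longrightarrow> (\<exists>t0. \<forall>t\<ge>t0. \<exists>N>0. \<forall>z\<in>space S. proj z \<in> V \<longrightarrow> N \<le> l z \<longrightarrow>
      mean_increment S K l t z \<le> - (real t * c))) \<and>
    (0 < \<delta> \<longrightarrow> (\<exists>t0. \<forall>t\<ge>t0. \<forall>z\<in>space S. proj z \<in> V \<longrightarrow> mean_increment S K l t z \<le> real t * \<delta>))"
  proof (cases "space S = {}")
    case True
    then show ?thesis by (auto intro: exI[of _ "1::real"])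
  next
    case False
    then obtain z0 where z0: "z0 \<in> space S" by blast
    \<comment> \<open>The distribution function \<open>F x\<close> depends neither on the start nor
      on the time, so one reference state gives the law of all \<open>\<phi> t x\<close>. In
      particular \<open>\<phi> 1\<close>, which defines \<open>f\<close>, and
      \<open>\<phi> 0\<close>, which dominates the first step, share it.\<close>
    define \<nu> where "\<nu> x = distr (Q z0) borel (\<phi> 0 x)" for x
    have prob: "prob_space (Q z)" if "z \<in> space S" for z
      using ver that by (simp add: chain_version_def)
    have meas: "\<phi> t x \<in> borel_measurable (Q z)" if "z \<in> space S" "x \<in> space MX" for t x z
      using ui[OF that(1), of t] that(2) by (simp add: uniformly_integrable_def)
    have law: "distr (Q z) borel (\<phi> t x) = \<nu> x" if z: "z \<in> space S" and x: "x \<in> space MX" for z t x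
      unfolding \<nu>_def
    proof (rule cdf_unique)
      show "real_distribution (distr (Q z) borel (\<phi> t x))" "real_distribution (distr (Q z0) borel (\<phi> 0 x))"
        using prob_space.real_distribution_distr[OF prob meas] z z0 x by auto
      show "cdf (distr (Q z) borel (\<phi> t x)) = cdf (distr (Q z0) borel (\<phi> 0 x))"
        using cdf[OF z x] cdf[OF z0 x] by (simp add: fun_eq_iff)
    qed
    have tails: "uniform_tails (space MX) \<nu>"
      unfolding \<nu>_def[abs_def] by (rule uniform_tails_of_uniformly_integrable[OF prob ui]) (rule z0)+
    have f\<nu>: "f x = (\<integral>s. s \<partial>\<nu> x)" if x: "x \<in> space MX" for x
      unfolding f[OF z0 x] law[OF z0 x, of 1, symmetric] using meas[OF z0 x]
      by (subst integral_distr) auto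
    have "\<nu> \<in> MX \<rightarrow>\<^sub>M prob_algebra borel"
    proof (rule measurable_of_cdf)
      show "prob_space (\<nu> x) \<and> sets (\<nu> x) = sets borel" if "x \<in> space MX" for x
        using tails that by (simp add: uniform_tails_def)
      show "(\<lambda>x. cdf (\<nu> x) u) \<in> borel_measurable MX" for u
        using F[of u] cdf[OF z0, of _ 0 u] by (simp add: \<nu>_def cong: measurable_cong)
    qed
    then have "(\<lambda>x. \<integral>s. s \<partial>\<nu> x) \<in> borel_measurable MX"
      by (rule measurable_compose[OF measurable_prob_algebraD integral_measurable_subprob_algebra]) simp
    then have "f \<in> borel_measurable MX"
      using f\<nu> by (simp cong: measurable_cong)
    moreover obtain C where "\<forall>x\<in>space MX. \<bar>f x\<bar> \<le> C"
      using uniform_tails_mean(2)[OF tails] f\<nu> by auto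
    ultimately have bdd: "base.bounded_by C f"
      by (simp add: base.bounded_by_def)
    note step = version_one_step[OF ver tails h meas law dom f\<nu>]
    show ?thesis
      using mean_increment_drift[OF bdd h step(1)] mean_increment_sublinear[OF bdd neg h step(2)]
      by simp
  qed
  then show "c < - (\<integral>x. f x \<partial>\<pi>) \<Longrightarrow> \<exists>t0. \<forall>t\<ge>t0. \<exists>N>0. \<forall>z\<in>space S. proj z \<in> V \<longrightarrow> N \<le> l z \<longrightarrow>
      mean_increment S K l t z \<le> - (real t * c)"
    and "0 < \<delta> \<Longrightarrow> \<exists>t0. \<forall>t\<ge>t0. \<forall>z\<in>space S. proj z \<in> V \<longrightarrow> mean_increment S K l t z \<le> real t * \<delta>"
    by simp_all
qed

end

text \<open>Both alternatives supply the same two facts about each level: a linear decrease from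
  high levels and sublinear growth. The threshold produced by \<open>sum_positive_recurrent\<close>
  depends neither on \<open>t\<close> nor on \<open>N\<^sub>0\<close>, so a maximum with
  \<open>N\<^sub>0\<close> serves as \<open>N\<^sub>1\<close>.\<close>

theorem theorem2:
  fixes MX :: "'x measure" and Y :: "nat \<Rightarrow> 'y measure" and M :: nat
    and K :: "'x \<times> (nat \<Rightarrow> 'y) \<Rightarrow> ('x \<times> (nat \<Rightarrow> 'y)) measure"
    and KX :: "'x \<Rightarrow> 'x measure"
    and V :: "'x set" and \<pi> :: "'x measure"
    and L :: "nat \<Rightarrow> 'y \<Rightarrow> real" and f :: "nat \<Rightarrow> 'x \<Rightarrow> real"
    and Q :: "'x \<times> (nat \<Rightarrow> 'y) \<Rightarrow> 'w measure"
    and Z :: "nat \<Rightarrow> 'w \<Rightarrow> 'x \<times> (nat \<Rightarrow> 'y)"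
  assumes M: "1 \<le> M"
    and gen_X: "countably_generated MX"
    and gen_Y: "countably_generated (PiM {1..M} Y)"
    and chain: "markov_kernel (joint_space MX Y M) K"
    and chain_X: "markov_kernel MX KX"
    and A0: "\<forall>z\<in>space (joint_space MX Y M). distr (K z) MX fst = KX (fst z)"
    and A1: "aperiodic MX KX"
    and A2: "positive_recurrent MX KX V"
    and A3: "minorized MX KX V"
    and stat: "stationary MX KX \<pi>"
    and L_meas: "\<forall>i\<in>{1..M}. L i \<in> borel_measurable (Y i)"
    and L_nonneg: "\<forall>i\<in>{1..M}. \<forall>y\<in>space (Y i). 0 \<le> L i y"
    and B1: "cond_B1 MX Y M K L"
    and B: "(cond_B2 MX Y M K \<pi> L f \<and> cond_B3 MX Y M K V L) \<or>
            (chain_version (joint_space MX Y M) K Q Z \<and> cond_Bhat MX Y M Q Z \<pi> L f)"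
  shows "\<exists>t'::nat. \<forall>t\<ge>t'.
    (\<exists>N\<^sub>0>0. drift_threshold MX Y M K V L (drift_rate M \<pi> f) t N\<^sub>0) \<and>
    (\<forall>N\<^sub>0>0. drift_threshold MX Y M K V L (drift_rate M \<pi> f) t N\<^sub>0 \<longrightarrow>
       (\<exists>N\<^sub>1\<ge>N\<^sub>0. positive_recurrent (joint_space MX Y M) K
          (V \<times> {y \<in> space (PiM {1..M} Y). (\<Sum>i=1..M. L i (y i)) \<le> N\<^sub>1})))"
proof -
  let ?S = "joint_space MX Y M"
  let ?l = "level L"
  interpret factor_chain ?S K MX KX V \<pi> fst
    by unfold_locales (use chain chain_X A0 A2 A3 stat in auto)
  have meas: "?l i \<in> borel_measurable ?S" if i: "i \<in> {1..M}" for i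
  proof -
    have "(\<lambda>z. snd z i) \<in> ?S \<rightarrow>\<^sub>M Y i"
      by (rule measurable_compose[OF measurable_snd measurable_component_singleton[OF i]])
    from measurable_compose[OF this L_meas[rule_format, OF i]] show ?thesis
      by (simp only: level_def[abs_def])
  qed
  have snd_space: "snd z \<in> space (PiM {1..M} Y)" if "z \<in> space ?S" for z
    using that by (auto simp: space_pair_measure)
  from B1 obtain U where U: "\<And>i z. i \<in> {1..M} \<Longrightarrow> z \<in> space ?S \<Longrightarrow>
      (\<integral>\<^sup>+\<omega>. ennreal \<bar>?l i (\<omega> 1) - ?l i (\<omega> 0)\<bar> \<partial>chain_law ?S K z) \<le> ennreal U"
    unfolding cond_B1_def SUP_le_iff by blast
  \<comment> \<open>The real \<open>U\<close> might be negative, in which case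
    \<open>ennreal U\<close> is \<open>0\<close>; the maximum keeps real arithmetic consistent with
    this.\<close>
  have level: "level_chain ?S K MX KX V \<pi> fst (?l i) (max U 0)" if i: "i \<in> {1..M}" for i
  proof
    show "?l i \<in> borel_measurable ?S"
      by (rule meas[OF i])
    show "0 \<le> ?l i z" if "z \<in> space ?S" for z
      using L_nonneg i snd_space[OF that] by (auto simp: level_def space_PiM PiE_iff)
    show "(\<integral>\<^sup>+w. ennreal \<bar>?l i w - ?l i z\<bar> \<partial>K z) \<le> ennreal (max U 0)" if z: "z \<in> space ?S" for z
    proof -
      note [measurable] = meas[OF i]
      have "(\<integral>\<^sup>+w. ennreal \<bar>?l i w - ?l i z\<bar> \<partial>K z) = (\<integral>\<^sup>+\<omega>. ennreal \<bar>?l i (\<omega> 1) - ?l i z\<bar> \<partial>chain_law ?S K z)"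
      proof -
        have m: "(\<lambda>w. ennreal \<bar>?l i w - ?l i z\<bar>) \<in> borel_measurable ?S"
          by measurable
        show ?thesis
          using nn_integral_nstep[OF z m, of 1] unfolding nstep_1[OF z] .
      qed
      also have "\<dots> = (\<integral>\<^sup>+\<omega>. ennreal \<bar>?l i (\<omega> 1) - ?l i (\<omega> 0)\<bar> \<partial>chain_law ?S K z)"
        using AE_chain_law_0[OF z meas[OF i]] by (intro nn_integral_cong_AE) (auto elim: eventually_mono)
      also have "\<dots> \<le> ennreal (max U 0)"
        using U[OF i z] by (rule order.trans) (simp add: ennreal_leI)
      finally show ?thesis .
    qed
  qed simp
  define c where "c = drift_rate M \<pi> f"
  have neg: "(\<integral>x. f i x \<partial>\<pi>) < 0" if "i \<in> {1..M}" for i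
    using B that by (auto simp: cond_B2_def cond_Bhat_def)
  \<comment> \<open>The division by ten leaves \<open>c\<close> strictly below every mean drift,
    which is the margin consumed in \<open>mean_increment_drift\<close>.\<close>
  have c: "0 < c" "\<And>i. i \<in> {1..M} \<Longrightarrow> c < - (\<integral>x. f i x \<partial>\<pi>)"
  proof -
    let ?m = "MIN i\<in>{1..M}. - (\<integral>x. f i x \<partial>\<pi>)"
    have m: "0 < ?m"
      using neg M by (subst Min_gr_iff) auto
    then show "0 < c"
      by (simp add: c_def drift_rate_def)
    fix i assume "i \<in> {1..M}"
    then have "?m \<le> - (\<integral>x. f i x \<partial>\<pi>)"
      by (intro Min_le) auto
    with m show "c < - (\<integral>x. f i x \<partial>\<pi>)"
      by (simp add: c_def drift_rate_def)
  qed
  have both: "(\<exists>t0. \<forall>t\<ge>t0. \<exists>N>0. \<forall>z\<in>space ?S. fst z \<in> V \<longrightarrow> N \<le> ?l i z \<longrightarrow>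
        mean_increment ?S K (?l i) t z \<le> - (real t * c)) \<and>
      (\<forall>\<delta>>0. \<exists>t0. \<forall>t\<ge>t0. \<forall>z\<in>space ?S. fst z \<in> V \<longrightarrow> mean_increment ?S K (?l i) t z \<le> real t * \<delta>)"
    if i: "i \<in> {1..M}" for i
  proof -
    interpret level_chain ?S K MX KX V \<pi> fst "?l i" "max U 0"
      by (rule level[OF i])
    from B show ?thesis
    proof
      assume B: "cond_B2 MX Y M K \<pi> L f \<and> cond_B3 MX Y M K V L"
      then obtain C h where bdd: "base.bounded_by C (f i)" and h: "decreases_to_zero h"
        and step: "\<And>z. z \<in> space ?S \<Longrightarrow> mean_increment ?S K (?l i) 1 z \<le> f i (fst z) + h (?l i z)"
        using i unfolding cond_B2_def base.bounded_by_def by blast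
      have "\<exists>t0. \<forall>t\<ge>t0. \<forall>z\<in>space ?S. fst z \<in> V \<longrightarrow> mean_increment ?S K (?l i) t z \<le> real t * \<delta>"
        if \<delta>: "0 < \<delta>" for \<delta> :: real
      proof -
        let ?s = "\<lambda>N::nat. SUP t\<in>{N..}. SUP z\<in>{z \<in> space ?S. fst z \<in> V}.
            ereal (mean_increment ?S K (?l i) t z / real t)"
        have "?s \<longlonglongrightarrow> 0"
          using B i by (simp add: cond_B3_def)
        then have "\<forall>\<^sub>F N in sequentially. ?s N < ereal \<delta>"
          using \<delta> by (intro order_tendstoD(2)) auto
        then obtain N where N: "?s N < ereal \<delta>"
          by (auto simp: eventually_sequentially)
        have "mean_increment ?S K (?l i) t z \<le> real t * \<delta>"
          if t: "max N 1 \<le> t" and z: "z \<in> space ?S" "fst z \<in> V" for t z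
        proof -
          have "ereal (mean_increment ?S K (?l i) t z / real t) \<le> ?s N"
            using t z by (intro SUP_upper2[of t] SUP_upper2[of z]) auto
          then have "ereal (mean_increment ?S K (?l i) t z / real t) < ereal \<delta>"
            using N by (rule order.strict_trans1)
          then show ?thesis
            using t by (simp add: field_simps)
        qed
        then show ?thesis by blast
      qed
      then show ?thesis
        using mean_increment_drift[OF bdd h step c(2)[OF i]] by (intro conjI allI impI)
    next
      assume B: "chain_version ?S K Q Z \<and> cond_Bhat MX Y M Q Z \<pi> L f"
      from bspec[OF conjunct2[OF B, unfolded cond_Bhat_def] i]
      obtain h and \<phi> :: "nat \<Rightarrow> 'x \<Rightarrow> 'w \<Rightarrow> real" and F :: "'x \<Rightarrow> real \<Rightarrow> real" where
        Bhat: "(\<forall>N\<ge>0. 0 \<le> h N) \<and> decreases_to_zero h \<and>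
          (\<forall>z\<in>space ?S.
            prob_space.indep_vars (Q z) (\<lambda>_. borel) (\<lambda>(t, x). \<phi> t x) (UNIV \<times> space MX)) \<and>
          (\<forall>z\<in>space ?S. \<forall>t. uniformly_integrable (Q z) (space MX) (\<phi> t)) \<and>
          (\<forall>z\<in>space ?S. \<forall>t. \<forall>x\<in>space MX. \<forall>u. cdf (distr (Q z) borel (\<phi> t x)) u = F x u) \<and>
          (\<forall>u. (\<lambda>x. F x u) \<in> borel_measurable MX) \<and>
          (\<forall>z\<in>space ?S. \<forall>t. AE w in Q z. ?l i (Z (Suc t) w) - ?l i (Z t w) \<le>
             \<phi> t (fst (Z t w)) w + h (?l i (Z t w))) \<and>
          (\<forall>z\<in>space ?S. \<forall>x\<in>space MX. f i x = (\<integral>w. \<phi> 1 x w \<partial>Q z)) \<and>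
          (\<integral>x. f i x \<partial>\<pi>) < 0"
        by (elim exE) (rule that)
      have h: "decreases_to_zero h"
        and ui: "\<And>z t. z \<in> space ?S \<Longrightarrow> uniformly_integrable (Q z) (space MX) (\<phi> t)"
        and cdf: "\<And>z t x u. z \<in> space ?S \<Longrightarrow> x \<in> space MX \<Longrightarrow> cdf (distr (Q z) borel (\<phi> t x)) u = F x u"
        and F: "\<And>u. (\<lambda>x. F x u) \<in> borel_measurable MX"
        and dom: "\<And>z t. z \<in> space ?S \<Longrightarrow>
          AE w in Q z. ?l i (Z (Suc t) w) - ?l i (Z t w) \<le> \<phi> t (fst (Z t w)) w + h (?l i (Z t w))"
        and f: "\<And>z x. z \<in> space ?S \<Longrightarrow> x \<in> space MX \<Longrightarrow> f i x = (\<integral>w. \<phi> 1 x w \<partial>Q z)"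
        using Bhat by (elim conjE; simp)+
      have ver: "chain_version ?S K Q Z"
        using B by blast
      have dom0: "AE w in Q z. ?l i (Z 1 w) - ?l i (Z 0 w) \<le> \<phi> 0 (fst (Z 0 w)) w + h (?l i (Z 0 w))"
        if "z \<in> space ?S" for z
        using dom[OF that, of 0] by simp
      show ?thesis
        using version_sublinear_drift[OF ver h ui cdf F dom0 f neg[OF i]] c(2)[OF i]
        by (intro conjI allI impI)
    qed
  qed
  have "\<forall>i\<in>{1..M}. \<exists>t0. \<forall>t\<ge>t0. \<exists>N>0. \<forall>z\<in>space ?S. fst z \<in> V \<longrightarrow> N \<le> ?l i z \<longrightarrow>
        mean_increment ?S K (?l i) t z \<le> - (real t * c)"
    by (intro ballI conjunct1[OF both])
  from bchoice[OF this] obtain t1 where t1: "\<forall>i\<in>{1..M}. \<forall>t\<ge>t1 i. \<exists>N>0. \<forall>z\<in>space ?S. fst z \<in> V \<longrightarrow> N \<le> ?l i z \<longrightarrow>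
        mean_increment ?S K (?l i) t z \<le> - (real t * c)"
    by (elim exE) (rule that)
  have "\<exists>N. \<forall>N1\<ge>N. positive_recurrent ?S K {z \<in> space ?S. fst z \<in> V \<and> (\<Sum>i\<in>{1..M}. ?l i z) \<le> N1}"
  proof (rule sum_positive_recurrent[OF _ _ level c(1)])
    show "{1..M} \<noteq> {}"
      using M by simp
    show "\<exists>t0. \<forall>t\<ge>t0. \<exists>N>0. \<forall>z\<in>space ?S. fst z \<in> V \<longrightarrow> N \<le> ?l i z \<longrightarrow>
        mean_increment ?S K (?l i) t z \<le> - (real t * c)" if "i \<in> {1..M}" for i
      using both[OF that] by (rule conjunct1)
    show "\<exists>t0. \<forall>t\<ge>t0. \<forall>z\<in>space ?S. fst z \<in> V \<longrightarrow> mean_increment ?S K (?l i) t z \<le> real t * \<delta>"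
      if "i \<in> {1..M}" "0 < \<delta>" for i \<delta>
      using both[OF that(1), THEN conjunct2, rule_format, OF that(2)] by blast
  qed simp
  then obtain N2 where N2: "\<And>N1. N2 \<le> N1 \<Longrightarrow>
      positive_recurrent ?S K {z \<in> space ?S. fst z \<in> V \<and> (\<Sum>i\<in>{1..M}. ?l i z) \<le> N1}"
    by blast
  have D: "{z \<in> space ?S. fst z \<in> V \<and> (\<Sum>i\<in>{1..M}. ?l i z) \<le> N1} =
      V \<times> {y \<in> space (PiM {1..M} Y). (\<Sum>i=1..M. L i (y i)) \<le> N1}" for N1
    using base.V_space by (auto simp: level_def space_pair_measure)
  show ?thesis
  \<comment> \<open>Sums of nonnegative terms act as common upper bounds, here for the times
    \<open>t1 i\<close> and below for the thresholds \<open>N i\<close>.\<close>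
  proof (intro exI[of _ "\<Sum>i=1..M. t1 i"] allI impI conjI)
    fix t assume t: "(\<Sum>i=1..M. t1 i) \<le> t"
    have "\<forall>i\<in>{1..M}. \<exists>N. 0 < N \<and> (\<forall>z\<in>space ?S. fst z \<in> V \<longrightarrow> N \<le> ?l i z \<longrightarrow>
        mean_increment ?S K (?l i) t z \<le> - (real t * c))"
    proof
      fix i assume i: "i \<in> {1..M}"
      have "t1 i \<le> t"
        using member_le_sum[OF i, of t1] t by simp
      then show "\<exists>N. 0 < N \<and> (\<forall>z\<in>space ?S. fst z \<in> V \<longrightarrow> N \<le> ?l i z \<longrightarrow>
          mean_increment ?S K (?l i) t z \<le> - (real t * c))"
        using t1 i by blast
    qed
    from bchoice[OF this] obtain N where N: "\<forall>i\<in>{1..M}. 0 < N i \<and> (\<forall>z\<in>space ?S. fst z \<in> V \<longrightarrow> N i \<le> ?l i z \<longrightarrow>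
        mean_increment ?S K (?l i) t z \<le> - (real t * c))"
      by (elim exE) (rule that)
    have N0: "0 < N i" if "i \<in> {1..M}" for i
      using N that by blast
    have "0 < (\<Sum>i=1..M. N i)"
      using N0 M by (intro sum_pos) auto
    moreover have "drift_threshold MX Y M K V L (drift_rate M \<pi> f) t (\<Sum>i=1..M. N i)"
      unfolding drift_threshold_def c_def[symmetric]
    proof (intro ballI impI)
      fix i z assume i: "i \<in> {1..M}" and z: "z \<in> space ?S" "fst z \<in> V" "(\<Sum>i=1..M. N i) \<le> ?l i z"
      have "N i \<le> (\<Sum>i=1..M. N i)"
        using N0 by (intro member_le_sum i) (auto intro: less_imp_le)
      then show "mean_increment ?S K (?l i) t z \<le> - (real t * c)"
        using N i z by (meson order.trans)
    qed
    ultimately show "\<exists>N\<^sub>0>0. drift_threshold MX Y M K V L (drift_rate M \<pi> f) t N\<^sub>0"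
      by blast
  next
    fix t and N\<^sub>0 :: real
    show "\<exists>N\<^sub>1\<ge>N\<^sub>0. positive_recurrent ?S K
        (V \<times> {y \<in> space (PiM {1..M} Y). (\<Sum>i=1..M. L i (y i)) \<le> N\<^sub>1})"
      using N2[of "max N\<^sub>0 N2"] unfolding D by (intro exI[of _ "max N\<^sub>0 N2"]) auto
  qed
qed

end
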